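(* For $\boldsymbol\alpha\in\mathbb{R}^2$ and $\tau\in\mathbb{H}$, with $Q(\boldsymbol w):=3w_1^2+w_2^2+3w_1w_2$ and with $H_{2,\boldsymbol\alpha}$, $g_{2,\boldsymbol\alpha}$ as defined in the context, we have $$H_{2,\boldsymbol\alpha}(\tau)=\int_{\mathbb{R}^2}g_{2,\boldsymbol\alpha}(\boldsymbol w)\,e^{2\pi i\tau Q(\boldsymbol w)}\,dw_1dw_2.$$
   Context: $\mathbb{H}$ is the complex upper half-plane; fractional powers are principal branches; integrals up to $i\infty$ are along vertical paths. For $\boldsymbol\alpha=(\alpha_1,\alpha_2)\in\mathbb{R}^2$ and $\boldsymbol w=(w_1,w_2)$ define $$\theta_3(\boldsymbol\alpha;\boldsymbol w):=\sum_{\boldsymbol n\in\boldsymbol\alpha+\mathbb{Z}^2}(2n_1+n_2)\,e^{\frac{3\pi i}{2}(2n_1+n_2)^2w_1+\frac{\pi i n_2^2w_2}{2}},$$ $$\theta_4(\boldsymbol\alpha;\boldsymbol w):=\sum_{\boldsymbol n\in\boldsymbol\alpha+\mathbb{Z}^2}(3n_1+2n_2)\,e^{\frac{\pi i}{2}(3n_1+2n_2)^2w_1+\frac{3\pi i n_1^2w_2}{2}},$$ $$\theta_5(\boldsymbol\alpha;\boldsymbol w):=\sum_{\boldsymbol n\in\boldsymbol\alpha+\mathbb{Z}^2}n_1\,e^{\frac{\pi i}{2}(3n_1+2n_2)^2w_1+\frac{3\pi i n_1^2w_2}{2}},$$ $$H_{2,\boldsymbol\alpha}(\tau):=\frac{\sqrt3\,i}{2\pi}\int_0^{i\infty}\int_{w_1}^{i\infty}\frac{2\theta_3(\boldsymbol\alpha;\boldsymbol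 w)-\theta_4(\boldsymbol\alpha;\boldsymbol w)}{\sqrt{-i(w_1+\tau)}\,(-i(w_2+\tau))^{\frac32}}\,dw_2dw_1+\frac{\sqrt3\,i}{2\pi}\int_0^{i\infty}\int_{w_1}^{i\infty}\frac{\theta_5(\boldsymbol\alpha;\boldsymbol w)}{(-i(w_1+\tau))^{\frac32}\sqrt{-i(w_2+\tau)}}\,dw_2dw_1.$$ For real $\alpha$ and $x$ set $$\mathcal F_\alpha(x):=\frac{\sinh(2\pi x)}{\cosh(2\pi x)-\cos(2\pi\alpha)},\qquad \mathcal G_\alpha(x):=\frac{\sin(2\pi\alpha)}{\cosh(2\pi x)-\cos(2\pi\alpha)},\qquad \mathcal G_\alpha^*(x):=x\,\mathcal G_\alpha(x),$$ and $$g_{2,\boldsymbol\alpha}(\boldsymbol w):=\begin{cases}-2iw_2\left(\mathcal G_{\alpha_1}(w_1)\mathcal F_{\alpha_2}(w_2)+\mathcal F_{\alpha_1}(w_1)\mathcal G_{\alpha_2}(w_2)\right)&\text{if }\alpha_1\notin\mathbb{Z},\\ -2i\left(\mathcal F_0(w_1)\mathcal G^*_{\alpha_2}(w_2)-\frac{1}{\pi w_1}\mathcal G^*_{\alpha_2}\left(w_2+\frac{3w_1}{2}\right)\right)&\text{if }\alpha_1\in\mathbb{Z}.\end{cases}$$ *)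

theory Defs
  imports "HOL-Analysis.Analysis"
begin

definition shifted_lattice :: "real \<times> real \<Rightarrow> (real \<times> real) set" where
  "shifted_lattice \<alpha> = (\<lambda>m. \<alpha> + m) ` (\<int> \<times> \<int>)"

definition theta3 :: "real \<times> real \<Rightarrow> complex \<times> complex \<Rightarrow> complex" where
  "theta3 \<alpha> = (\<lambda>(w\<^sub>1, w\<^sub>2). \<Sum>\<^sub>\<infinity>(n\<^sub>1, n\<^sub>2)\<in>shifted_lattice \<alpha>.
     of_real (2 * n\<^sub>1 + n\<^sub>2) *
     exp (3 * pi * \<i> / 2 * of_real ((2 * n\<^sub>1 + n\<^sub>2)\<^sup>2) * w\<^sub>1 + pi * \<i> * of_real (n\<^sub>2\<^sup>2) * w\<^sub>2 / 2))"

definition theta4 :: "real \<times> real \<Rightarrow> complex \<times> complex \<Rightarrow> complex" where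
  "theta4 \<alpha> = (\<lambda>(w\<^sub>1, w\<^sub>2). \<Sum>\<^sub>\<infinity>(n\<^sub>1, n\<^sub>2)\<in>shifted_lattice \<alpha>.
     of_real (3 * n\<^sub>1 + 2 * n\<^sub>2) *
     exp (pi * \<i> / 2 * of_real ((3 * n\<^sub>1 + 2 * n\<^sub>2)\<^sup>2) * w\<^sub>1 + 3 * pi * \<i> * of_real (n\<^sub>1\<^sup>2) * w\<^sub>2 / 2))"

definition theta5 :: "real \<times> real \<Rightarrow> complex \<times> complex \<Rightarrow> complex" where
  "theta5 \<alpha> = (\<lambda>(w\<^sub>1, w\<^sub>2). \<Sum>\<^sub>\<infinity>(n\<^sub>1, n\<^sub>2)\<in>shifted_lattice \<alpha>.
     of_real n\<^sub>1 *
     exp (pi * \<i> / 2 * of_real ((3 * n\<^sub>1 + 2 * n\<^sub>2)\<^sup>2) * w\<^sub>1 + 3 * pi * \<i> * of_real (n\<^sub>1\<^sup>2) * w\<^sub>2 / 2))"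

text \<open>
  The integral of \<open>f\<close> from \<open>a\<close> up to \<open>i\<infinity>\<close> along the vertical ray \<open>w = a + i t\<close>, \<open>t > 0\<close>;
  the leading factor comes from \<open>dw = i dt\<close>.
\<close>
definition vertical_integral :: "complex \<Rightarrow> (complex \<Rightarrow> complex) \<Rightarrow> complex" where
  "vertical_integral a f = \<i> * (LBINT t:{0<..}. f (a + \<i> * of_real t))"

text \<open>
  Both \<open>csqrt\<close> and complex \<open>powr\<close> are the principal branches; on the paths of integration
  \<open>- \<i> * (w + \<tau>)\<close> lies in the right half-plane.
\<close>
definition H2 :: "real \<times> real \<Rightarrow> complex \<Rightarrow> complex" where
  "H2 \<alpha> \<tau> =
     of_real (sqrt 3) * \<i> / (2 * pi) *
       vertical_integral 0 (\<lambda>w\<^sub>1. vertical_integral w\<^sub>1 (\<lambda>w\<^sub>2.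
         (2 * theta3 \<alpha> (w\<^sub>1, w\<^sub>2) - theta4 \<alpha> (w\<^sub>1, w\<^sub>2)) /
         (csqrt (- \<i> * (w\<^sub>1 + \<tau>)) * (- \<i> * (w\<^sub>2 + \<tau>)) powr (3 / 2))))
   + of_real (sqrt 3) * \<i> / (2 * pi) *
       vertical_integral 0 (\<lambda>w\<^sub>1. vertical_integral w\<^sub>1 (\<lambda>w\<^sub>2.
         theta5 \<alpha> (w\<^sub>1, w\<^sub>2) /
         ((- \<i> * (w\<^sub>1 + \<tau>)) powr (3 / 2) * csqrt (- \<i> * (w\<^sub>2 + \<tau>)))))"

definition \<F> :: "real \<Rightarrow> real \<Rightarrow> real" where
  "\<F> a x = sinh (2 * pi * x) / (cosh (2 * pi * x) - cos (2 * pi * a))"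

definition \<G> :: "real \<Rightarrow> real \<Rightarrow> real" where
  "\<G> a x = sin (2 * pi * a) / (cosh (2 * pi * x) - cos (2 * pi * a))"

definition Gstar :: "real \<Rightarrow> real \<Rightarrow> real" where
  "Gstar a x = x * \<G> a x"

text \<open>
  The quotients in \<open>g2\<close> are undefined only where \<open>w\<^sub>1 = 0\<close>, \<open>w\<^sub>2 = 0\<close> or
  \<open>w\<^sub>2 + 3 * w\<^sub>1 / 2 = 0\<close>. These null sets do not affect the integral over the plane, so the
  value 0 of division by zero there is harmless.
\<close>
definition g2 :: "real \<times> real \<Rightarrow> real \<times> real \<Rightarrow> complex" where
  "g2 = (\<lambda>(\<alpha>\<^sub>1, \<alpha>\<^sub>2) (w\<^sub>1, w\<^sub>2).
     if \<alpha>\<^sub>1 \<notin> \<int> then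
       - 2 * \<i> * of_real w\<^sub>2 * of_real (\<G> \<alpha>\<^sub>1 w\<^sub>1 * \<F> \<alpha>\<^sub>2 w\<^sub>2 + \<F> \<alpha>\<^sub>1 w\<^sub>1 * \<G> \<alpha>\<^sub>2 w\<^sub>2)
     else
       - 2 * \<i> * of_real (\<F> 0 w\<^sub>1 * Gstar \<alpha>\<^sub>2 w\<^sub>2 - 1 / (pi * w\<^sub>1) * Gstar \<alpha>\<^sub>2 (w\<^sub>2 + 3 * w\<^sub>1 / 2)))"

definition Q :: "real \<times> real \<Rightarrow> real" where
  "Q = (\<lambda>(w\<^sub>1, w\<^sub>2). 3 * w\<^sub>1\<^sup>2 + w\<^sub>2\<^sup>2 + 3 * w\<^sub>1 * w\<^sub>2)"

end

theory Submission
  imports Defs "HOL-Probability.Distributions"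
begin

text \<open>
  Truncate the lattice sums to the finitely many \<open>n\<close> with \<open>Q n \<le> N\<close>. For a single \<open>n\<close>, Gaussian moments
  turn the weights \<open>(t + s)\<^sup>-\<^sup>1\<^sup>/\<^sup>2\<close> and \<open>(v + s)\<^sup>-\<^sup>3\<^sup>/\<^sup>2\<close>, where \<open>s = - i \<tau>\<close>, into integrals over a line. Integrating
  out the two vertical variables leaves a plane integral of a rational kernel against
  \<open>exp (2 \<pi> i \<tau> Q w)\<close>. Up to kernels that are odd under a reflection preserving \<open>Q\<close>, and hence integrate to
  zero, the three theta kernels of \<open>n\<close> combine to one rational function, which for \<open>a \<noteq> 0\<close> is
  \<open>(a y\<^sup>2 + b x y) / ((a\<^sup>2 + x\<^sup>2) (b\<^sup>2 + y\<^sup>2))\<close>, with \<open>n = (a, b)\<close> and \<open>w = (x, y)\<close>. Sums of it over \<open>Q n \<le> N\<close>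
  converge to a constant multiple of \<open>g2\<close> by the partial fractions of the cotangent.

  Absolute values of the summands do not give an integrable majorant. The truncation by \<open>Q\<close> repairs this:
  its sections in the relevant lattice directions are windows, symmetric
  for the numerators of the theta series and nearly symmetric for the cotangent sums, so that the numerators
  cancel and all partial sums have an integrable majorant.
\<close>

section \<open>Complex Gaussian integrals\<close>

text \<open>For t > 0 the theta series converge absolutely, but the sum of |p| exp (- c p^2 t) is of
  order 1/t, which is not integrable at 0. On the plane side the terms decay along one lattice
  direction only like 1/|a|. One order of summation has to suit all these sums at once. Q does,
  because 4 Q (a, b) = 3 (2a + b)^2 + b^2 = (3a + 2b)^2 + 3 a^2. Fixing one of two squares leaves a
  window symmetric in the root of the other, and the numerators 2a + b, 3a + 2b and a of the three
  theta series are such roots. The cancellation lowers 1/t to t^(-1/2). The cotangent sums run along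
  the coordinate axes instead, where the windows of Q are centred off the origin by b/2 or 3a/2. The
  loss is bounded by the square root of this offset, which is still summable against the other,
  absolutely convergent factor.\<close>

lemma integral_Ioi_FTC:
  fixes F f :: "real \<Rightarrow> 'a::euclidean_space"
  assumes F: "\<And>x. (F has_vector_derivative f x) (at x)"
    and cont: "\<And>x. isCont f x"
    and int: "set_integrable lborel {a<..} f"
    and lim: "(F \<longlongrightarrow> B) at_top"
  shows "(LBINT x:{a<..}. f x) = B - F a"
proof -
  have "(LBINT x=ereal a..\<infinity>. f x) = B - F a"
  proof (rule interval_integral_FTC_integrable)
    show "set_integrable lborel (einterval (ereal a) \<infinity>) f"
      using int by simp
    have "isCont F a"
      using F has_vector_derivative_continuous by blast
    then show "((F \<circ> real_of_ereal) \<longlongrightarrow> F a) (at_right (ereal a))"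
      by (simp add: ereal_tendsto_simps filterlim_at_split isCont_def)
    show "((F \<circ> real_of_ereal) \<longlongrightarrow> B) (at_left \<infinity>)"
      using lim by (simp add: ereal_tendsto_simps)
  qed (use F cont in auto)
  then show ?thesis
    by (simp add: interval_integral_to_infinity_eq)
qed

lemma integrable_power_gauss:
  fixes r :: real
  assumes "r > 0"
  shows "integrable lborel (\<lambda>x::real. x ^ k * exp (- r * x\<^sup>2))"
proof -
  \<comment> \<open>The standard normal density has exponent - x^2 / 2, so scaling by a root of 2 r
    produces - r x^2.\<close>
  define c where "c = sqrt (2 * r)"
  have c: "c > 0" "c\<^sup>2 = 2 * r"
    using assms by (auto simp: c_def)
  have "integrable lborel (\<lambda>x. std_normal_density (0 + c * x) * (0 + c * x) ^ k)"
    using c by (intro lborel_integrable_real_affine integrable_std_normal_moment) auto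
  then have "integrable lborel (\<lambda>x. sqrt (2 * pi) / c ^ k * (std_normal_density (c * x) * (c * x) ^ k))"
    by simp
  moreover have "sqrt (2 * pi) / c ^ k * (std_normal_density (c * x) * (c * x) ^ k) = x ^ k * exp (- r * x\<^sup>2)" for x
    using c by (simp add: std_normal_density_def power_mult_distrib field_simps)
  ultimately show ?thesis
    by simp
qed

lemma integrable_power_cgauss:
  assumes "Re z > 0"
  shows "integrable lborel (\<lambda>x::real. of_real (x ^ k) * exp (- z * of_real (x\<^sup>2)))"
proof (rule Bochner_Integration.integrable_bound)
  show "integrable lborel (\<lambda>x. x ^ k * exp (- Re z * x\<^sup>2))"
    by (rule integrable_power_gauss[OF assms])
qed (auto simp: norm_mult abs_mult power_abs norm_exp_eq_Re simp flip: of_real_power intro!: AE_I2)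

text \<open>These are boundary terms of the integrations below: k = 0 for the moment of |x|, k = 1
  for the integration by parts. The inequality y \<le> exp y already gives decay like 1/|x|.\<close>

lemma power_cgauss_tendsto_0:
  assumes "Re w > 0" "k \<le> 1"
  shows "((\<lambda>x::real. of_real (x ^ k) * exp (- w * of_real (x\<^sup>2))) \<longlongrightarrow> 0) at_top"
    "((\<lambda>x::real. of_real (x ^ k) * exp (- w * of_real (x\<^sup>2))) \<longlongrightarrow> 0) at_bot"
proof -
  have bound: "norm (of_real (x ^ k) * exp (- w * of_real (x\<^sup>2))) \<le> norm (1 / (Re w * x))"
    if "\<bar>x\<bar> \<ge> 1" for x :: real
  proof -
    have "Re w * x\<^sup>2 \<le> exp (Re w * x\<^sup>2)"
      using exp_ge_add_one_self[of "Re w * x\<^sup>2"] by linarith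
    moreover have "\<bar>x\<bar> ^ k \<le> \<bar>x\<bar>"
      using power_increasing[OF assms(2) that] by simp
    moreover have "\<bar>x\<bar> * (Re w * \<bar>x\<bar>) = Re w * x\<^sup>2"
      by (simp add: power2_eq_square mult.left_commute[of "\<bar>x\<bar>"])
    moreover have "\<bar>x\<bar> ^ k * (Re w * \<bar>x\<bar>) \<le> \<bar>x\<bar> * (Re w * \<bar>x\<bar>)"
      using assms(1) \<open>\<bar>x\<bar> ^ k \<le> \<bar>x\<bar>\<close> by (intro mult_right_mono) auto
    ultimately have "\<bar>x\<bar> ^ k * (Re w * \<bar>x\<bar>) \<le> exp (Re w * x\<^sup>2)"
      by linarith
    then have "\<bar>x\<bar> ^ k * exp (- (Re w * x\<^sup>2)) \<le> 1 / (Re w * \<bar>x\<bar>)"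
      using that assms by (simp add: exp_minus field_simps)
    then show ?thesis
      using assms by (simp add: norm_mult norm_exp_eq_Re norm_power norm_divide abs_mult)
  qed
  have lim: "((\<lambda>x. 1 / (Re w * x)) \<longlongrightarrow> 0) at_top" "((\<lambda>x. 1 / (Re w * x)) \<longlongrightarrow> 0) at_bot"
  proof -
    show "((\<lambda>x. 1 / (Re w * x)) \<longlongrightarrow> 0) at_top"
      using assms(1) by (intro tendsto_divide_0[OF tendsto_const] filterlim_at_top_imp_at_infinity
          filterlim_tendsto_pos_mult_at_top[OF tendsto_const]) (auto intro: filterlim_ident)
    show "((\<lambda>x. 1 / (Re w * x)) \<longlongrightarrow> 0) at_bot"
      using assms(1) by (intro tendsto_divide_0[OF tendsto_const] filterlim_at_bot_imp_at_infinity
          filterlim_tendsto_pos_mult_at_bot[OF tendsto_const]) (auto intro: filterlim_ident)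
  qed
  have ev: "eventually (\<lambda>x::real. \<bar>x\<bar> \<ge> 1) at_top" "eventually (\<lambda>x::real. \<bar>x\<bar> \<ge> 1) at_bot"
    by (rule eventually_mono[OF eventually_ge_at_top[of "1::real"]], simp,
        rule eventually_mono[OF eventually_le_at_bot[of "-1::real"]], simp)
  show "((\<lambda>x::real. of_real (x ^ k) * exp (- w * of_real (x\<^sup>2))) \<longlongrightarrow> 0) at_top"
    by (rule Lim_null_comparison[OF eventually_mono[OF ev(1)] tendsto_norm_zero[OF lim(1)]]) (rule bound)
  show "((\<lambda>x::real. of_real (x ^ k) * exp (- w * of_real (x\<^sup>2))) \<longlongrightarrow> 0) at_bot"
    by (rule Lim_null_comparison[OF eventually_mono[OF ev(2)] tendsto_norm_zero[OF lim(2)]]) (rule bound)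
qed

lemma cgauss_has_vector_derivative:
  fixes w :: complex
  shows "((\<lambda>x::real. exp (- w * of_real (x\<^sup>2))) has_vector_derivative (- 2 * w * of_real x * exp (- w * of_real (x\<^sup>2)))) (at x)"
proof -
  have "((\<lambda>z. exp (- w * z\<^sup>2)) has_field_derivative (- 2 * w * of_real x * exp (- w * (of_real x)\<^sup>2))) (at (of_real x))"
    by (auto intro!: derivative_eq_intros)
  from has_vector_derivative_real_field[OF this] show ?thesis
    by simp
qed

text \<open>The weight |x| is the Jacobian of the substitution y = x s in the squared Gaussian
  integral. On each half line it makes the integrand an exact derivative, so complex w is handled
  without moving a contour.\<close>

lemma integral_abs_cgauss:
  assumes "Re w > 0"
  shows "integrable lborel (\<lambda>x::real. of_real \<bar>x\<bar> * exp (- w * of_real (x\<^sup>2)))"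
    and "(LBINT x. of_real \<bar>x\<bar> * exp (- w * of_real (x\<^sup>2))) = 1 / w"
proof -
  let ?g = "\<lambda>x::real. of_real \<bar>x\<bar> * exp (- w * of_real (x\<^sup>2))"
  show int: "integrable lborel ?g"
    using Bochner_Integration.integrable_bound[OF integrable_power_cgauss[OF assms, of 1], of ?g]
    by (simp add: norm_mult)
  have w: "w \<noteq> 0"
    using assms by auto
  have half: "(LBINT x:{0<..}. of_real x * exp (- w * of_real (x\<^sup>2))) = 1 / (2 * w)"
  proof -
    have "(LBINT x:{0<..}. of_real x * exp (- w * of_real (x\<^sup>2))) = 0 - (- 1 / (2 * w)) * exp (- w * of_real (0\<^sup>2))"
    proof (rule integral_Ioi_FTC[where F = "\<lambda>x. (- 1 / (2 * w)) * exp (- w * of_real (x\<^sup>2))"])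
      show "((\<lambda>x. (- 1 / (2 * w)) * exp (- w * of_real (x\<^sup>2))) has_vector_derivative
              of_real x * exp (- w * of_real (x\<^sup>2))) (at x)" for x :: real
        using has_vector_derivative_mult_right[OF cgauss_has_vector_derivative[of w x], of "- 1 / (2 * w)"] w
        by simp
      show "set_integrable lborel {0<..} (\<lambda>x::real. of_real x * exp (- w * of_real (x\<^sup>2)))"
        using integrable_power_cgauss[OF assms, of 1] unfolding set_integrable_def
        by (intro integrable_mult_indicator) auto
      show "((\<lambda>x. (- 1 / (2 * w)) * exp (- w * of_real (x\<^sup>2))) \<longlongrightarrow> 0) at_top"
        using tendsto_mult_right_zero[OF power_cgauss_tendsto_0(1)[OF assms, of 0], of "- 1 / (2 * w)"] by simp
    qed (auto intro!: continuous_intros)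
    then show ?thesis by simp
  qed
  have ae: "AE x in lborel. ?g x = indicator {0<..} x *\<^sub>R ?g x + indicator {0<..} (-x) *\<^sub>R ?g (-x)"
    using AE_lborel_singleton[of "0::real"] by eventually_elim (auto simp: indicator_def)
  have pos: "(LBINT x. indicator {0<..} x *\<^sub>R ?g x) = 1 / (2 * w)"
    unfolding half[symmetric] set_lebesgue_integral_def
    by (intro Bochner_Integration.integral_cong) (auto simp: indicator_def)
  have intp: "integrable lborel (\<lambda>x. indicator {0<..} x *\<^sub>R ?g x)"
    by (intro integrable_mult_indicator int) auto
  have intn: "integrable lborel (\<lambda>x. indicator {0<..} (-x) *\<^sub>R ?g (-x))"
    using lborel_integrable_real_affine[OF intp, of "-1" 0] by simp
  have neg: "(LBINT x. indicator {0<..} (-x) *\<^sub>R ?g (-x)) = (LBINT x. indicator {0<..} x *\<^sub>R ?g x)"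
    using lborel_integral_real_affine[of "-1" "\<lambda>x. indicator {0<..} x *\<^sub>R ?g x" 0] by simp
  have "(LBINT x. ?g x) = (LBINT x. indicator {0<..} x *\<^sub>R ?g x + indicator {0<..} (-x) *\<^sub>R ?g (-x))"
    by (intro integral_cong_AE ae) (auto intro!: borel_measurable_integrable intp intn int)
  also have "\<dots> = (LBINT x. indicator {0<..} x *\<^sub>R ?g x) + (LBINT x. indicator {0<..} (-x) *\<^sub>R ?g (-x))"
    by (rule Bochner_Integration.integral_add[OF intp intn])
  also have "\<dots> = 1 / w"
    using w unfolding neg pos by (simp add: field_simps)
  finally show "(LBINT x. ?g x) = 1 / w" .
qed

lemma integral_inverse_1_plus_square:
  "integrable lborel (\<lambda>s::real. 1 / (1 + s\<^sup>2))" "(LBINT s. 1 / (1 + s\<^sup>2)) = (pi::real)"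
proof -
  have *: "set_integrable lborel (einterval (-\<infinity>) \<infinity>) (\<lambda>s::real. 1 / (1 + s\<^sup>2))"
    "(LBINT s=-\<infinity>..\<infinity>. 1 / (1 + s\<^sup>2)) = pi / 2 - (- (pi / 2))"
    by (rule interval_integral_FTC_nonneg[where F = arctan];
        auto intro!: derivative_eq_intros continuous_intros tendsto_arctan_at_top tendsto_arctan_at_bot
          simp: ereal_tendsto_simps add_nonneg_eq_0_iff field_simps)+
  then show "integrable lborel (\<lambda>s::real. 1 / (1 + s\<^sup>2))" "(LBINT s. 1 / (1 + s\<^sup>2)) = (pi::real)"
    by (auto simp: set_integrable_def interval_lebesgue_integral_def set_lebesgue_integral_def)
qed

definition gauss_int :: "complex \<Rightarrow> complex" where
  "gauss_int z = (LBINT x. exp (- z * of_real (x\<^sup>2)))"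

text \<open>The substitution \<open>y = x s\<close> turns the square of the integral into
  \<open>\<integral>\<integral> \<bar>x\<bar> exp (- z x\<^sup>2 (1 + s\<^sup>2))\<close>.\<close>
lemma gauss_int_square:
  assumes "Re z > 0"
  shows "(gauss_int z)\<^sup>2 = of_real pi / z"
proof -
  let ?e = "\<lambda>x::real. exp (- z * of_real (x\<^sup>2))"
  let ?f = "\<lambda>x s::real. of_real \<bar>x\<bar> * exp (- (z * of_real (1 + s\<^sup>2)) * of_real (x\<^sup>2))"
  have pos: "Re (z * of_real (1 + s\<^sup>2)) > 0" for s :: real
    using assms by (simp add: add_pos_nonneg)
  have "(gauss_int z)\<^sup>2 = (LBINT x. ?e x * gauss_int z)"
    by (simp add: power2_eq_square gauss_int_def)
  also have "\<dots> = (LBINT x. (LBINT s. ?f x s))"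
  proof (rule integral_cong_AE)
    show "AE x in lborel. ?e x * gauss_int z = (LBINT s. ?f x s)"
      using AE_lborel_singleton[of "0::real"]
    proof eventually_elim
      case (elim x)
      have "gauss_int z = \<bar>x\<bar> *\<^sub>R (LBINT s. exp (- z * of_real ((0 + x * s)\<^sup>2)))"
        unfolding gauss_int_def using elim by (rule lborel_integral_real_affine)
      then have "?e x * gauss_int z = (LBINT s. ?e x * of_real \<bar>x\<bar> * exp (- z * of_real ((0 + x * s)\<^sup>2)))"
        by (simp add: scaleR_conv_of_real)
      also have "\<dots> = (LBINT s. ?f x s)"
        by (intro Bochner_Integration.integral_cong) (auto simp: power2_eq_square algebra_simps exp_add exp_diff exp_minus field_simps)
      finally show ?case .
    qed
  qed measurable
  also have "\<dots> = (LBINT s. (LBINT x. ?f x s))"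
  proof (rule lborel_pair.Fubini_integral[symmetric])
    have "integrable (lborel \<Otimes>\<^sub>M lborel) (\<lambda>(s, x). ?f x s)"
    proof (rule lborel_pair.Fubini_integrable)
      show "integrable lborel (\<lambda>s. LBINT x. norm (case (s, x) of (s, x) \<Rightarrow> ?f x s))"
      proof -
        have "(LBINT x. norm (?f x s)) = 1 / Re z * (1 / (1 + s\<^sup>2))" for s
        proof -
          have "complex_of_real (LBINT x. norm (?f x s)) = (LBINT x. of_real (norm (?f x s)))"
            by simp
          also have "\<dots> = (LBINT x. of_real \<bar>x\<bar> * exp (- of_real (Re (z * of_real (1 + s\<^sup>2))) * of_real (x\<^sup>2)))"
            by (intro Bochner_Integration.integral_cong refl)
               (simp add: norm_mult norm_exp_eq_Re exp_of_real[symmetric])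
          also have "\<dots> = 1 / of_real (Re (z * of_real (1 + s\<^sup>2)))"
            using pos by (intro integral_abs_cgauss) simp
          also have "\<dots> = of_real (1 / Re z * (1 / (1 + s\<^sup>2)))"
            by simp
          finally show ?thesis
            unfolding of_real_eq_iff .
        qed
        then show ?thesis
          using integral_inverse_1_plus_square(1) by (simp only: prod.case integrable_mult_right)
      qed
      show "AE s in lborel. integrable lborel (\<lambda>x. case (s, x) of (s, x) \<Rightarrow> ?f x s)"
        using integral_abs_cgauss(1)[OF pos] by (intro AE_I2) simp
    qed measurable
    then show "integrable (lborel \<Otimes>\<^sub>M lborel) (\<lambda>(x, s). ?f x s)"
      by (subst (asm) lborel_pair.integrable_product_swap_iff[symmetric]) (simp add: case_prod_unfold)
  qed
  also have "\<dots> = (LBINT s. 1 / z * of_real (1 / (1 + s\<^sup>2)))"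
    using integral_abs_cgauss(2)[OF pos] by simp
  also have "\<dots> = of_real pi / z"
    using integral_inverse_1_plus_square(2) by (simp only: integral_mult_right_zero integral_complex_of_real) simp
  finally show ?thesis .
qed

lemma continuous_on_gauss_int:
  assumes "r > 0"
  shows "continuous_on {z. Re z \<ge> r} gauss_int"
  unfolding continuous_on_sequentially
proof safe
  fix u :: "nat \<Rightarrow> complex" and z
  assume u: "\<forall>n. u n \<in> {z. Re z \<ge> r}" "u \<longlonglongrightarrow> z"
  show "(gauss_int \<circ> u) \<longlonglongrightarrow> gauss_int z"
    unfolding gauss_int_def comp_def
  proof (rule integral_dominated_convergence)
    show "integrable lborel (\<lambda>x::real. exp (- r * x\<^sup>2))"
      using integrable_power_gauss[OF assms, of 0] by simp
    show "AE x in lborel. (\<lambda>n. exp (- u n * of_real (x\<^sup>2))) \<longlonglongrightarrow> exp (- z * of_real (x\<^sup>2))"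
      by (intro AE_I2 tendsto_intros u)
    show "AE x in lborel. norm (exp (- u n * of_real (x\<^sup>2))) \<le> exp (- r * x\<^sup>2)" for n
      using u by (intro AE_I2) (auto simp: norm_exp_eq_Re mult_right_mono)
  qed measurable
qed

lemma gauss_int_1: "gauss_int 1 = of_real (sqrt pi)"
proof -
  have "(LBINT x. std_normal_density (0 + sqrt 2 * x)) = 1 / sqrt 2"
    using lborel_integral_real_affine[of "sqrt 2" std_normal_density 0] by (simp add: field_simps)
  moreover have "std_normal_density (0 + sqrt 2 * x) = exp (- (x\<^sup>2)) / sqrt (2 * pi)" for x
    by (simp add: std_normal_density_def power_mult_distrib)
  ultimately have "(LBINT x::real. exp (- (x\<^sup>2))) / sqrt (2 * pi) = 1 / sqrt 2"
    by simp
  then have "(LBINT x::real. exp (- (x\<^sup>2))) = sqrt pi"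
    by (simp add: field_simps real_sqrt_mult)
  moreover have "gauss_int 1 = of_real (LBINT x::real. exp (- (x\<^sup>2)))"
    unfolding gauss_int_def by (simp flip: integral_complex_of_real exp_of_real)
  ultimately show ?thesis
    by simp
qed

text \<open>The square determines the integral up to sign. The quotient \<open>h\<close> by the
  claimed value takes only the values 1 and -1 and is continuous on the segment from 1 to z, which
  stays in Re \<ge> min 1 (Re z). Hence it is constant, and its value at 1 selects the principal
  branch.\<close>

lemma gauss_int_eq:
  assumes "Re z > 0"
  shows "gauss_int z = of_real (sqrt pi) / csqrt z"
proof -
  define r where "r = min 1 (Re z)"
  define h where "h = (\<lambda>w. gauss_int w * csqrt w / of_real (sqrt pi))"
  have r: "r > 0"
    using assms by (simp add: r_def)
  have seg: "w \<in> {z. Re z \<ge> r}" if "w \<in> closed_segment 1 z" for w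
  proof -
    have "convex {z. Re z \<ge> r}"
      by (rule convex_halfspace_Re_ge)
    then show ?thesis
      using that closed_segment_subset[of 1 "{z. Re z \<ge> r}" z] by (auto simp: r_def)
  qed
  have sq: "(h w)\<^sup>2 = 1" if "w \<in> closed_segment 1 z" for w
  proof -
    have "Re w > 0"
      using seg[OF that] r by simp
    moreover from this have "w \<noteq> 0"
      by auto
    ultimately show ?thesis
      using gauss_int_square[of w] by (simp add: h_def power_mult_distrib power_divide flip: of_real_power)
  qed
  have "continuous_on (closed_segment 1 z) csqrt"
  proof (rule continuous_on_subset[of "{z. Re z \<ge> r}"])
    show "continuous_on {z. Re z \<ge> r} csqrt"
    proof (rule continuous_at_imp_continuous_on, safe)
      fix w assume "Re w \<ge> r"
      then have "w \<notin> \<real>\<^sub>\<le>\<^sub>0"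
        using r by (auto simp: complex_nonpos_Reals_iff)
      then show "isCont csqrt w"
        by (rule continuous_at_csqrt)
    qed
  qed (use seg in auto)
  then have cont: "continuous_on (closed_segment 1 z) h"
    unfolding h_def
    by (intro continuous_intros continuous_on_subset[OF continuous_on_gauss_int[OF r]]) (use seg in auto)
  have "h constant_on closed_segment 1 z"
  proof (rule continuous_finite_range_constant)
    have "h ` closed_segment 1 z \<subseteq> {1, -1}"
      using sq by (auto simp: power2_eq_1_iff)
    then show "finite (h ` closed_segment 1 z)"
      by (rule finite_subset) simp
  qed (use cont in auto)
  then have "h z = h 1"
    unfolding constant_on_def by (metis ends_in_segment)
  also have "\<dots> = 1"
    by (simp add: h_def gauss_int_1)
  finally have "gauss_int z * csqrt z = of_real (sqrt pi)"
    by (simp add: h_def field_simps)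
  moreover have "csqrt z \<noteq> 0"
    using assms by auto
  ultimately show ?thesis
    by (simp add: nonzero_eq_divide_eq)
qed

section \<open>Gaussian moments representing the exponents 1/2 and 3/2\<close>

text \<open>Used from left to right: a power of z in the weight is opened into a Gaussian integral.
  The free scale c is later chosen so that the exponents add up to 2 \<pi> Q.\<close>

lemma cgauss_moment_0:
  assumes "Re z > 0" "c > 0"
  shows "1 / csqrt z = of_real (sqrt (c / pi)) * (LBINT x. exp (- z * of_real (c * x\<^sup>2)))"
proof -
  have "gauss_int z = sqrt c *\<^sub>R (LBINT x. exp (- z * of_real ((0 + sqrt c * x)\<^sup>2)))"
    unfolding gauss_int_def using lborel_integral_real_affine[of "sqrt c"  "\<lambda>x. exp (- z * of_real (x\<^sup>2))" 0] assms
    by simp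
  then have "gauss_int z = of_real (sqrt c) * (LBINT x. exp (- z * of_real (c * x\<^sup>2)))"
    using assms by (simp add: power_mult_distrib scaleR_conv_of_real flip: of_real_power)
  then show ?thesis
    unfolding gauss_int_eq[OF assms(1)] by (simp add: real_sqrt_divide field_simps)
qed

lemma cgauss_moment_2_aux:
  assumes "Re z > 0"
  shows "gauss_int z = 2 * z * (LBINT x. of_real (x\<^sup>2) * exp (- z * of_real (x\<^sup>2)))"
proof -
  let ?e = "\<lambda>x::real. exp (- z * of_real (x\<^sup>2))"
  note i0 = integrable_power_cgauss[OF assms, of 0, simplified]
  note i2 = integrable_power_cgauss[OF assms, of 2]
  have int: "integrable lborel (\<lambda>x. ?e x - 2 * z * (of_real (x\<^sup>2) * ?e x))"
    using i0 i2 by simp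
  \<comment> \<open>Integration by parts: x exp (- z x^2) vanishes at both ends, and its derivative
    is the difference of the two integrands.\<close>
  have "(LBINT x=-\<infinity>..\<infinity>. ?e x - 2 * z * (of_real (x\<^sup>2) * ?e x)) = 0 - 0"
  proof (rule interval_integral_FTC_integrable)
    show "((\<lambda>x. of_real x * ?e x) has_vector_derivative ?e x - 2 * z * (of_real (x\<^sup>2) * ?e x)) (at x)" for x
    proof -
      have "((\<lambda>w. w * exp (- z * w\<^sup>2)) has_field_derivative ?e x - 2 * z * (of_real (x\<^sup>2) * ?e x)) (at (of_real x))"
        by (auto intro!: derivative_eq_intros simp: algebra_simps power2_eq_square)
      from has_vector_derivative_real_field[OF this] show ?thesis
        by simp
    qed
    show "set_integrable lborel (einterval (-\<infinity>) \<infinity>) (\<lambda>x. ?e x - 2 * z * (of_real (x\<^sup>2) * ?e x))"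
      using int by (simp add: set_integrable_def)
    show "(((\<lambda>x. of_real x * ?e x) \<circ> real_of_ereal) \<longlongrightarrow> 0) (at_right (-\<infinity>))"
      using power_cgauss_tendsto_0(2)[OF assms, of 1] by (simp add: ereal_tendsto_simps)
    show "(((\<lambda>x. of_real x * ?e x) \<circ> real_of_ereal) \<longlongrightarrow> 0) (at_left \<infinity>)"
      using power_cgauss_tendsto_0(1)[OF assms, of 1] by (simp add: ereal_tendsto_simps)
  qed (auto intro!: continuous_intros)
  then have "(LBINT x. ?e x - 2 * z * (of_real (x\<^sup>2) * ?e x)) = 0"
    by (simp add: interval_lebesgue_integral_def set_lebesgue_integral_def)
  then have "(LBINT x. ?e x) = (LBINT x. 2 * z * (of_real (x\<^sup>2) * ?e x))"
    using i0 i2 by (simp add: Bochner_Integration.integral_diff)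
  then show ?thesis
    by (simp only: gauss_int_def integral_mult_right_zero)
qed

lemma powr_3_half: "z powr (3 / 2) = z * csqrt z" for z :: complex
proof -
  have "z powr (3 / 2) = z powr (1 + 1 / 2)"
    by simp
  also have "\<dots> = z * csqrt z"
    by (subst powr_add) (simp add: csqrt_conv_powr)
  finally show ?thesis .
qed

lemma cgauss_moment_2:
  assumes "Re z > 0" "c > 0"
  shows "1 / z powr (3 / 2) =
    of_real (2 * c * sqrt (c / pi)) * (LBINT x. of_real (x\<^sup>2) * exp (- z * of_real (c * x\<^sup>2)))"
proof -
  have z: "z \<noteq> 0" using assms by auto
  have "(LBINT x. of_real (x\<^sup>2) * exp (- z * of_real (x\<^sup>2))) = gauss_int z / (2 * z)"
    using cgauss_moment_2_aux[OF assms(1)] z by (simp add: field_simps)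
  also have "\<dots> = of_real (sqrt pi) / (2 * z powr (3/2))"
    by (simp add: gauss_int_eq powr_3_half assms)
  finally have 1: "(LBINT x. of_real (x\<^sup>2) * exp (- z * of_real (x\<^sup>2))) = of_real (sqrt pi) / (2 * z powr (3/2))" .
  have "(LBINT x. of_real (x\<^sup>2) * exp (- z * of_real (x\<^sup>2))) =
     sqrt c *\<^sub>R (LBINT x. of_real ((0 + sqrt c * x)\<^sup>2) * exp (- z * of_real ((0 + sqrt c * x)\<^sup>2)))"
    using lborel_integral_real_affine[of "sqrt c"  "\<lambda>x. of_real (x\<^sup>2) * exp (- z * of_real (x\<^sup>2))" 0] assms
    by simp
  also have "\<dots> = of_real (sqrt c) * (LBINT x. of_real c * (of_real (x\<^sup>2) * exp (- z * of_real (c * x\<^sup>2))))"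
    using assms by (simp add: power_mult_distrib scaleR_conv_of_real mult.assoc flip: of_real_power)
  also have "\<dots> = of_real (c * sqrt c) * (LBINT x. of_real (x\<^sup>2) * exp (- z * of_real (c * x\<^sup>2)))"
    by (simp only: integral_mult_right_zero of_real_mult mult_ac)
  finally have "of_real (c * sqrt c) * (LBINT x. of_real (x\<^sup>2) * exp (- z * of_real (c * x\<^sup>2))) =
      of_real (sqrt pi) / (2 * z powr (3/2))"
    using 1 by simp
  then have "2 / of_real (sqrt pi) * (of_real (c * sqrt c) * (LBINT x. of_real (x\<^sup>2) * exp (- z * of_real (c * x\<^sup>2)))) =
      2 / of_real (sqrt pi) * (of_real (sqrt pi) / (2 * z powr (3/2)))"
    by (rule arg_cong)
  then have "of_real (2 * c * sqrt c / sqrt pi) * (LBINT x. of_real (x\<^sup>2) * exp (- z * of_real (c * x\<^sup>2))) = 1 / z powr (3 / 2)"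
    by (simp add: mult_ac)
  then show ?thesis
    by (simp add: real_sqrt_divide)
qed

section \<open>Iterated vertical integrals as plane integrals\<close>

lemma integral_exp_Ioi:
  fixes k :: real
  assumes "k > 0"
  shows "set_integrable lborel {0<..} (\<lambda>t. exp (- k * t))" "(LBINT t:{0<..}. exp (- k * t)) = 1 / k"
proof -
  have "((\<lambda>x. - exp (- (k * x)) / k) \<longlongrightarrow> - 0 / k) at_top"
    using assms by (intro tendsto_intros filterlim_compose[OF exp_at_bot]
        filterlim_compose[OF filterlim_uminus_at_bot_at_top]
        filterlim_tendsto_pos_mult_at_top[OF tendsto_const] filterlim_ident)
      auto
  moreover have "((\<lambda>x. - exp (- (k * x)) / k) \<longlongrightarrow> - exp (- (k * 0)) / k) (at_right 0)"
    using assms by (intro tendsto_intros) auto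
  ultimately have *: "set_integrable lborel (einterval (ereal 0) \<infinity>) (\<lambda>t. exp (- k * t))"
    "(LBINT t=ereal 0..\<infinity>. exp (- k * t)) = 0 - (- 1 / k)"
    using assms by (intro interval_integral_FTC_nonneg[where F = "\<lambda>t. - exp (- k * t) / k"];
        auto intro!: derivative_eq_intros simp: ereal_tendsto_simps)+
  show "set_integrable lborel {0<..} (\<lambda>t. exp (- k * t))" "(LBINT t:{0<..}. exp (- k * t)) = 1 / k"
    using *(1) *(2)[unfolded interval_integral_to_infinity_eq] by simp_all
qed

lemma borel_measurable_fst_real [measurable]: "fst \<in> borel_measurable (borel :: (real \<times> real) measure)"
  and borel_measurable_snd_real [measurable]: "snd \<in> borel_measurable (borel :: (real \<times> real) measure)"
  by (simp_all flip: borel_prod)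

lemma integral_pair_times:
  fixes f g :: "real \<Rightarrow> 'a::{real_normed_field,banach,second_countable_topology}"
  assumes f: "integrable lborel f" and g: "integrable lborel g"
  shows "integrable lborel (\<lambda>(x, y). f x * g y)"
    and "integral\<^sup>L lborel (\<lambda>(x, y). f x * g y) = integral\<^sup>L lborel f * integral\<^sup>L lborel g"
proof -
  note [measurable] = borel_measurable_integrable[OF f] borel_measurable_integrable[OF g]
  have *: "integrable (lborel \<Otimes>\<^sub>M lborel) (\<lambda>(x, y). f x * g y)"
  proof (rule lborel_pair.Fubini_integrable)
    show "integrable lborel (\<lambda>x. LBINT y. norm (case (x, y) of (x, y) \<Rightarrow> f x * g y))"
      using f by (simp add: norm_mult)
    show "AE x in lborel. integrable lborel (\<lambda>y. case (x, y) of (x, y) \<Rightarrow> f x * g y)"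
      using g by simp
  qed measurable
  then show "integrable lborel (\<lambda>(x, y). f x * g y)"
    by (simp add: lborel_prod)
  show "integral\<^sup>L lborel (\<lambda>(x, y). f x * g y) = integral\<^sup>L lborel f * integral\<^sup>L lborel g"
    using lborel_pair.integral_fst'[OF *] by (simp add: lborel_prod)
qed

text \<open>The integral of exp (- k u) over u > 0 is 1 / k with k = d (q^2 + y^2), so Fubini trades
  the vertical variable u for a denominator. The factor exp (- (t + Re s) d y^2) left over makes the
  exchange absolutely convergent.\<close>

lemma laplace_kernel_inner:
  fixes \<omega> :: "real \<Rightarrow> real" and d q t :: real
  assumes d: "d > 0" and t: "t > 0" and s: "Re s > 0"
    and [measurable]: "\<omega> \<in> borel_measurable borel" and nonneg: "\<And>y. \<omega> y \<ge> 0"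
    and int: "\<And>r. r > 0 \<Longrightarrow> integrable lborel (\<lambda>y. \<omega> y / (d * (q\<^sup>2 + y\<^sup>2)) * exp (- r * (d * y\<^sup>2)))"
  shows "(LBINT u:{0<..}. of_real (exp (- (d * q\<^sup>2 * (t + u)))) * (LBINT y. of_real (\<omega> y) * exp (- (of_real (t + u) + s) * of_real (d * y\<^sup>2)))) =
     (LBINT y. of_real (\<omega> y / (d * (q\<^sup>2 + y\<^sup>2)) * exp (- (d * (q\<^sup>2 + y\<^sup>2) * t))) * exp (- s * of_real (d * y\<^sup>2)))"
proof -
  define k where "k y = d * (q\<^sup>2 + y\<^sup>2)" for y
  define f where "f u y = of_real (indicator {0<..} u * (\<omega> y * exp (- (k y * (t + u))))) * exp (- s * of_real (d * y\<^sup>2))" for u y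
  have [measurable]: "k \<in> borel_measurable borel"
    unfolding k_def by measurable
  \<comment> \<open>For q = 0 the function k vanishes at y = 0, so positivity holds only almost
    everywhere.\<close>
  have kpos: "AE y in lborel. k y > 0"
    using AE_lborel_singleton[of "0::real"] by eventually_elim (use d in \<open>auto simp: k_def add_nonneg_pos\<close>)
  have exp_split: "exp (- (k y * (t + u))) = exp (- (k y * t)) * exp (- (k y) * u)" for y u
    by (simp add: algebra_simps flip: exp_add)
  have inner: "integrable lborel (\<lambda>u. f u y)"
    "(LBINT u. f u y) = of_real (\<omega> y / k y * exp (- (k y * t))) * exp (- s * of_real (d * y\<^sup>2))"
    "(LBINT u. norm (f u y)) = \<omega> y / k y * exp (- (k y * t)) * exp (- Re s * (d * y\<^sup>2))"
    if "k y > 0" for y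
  proof -
    let ?g = "\<lambda>u. indicator {0<..} u * exp (- (k y) * u)"
    have g: "integrable lborel ?g" "(LBINT u. ?g u) = 1 / k y"
      using integral_exp_Ioi[OF that] by (simp_all add: set_integrable_def set_lebesgue_integral_def)
    have f: "f u y = of_real (?g u) * (of_real (\<omega> y * exp (- (k y * t))) * exp (- s * of_real (d * y\<^sup>2)))" for u
      unfolding f_def exp_split by (simp add: mult_ac)
    show "integrable lborel (\<lambda>u. f u y)"
      unfolding f using g(1) by (intro integrable_mult_left integrable_of_real)
    show "(LBINT u. f u y) = of_real (\<omega> y / k y * exp (- (k y * t))) * exp (- s * of_real (d * y\<^sup>2))"
      unfolding f integral_mult_left_zero integral_complex_of_real g(2) by simp
    have "norm (f u y) = ?g u * (\<omega> y * exp (- (k y * t)) * exp (- Re s * (d * y\<^sup>2)))" for u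
      unfolding f using nonneg[of y] by (simp add: norm_mult norm_exp_eq_Re del: of_real_mult)
    then show "(LBINT u. norm (f u y)) = \<omega> y / k y * exp (- (k y * t)) * exp (- Re s * (d * y\<^sup>2))"
      by (simp only: integral_mult_left_zero g(2)) simp
  qed
  have pair: "integrable (lborel \<Otimes>\<^sub>M lborel) (\<lambda>(y, u). f u y)"
  proof (rule lborel_pair.Fubini_integrable)
    show "(\<lambda>(y, u). f u y) \<in> borel_measurable (lborel \<Otimes>\<^sub>M lborel)"
      unfolding f_def by measurable
    show "AE y in lborel. integrable lborel (\<lambda>u. case (y, u) of (y, u) \<Rightarrow> f u y)"
      using kpos by eventually_elim (simp add: inner(1))
    have "integrable lborel (\<lambda>y. exp (- (d * q\<^sup>2 * t)) * (\<omega> y / k y * exp (- (t + Re s) * (d * y\<^sup>2))))"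
      using int[of "t + Re s"] t s unfolding k_def by (intro integrable_mult_right) simp
    moreover have "AE y in lborel. exp (- (d * q\<^sup>2 * t)) * (\<omega> y / k y * exp (- (t + Re s) * (d * y\<^sup>2))) = (LBINT u. norm (f u y))"
      using kpos
    proof eventually_elim
      case (elim y)
      show ?case
        unfolding inner(3)[OF elim] by (simp add: k_def algebra_simps flip: exp_add)
    qed
    moreover have "(\<lambda>y. LBINT u. norm (f u y)) \<in> borel_measurable lborel"
      unfolding f_def by measurable
    ultimately show "integrable lborel (\<lambda>y. LBINT u. norm (case (y, u) of (y, u) \<Rightarrow> f u y))"
      by (simp add: integrable_cong_AE_imp[of lborel])
  qed
  have "(LBINT u:{0<..}. of_real (exp (- (d * q\<^sup>2 * (t + u)))) * (LBINT y. of_real (\<omega> y) * exp (- (of_real (t + u) + s) * of_real (d * y\<^sup>2))))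
      = (LBINT u. (LBINT y. f u y))"
    unfolding set_lebesgue_integral_def
  proof (rule Bochner_Integration.integral_cong[OF refl])
    fix u :: real
    have "f u y = of_real (indicator {0<..} u) * (of_real (exp (- (d * q\<^sup>2 * (t + u)))) *
        (of_real (\<omega> y) * exp (- (of_real (t + u) + s) * of_real (d * y\<^sup>2))))" for y
      unfolding f_def k_def by (simp add: algebra_simps exp_add exp_diff exp_minus field_simps flip: exp_of_real)
    then show "indicator {0<..} u *\<^sub>R (of_real (exp (- (d * q\<^sup>2 * (t + u)))) * (LBINT y. of_real (\<omega> y) * exp (- (of_real (t + u) + s) * of_real (d * y\<^sup>2))))
      = (LBINT y. f u y)"
      by (simp only: integral_mult_right_zero scaleR_conv_of_real)
  qed
  also have "\<dots> = (LBINT y. (LBINT u. f u y))"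
    using lborel_pair.Fubini_integral[of "\<lambda>y u. f u y"] pair by simp
  also have "\<dots> = (LBINT y. of_real (\<omega> y / k y * exp (- (k y * t))) * exp (- s * of_real (d * y\<^sup>2)))"
    using kpos inner(2) by (intro integral_cong_AE) (auto simp: f_def elim: eventually_mono)
  finally show ?thesis
    unfolding k_def .
qed

text \<open>The same device for the outer variable. Because v = t + u, the exponent in t collects
  both coordinates, so the second denominator is the full form c (p^2 + x^2) + d (q^2 + y^2), the
  source of Q (n) + Q (w). The functions \<omega> are the moment weights, a constant or a
  square.\<close>

lemma laplace_kernel:
  fixes \<omega>\<^sub>1 \<omega>\<^sub>2 :: "real \<Rightarrow> real" and c d p q :: real
  assumes c: "c > 0" and d: "d > 0" and s: "Re s > 0" and pq: "p \<noteq> 0 \<or> q \<noteq> 0"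
    and [measurable]: "\<omega>\<^sub>1 \<in> borel_measurable borel" "\<omega>\<^sub>2 \<in> borel_measurable borel"
    and nonneg: "\<And>x. \<omega>\<^sub>1 x \<ge> 0" "\<And>y. \<omega>\<^sub>2 y \<ge> 0"
    and int1: "\<And>r. r > 0 \<Longrightarrow> integrable lborel (\<lambda>x. \<omega>\<^sub>1 x * exp (- r * (c * x\<^sup>2)))"
    and int2: "\<And>r. r > 0 \<Longrightarrow> integrable lborel (\<lambda>y. \<omega>\<^sub>2 y / (d * (q\<^sup>2 + y\<^sup>2)) * exp (- r * (d * y\<^sup>2)))"
    and int: "integrable lborel (\<lambda>(x, y). \<omega>\<^sub>1 x * \<omega>\<^sub>2 y / (d * (q\<^sup>2 + y\<^sup>2) * (c * (p\<^sup>2 + x\<^sup>2) + d * (q\<^sup>2 + y\<^sup>2))) *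
      exp (- Re s * (c * x\<^sup>2 + d * y\<^sup>2)))"
  shows "(LBINT t:{0<..}. LBINT u:{0<..}. of_real (exp (- (c * p\<^sup>2 * t + d * q\<^sup>2 * (t + u)))) *
      ((LBINT x. of_real (\<omega>\<^sub>1 x) * exp (- (of_real t + s) * of_real (c * x\<^sup>2))) *
       (LBINT y. of_real (\<omega>\<^sub>2 y) * exp (- (of_real (t + u) + s) * of_real (d * y\<^sup>2))))) =
    (LBINT (x, y). of_real (\<omega>\<^sub>1 x * \<omega>\<^sub>2 y / (d * (q\<^sup>2 + y\<^sup>2) * (c * (p\<^sup>2 + x\<^sup>2) + d * (q\<^sup>2 + y\<^sup>2)))) *
      exp (- s * of_real (c * x\<^sup>2 + d * y\<^sup>2)))"
proof -
  define k where "k y = d * (q\<^sup>2 + y\<^sup>2)" for y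
  define K where "K x y = c * (p\<^sup>2 + x\<^sup>2) + k y" for x y
  have [measurable]: "k \<in> borel_measurable borel"
    unfolding k_def by measurable
  define f where "f t w = (case w of (x, y) \<Rightarrow> of_real (indicator {0<..} t * (\<omega>\<^sub>1 x * \<omega>\<^sub>2 y / k y * exp (- (K x y * t)))) *
     exp (- s * of_real (c * x\<^sup>2 + d * y\<^sup>2)))" for t w
  have Kpos: "K x y > 0" for x y
  proof -
    have "K x y = (c * p\<^sup>2 + d * q\<^sup>2) + (c * x\<^sup>2 + d * y\<^sup>2)"
      by (simp add: K_def k_def algebra_simps)
    moreover have "c * p\<^sup>2 + d * q\<^sup>2 > 0"
      using c d pq by (auto intro: add_pos_nonneg add_nonneg_pos)
    moreover have "c * x\<^sup>2 + d * y\<^sup>2 \<ge> 0"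
      using c d by simp
    ultimately show ?thesis by linarith
  qed
  have k0: "k y \<ge> 0" for y
    using d by (simp add: k_def)
  have inner: "integrable lborel (\<lambda>t. f t (x, y))"
    "(LBINT t. f t (x, y)) = of_real (\<omega>\<^sub>1 x * \<omega>\<^sub>2 y / (k y * K x y)) * exp (- s * of_real (c * x\<^sup>2 + d * y\<^sup>2))"
    "(LBINT t. norm (f t (x, y))) = \<omega>\<^sub>1 x * \<omega>\<^sub>2 y / (k y * K x y) * exp (- Re s * (c * x\<^sup>2 + d * y\<^sup>2))" for x y
  proof -
    let ?g = "\<lambda>t. indicator {0<..} t * exp (- (K x y) * t)"
    have g: "integrable lborel ?g" "(LBINT t. ?g t) = 1 / K x y"
      using integral_exp_Ioi[OF Kpos] by (simp_all add: set_integrable_def set_lebesgue_integral_def)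
    have f: "f t (x, y) = of_real (?g t) * (of_real (\<omega>\<^sub>1 x * \<omega>\<^sub>2 y / k y) * exp (- s * of_real (c * x\<^sup>2 + d * y\<^sup>2)))" for t
      unfolding f_def by (simp add: mult_ac)
    show "integrable lborel (\<lambda>t. f t (x, y))"
      unfolding f using g(1) by (intro integrable_mult_left integrable_of_real)
    show "(LBINT t. f t (x, y)) = of_real (\<omega>\<^sub>1 x * \<omega>\<^sub>2 y / (k y * K x y)) * exp (- s * of_real (c * x\<^sup>2 + d * y\<^sup>2))"
      unfolding f integral_mult_left_zero integral_complex_of_real g(2) by simp
    have "norm (f t (x, y)) = ?g t * (\<omega>\<^sub>1 x * \<omega>\<^sub>2 y / k y * exp (- Re s * (c * x\<^sup>2 + d * y\<^sup>2)))" for t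
      unfolding f using nonneg(1)[of x] nonneg(2)[of y] k0[of y] by (simp add: norm_mult norm_divide norm_exp_eq_Re)
    then show "(LBINT t. norm (f t (x, y))) = \<omega>\<^sub>1 x * \<omega>\<^sub>2 y / (k y * K x y) * exp (- Re s * (c * x\<^sup>2 + d * y\<^sup>2))"
      by (simp only: integral_mult_left_zero g(2)) simp
  qed
  have [measurable]: "(\<lambda>(w, t). f t w) \<in> borel_measurable (lborel \<Otimes>\<^sub>M lborel)"
    unfolding f_def K_def case_prod_unfold by measurable
  have pair: "integrable (lborel \<Otimes>\<^sub>M lborel) (\<lambda>(w, t). f t w)"
  proof (rule lborel_pair.Fubini_integrable)
    show "AE w in lborel. integrable lborel (\<lambda>t. case (w, t) of (w, t) \<Rightarrow> f t w)"
      using inner(1) by (intro AE_I2) (auto simp: split_paired_all)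
    show "integrable lborel (\<lambda>w. LBINT t. norm (case (w, t) of (w, t) \<Rightarrow> f t w))"
    proof -
      have "(LBINT t. norm (f t w)) = (case w of (x, y) \<Rightarrow> \<omega>\<^sub>1 x * \<omega>\<^sub>2 y / (k y * K x y) * exp (- Re s * (c * x\<^sup>2 + d * y\<^sup>2)))" for w
        using inner(3) by (cases w) simp
      then show ?thesis
        using int by (simp only: prod.case k_def K_def)
    qed
  qed measurable
  have outer: "(LBINT u:{0<..}. of_real (exp (- (c * p\<^sup>2 * t + d * q\<^sup>2 * (t + u)))) *
      ((LBINT x. of_real (\<omega>\<^sub>1 x) * exp (- (of_real t + s) * of_real (c * x\<^sup>2))) *
       (LBINT y. of_real (\<omega>\<^sub>2 y) * exp (- (of_real (t + u) + s) * of_real (d * y\<^sup>2))))) = (LBINT w. f t w)"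
    if t: "t > 0" for t
  proof -
    let ?F = "LBINT x. of_real (\<omega>\<^sub>1 x) * exp (- (of_real t + s) * of_real (c * x\<^sup>2))"
    let ?h = "\<lambda>x. of_real (\<omega>\<^sub>1 x) * exp (- (of_real t + s) * of_real (c * x\<^sup>2))"
    let ?g = "\<lambda>y. of_real (\<omega>\<^sub>2 y / k y * exp (- (k y * t))) * exp (- s * of_real (d * y\<^sup>2))"
    have "(LBINT u:{0<..}. of_real (exp (- (c * p\<^sup>2 * t + d * q\<^sup>2 * (t + u)))) *
      (?F * (LBINT y. of_real (\<omega>\<^sub>2 y) * exp (- (of_real (t + u) + s) * of_real (d * y\<^sup>2)))))
      = (LBINT u:{0<..}. (of_real (exp (- (c * p\<^sup>2 * t))) * ?F) * (of_real (exp (- (d * q\<^sup>2 * (t + u)))) *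
         (LBINT y. of_real (\<omega>\<^sub>2 y) * exp (- (of_real (t + u) + s) * of_real (d * y\<^sup>2)))))"
    proof (intro set_lebesgue_integral_cong allI impI)
      fix u :: real
      have "exp (- (c * p\<^sup>2 * t + d * q\<^sup>2 * (t + u))) = exp (- (c * p\<^sup>2 * t)) * exp (- (d * q\<^sup>2 * (t + u)))"
        by (simp flip: exp_add)
      then show "of_real (exp (- (c * p\<^sup>2 * t + d * q\<^sup>2 * (t + u)))) *
          (?F * (LBINT y. of_real (\<omega>\<^sub>2 y) * exp (- (of_real (t + u) + s) * of_real (d * y\<^sup>2)))) =
        (of_real (exp (- (c * p\<^sup>2 * t))) * ?F) * (of_real (exp (- (d * q\<^sup>2 * (t + u)))) *
          (LBINT y. of_real (\<omega>\<^sub>2 y) * exp (- (of_real (t + u) + s) * of_real (d * y\<^sup>2))))"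
        by (simp only: of_real_mult mult_ac)
    qed simp
    also have "\<dots> = (of_real (exp (- (c * p\<^sup>2 * t))) * ?F) * (LBINT y. ?g y)"
      unfolding set_integral_mult_right k_def
      using laplace_kernel_inner[OF d t s _ nonneg(2) int2] by simp
    also have "\<dots> = of_real (exp (- (c * p\<^sup>2 * t))) * (LBINT (x, y). ?h x * ?g y)"
    proof -
      have "integrable lborel ?h"
      proof (rule Bochner_Integration.integrable_bound[OF int1[of "t + Re s"]])
        show "AE x in lborel. norm (?h x) \<le> norm (\<omega>\<^sub>1 x * exp (- (t + Re s) * (c * x\<^sup>2)))"
          using nonneg(1) by (intro AE_I2) (simp add: norm_mult norm_exp_eq_Re abs_mult)
      qed (use s t in auto)
      moreover have "integrable lborel ?g"
      proof (rule Bochner_Integration.integrable_bound[OF int2[of "Re s"]])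
        have "norm (?g y) \<le> norm (\<omega>\<^sub>2 y / k y * exp (- Re s * (d * y\<^sup>2)))" for y
        proof -
          have "norm (?g y) = \<omega>\<^sub>2 y / k y * exp (- Re s * (d * y\<^sup>2)) * exp (- (k y * t))"
            using nonneg(2)[of y] k0[of y] by (simp add: norm_mult norm_divide norm_exp_eq_Re)
          also have "\<dots> \<le> \<omega>\<^sub>2 y / k y * exp (- Re s * (d * y\<^sup>2)) * 1"
            using nonneg(2)[of y] k0[of y] t by (intro mult_left_mono) auto
          finally show ?thesis
            using nonneg(2)[of y] k0[of y] by simp
        qed
        then show "AE y in lborel. norm (?g y) \<le> norm (\<omega>\<^sub>2 y / (d * (q\<^sup>2 + y\<^sup>2)) * exp (- Re s * (d * y\<^sup>2)))"
          by (simp add: k_def)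
      qed (use s in auto)
      ultimately show ?thesis
        by (subst integral_pair_times(2)) (simp_all only: mult.assoc)
    qed
    also have "\<dots> = (LBINT w. of_real (exp (- (c * p\<^sup>2 * t))) * (case w of (x, y) \<Rightarrow> ?h x * ?g y))"
      by (simp only: integral_mult_right_zero)
    also have "\<dots> = (LBINT w. f t w)"
    proof (rule Bochner_Integration.integral_cong[OF refl])
      fix w :: "real \<times> real"
      obtain x y where w: "w = (x, y)" by (cases w)
      have "of_real (exp (- (c * p\<^sup>2 * t))) * exp (- (of_real t + s) * of_real (c * x\<^sup>2)) * of_real (exp (- (k y * t))) * exp (- s * of_real (d * y\<^sup>2))
         = of_real (exp (- (K x y * t))) * exp (- s * of_real (c * x\<^sup>2 + d * y\<^sup>2))"
        by (simp add: K_def algebra_simps flip: exp_of_real exp_add)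
      then show "of_real (exp (- (c * p\<^sup>2 * t))) * (case w of (x, y) \<Rightarrow> ?h x * ?g y) = f t w"
        using t by (simp add: w f_def mult_ac)
    qed
    finally show ?thesis .
  qed
  have "(LBINT t:{0<..}. LBINT u:{0<..}. of_real (exp (- (c * p\<^sup>2 * t + d * q\<^sup>2 * (t + u)))) *
      ((LBINT x. of_real (\<omega>\<^sub>1 x) * exp (- (of_real t + s) * of_real (c * x\<^sup>2))) *
       (LBINT y. of_real (\<omega>\<^sub>2 y) * exp (- (of_real (t + u) + s) * of_real (d * y\<^sup>2))))) = (LBINT t. LBINT w. f t w)"
    unfolding set_lebesgue_integral_def[where A = "{0<..}" and f = "\<lambda>t. LBINT u:{0<..}. F t u" for F]
  proof (rule Bochner_Integration.integral_cong[OF refl])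
    fix t :: real
    show "indicator {0<..} t *\<^sub>R (LBINT u:{0<..}. of_real (exp (- (c * p\<^sup>2 * t + d * q\<^sup>2 * (t + u)))) *
      ((LBINT x. of_real (\<omega>\<^sub>1 x) * exp (- (of_real t + s) * of_real (c * x\<^sup>2))) *
       (LBINT y. of_real (\<omega>\<^sub>2 y) * exp (- (of_real (t + u) + s) * of_real (d * y\<^sup>2))))) = (LBINT w. f t w)"
    proof (cases "t > 0")
      case True
      then show ?thesis
        by (subst outer[symmetric]) simp_all
    qed (simp add: f_def case_prod_unfold)
  qed
  also have "\<dots> = (LBINT w. LBINT t. f t w)"
    using lborel_pair.Fubini_integral[of "\<lambda>w t. f t w"] pair by simp
  also have "\<dots> = (LBINT (x, y). of_real (\<omega>\<^sub>1 x * \<omega>\<^sub>2 y / (k y * K x y)) * exp (- s * of_real (c * x\<^sup>2 + d * y\<^sup>2)))"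
    using inner(2) by (intro Bochner_Integration.integral_cong) (auto simp: split_paired_all)
  finally show ?thesis
    by (simp add: k_def K_def)
qed

text \<open>Along w = i t one has - i (w + \<tau>) = t + s with s = - i \<tau>.\<close>

definition weight13 :: "complex \<Rightarrow> real \<Rightarrow> real \<Rightarrow> complex" where
  "weight13 s t v = 1 / (csqrt (of_real t + s) * (of_real v + s) powr (3 / 2))"

definition weight31 :: "complex \<Rightarrow> real \<Rightarrow> real \<Rightarrow> complex" where
  "weight31 s t v = 1 / ((of_real t + s) powr (3 / 2) * csqrt (of_real v + s))"

text \<open>The inner vertical path starts at the outer point, whence v = t + u and the region 0 < t
  < v.\<close>

abbreviation wedge_integral :: "(real \<Rightarrow> real \<Rightarrow> complex) \<Rightarrow> complex" where
  "wedge_integral f \<equiv> (LBINT t:{0<..}. LBINT u:{0<..}. f t (t + u))"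

text \<open>A bound B on the inner quotient yields every integrability condition concerning it: the
  other denominator is at least D = c p^2 + d q^2 > 0, so the kernel is at most B / D times the
  first weight. Both moment patterns fit, with B = 1/d for y^2, and with B = 1/(d q^2) for the
  constant weight when q is nonzero.\<close>

lemma laplace_kernel_bounded:
  fixes \<omega>\<^sub>1 \<omega>\<^sub>2 :: "real \<Rightarrow> real" and c d p q B :: real
  assumes c: "c > 0" and d: "d > 0" and s: "Re s > 0" and pq: "p \<noteq> 0 \<or> q \<noteq> 0"
    and [measurable]: "\<omega>\<^sub>1 \<in> borel_measurable borel" "\<omega>\<^sub>2 \<in> borel_measurable borel"
    and nonneg: "\<And>x. \<omega>\<^sub>1 x \<ge> 0" "\<And>y. \<omega>\<^sub>2 y \<ge> 0"
    and int1: "\<And>r. r > 0 \<Longrightarrow> integrable lborel (\<lambda>x. \<omega>\<^sub>1 x * exp (- r * (c * x\<^sup>2)))"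
    and B: "\<And>y. \<omega>\<^sub>2 y / (d * (q\<^sup>2 + y\<^sup>2)) \<le> B"
  defines "k \<equiv> \<lambda>x y. \<omega>\<^sub>1 x * \<omega>\<^sub>2 y / (d * (q\<^sup>2 + y\<^sup>2) * (c * (p\<^sup>2 + x\<^sup>2) + d * (q\<^sup>2 + y\<^sup>2)))"
  shows "integrable lborel (\<lambda>(x, y). k x y * exp (- Re s * (c * x\<^sup>2 + d * y\<^sup>2)))"
    and "wedge_integral (\<lambda>t v. of_real (exp (- (c * p\<^sup>2 * t + d * q\<^sup>2 * v))) *
      ((LBINT x. of_real (\<omega>\<^sub>1 x) * exp (- (of_real t + s) * of_real (c * x\<^sup>2))) *
       (LBINT y. of_real (\<omega>\<^sub>2 y) * exp (- (of_real v + s) * of_real (d * y\<^sup>2))))) =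
      (LBINT (x, y). of_real (k x y) * exp (- s * of_real (c * x\<^sup>2 + d * y\<^sup>2)))"
proof -
  define D where "D = c * p\<^sup>2 + d * q\<^sup>2"
  have D: "D > 0"
    using c d pq by (auto simp: D_def intro: add_pos_nonneg add_nonneg_pos)
  have D_le: "D \<le> c * (p\<^sup>2 + x\<^sup>2) + d * (q\<^sup>2 + y\<^sup>2)" for x y
    using c d by (simp add: D_def algebra_simps)
  have w0: "\<omega>\<^sub>2 y / (d * (q\<^sup>2 + y\<^sup>2)) \<ge> 0" for y
    using d nonneg(2)[of y] by simp
  have B0: "B \<ge> 0"
    using w0 B by (rule order_trans)
  have k: "0 \<le> k x y" "k x y \<le> B / D * \<omega>\<^sub>1 x" for x y
  proof -
    have "k x y = \<omega>\<^sub>2 y / (d * (q\<^sup>2 + y\<^sup>2)) * (1 / (c * (p\<^sup>2 + x\<^sup>2) + d * (q\<^sup>2 + y\<^sup>2))) * \<omega>\<^sub>1 x"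
      by (simp add: k_def)
    moreover have "\<omega>\<^sub>2 y / (d * (q\<^sup>2 + y\<^sup>2)) * (1 / (c * (p\<^sup>2 + x\<^sup>2) + d * (q\<^sup>2 + y\<^sup>2))) * \<omega>\<^sub>1 x \<le> B * (1 / D) * \<omega>\<^sub>1 x"
      using D D_le[of x y] B0 by (intro mult_right_mono mult_mono B frac_le nonneg) auto
    ultimately show "k x y \<le> B / D * \<omega>\<^sub>1 x"
      by simp
    show "0 \<le> k x y"
      unfolding k_def using c d nonneg by simp
  qed
  have gi: "integrable lborel (\<lambda>y::real. exp (- r * (d * y\<^sup>2)))" if "r > 0" for r
    using integrable_power_gauss[of "r * d" 0] that d by (simp add: mult.assoc)
  show int: "integrable lborel (\<lambda>(x, y). k x y * exp (- Re s * (c * x\<^sup>2 + d * y\<^sup>2)))"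
  proof (rule Bochner_Integration.integrable_bound)
    show "integrable lborel (\<lambda>(x, y). (B / D * (\<omega>\<^sub>1 x * exp (- Re s * (c * x\<^sup>2)))) * exp (- Re s * (d * y\<^sup>2)))"
      by (intro integral_pair_times(1) integrable_mult_right int1 gi s)
    show "AE w in lborel. norm (case w of (x, y) \<Rightarrow> k x y * exp (- Re s * (c * x\<^sup>2 + d * y\<^sup>2))) \<le>
       norm (case w of (x, y) \<Rightarrow> (B / D * (\<omega>\<^sub>1 x * exp (- Re s * (c * x\<^sup>2)))) * exp (- Re s * (d * y\<^sup>2)))"
    proof (intro AE_I2, clarify)
      fix x y :: real
      have "k x y * exp (- Re s * (c * x\<^sup>2 + d * y\<^sup>2)) \<le> (B / D * \<omega>\<^sub>1 x) * exp (- Re s * (c * x\<^sup>2 + d * y\<^sup>2))"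
        by (intro mult_right_mono k) auto
      moreover have "exp (- Re s * (c * x\<^sup>2 + d * y\<^sup>2)) = exp (- Re s * (c * x\<^sup>2)) * exp (- Re s * (d * y\<^sup>2))"
        by (simp add: algebra_simps flip: exp_add)
      ultimately show "norm (k x y * exp (- Re s * (c * x\<^sup>2 + d * y\<^sup>2))) \<le>
          norm ((B / D * (\<omega>\<^sub>1 x * exp (- Re s * (c * x\<^sup>2)))) * exp (- Re s * (d * y\<^sup>2)))"
        using k(1)[of x y] B0 D nonneg(1)[of x] by (simp add: abs_mult mult.assoc)
    qed
  qed (simp add: k_def case_prod_unfold)
  show "wedge_integral (\<lambda>t v. of_real (exp (- (c * p\<^sup>2 * t + d * q\<^sup>2 * v))) *
      ((LBINT x. of_real (\<omega>\<^sub>1 x) * exp (- (of_real t + s) * of_real (c * x\<^sup>2))) *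
       (LBINT y. of_real (\<omega>\<^sub>2 y) * exp (- (of_real v + s) * of_real (d * y\<^sup>2))))) =
      (LBINT (x, y). of_real (k x y) * exp (- s * of_real (c * x\<^sup>2 + d * y\<^sup>2)))"
    unfolding k_def
  proof (rule laplace_kernel[OF c d s pq _ _ nonneg int1 _ int[unfolded k_def]])
    show "integrable lborel (\<lambda>y. \<omega>\<^sub>2 y / (d * (q\<^sup>2 + y\<^sup>2)) * exp (- r * (d * y\<^sup>2)))" if "r > 0" for r
    proof (rule Bochner_Integration.integrable_bound)
      show "integrable lborel (\<lambda>y. B * exp (- r * (d * y\<^sup>2)))"
        by (intro integrable_mult_right gi that)
      show "AE y in lborel. norm (\<omega>\<^sub>2 y / (d * (q\<^sup>2 + y\<^sup>2)) * exp (- r * (d * y\<^sup>2))) \<le> norm (B * exp (- r * (d * y\<^sup>2)))"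
      proof (intro AE_I2)
        fix y :: real
        show "norm (\<omega>\<^sub>2 y / (d * (q\<^sup>2 + y\<^sup>2)) * exp (- r * (d * y\<^sup>2))) \<le> norm (B * exp (- r * (d * y\<^sup>2)))"
          unfolding real_norm_def abs_mult abs_of_nonneg[OF w0] abs_of_nonneg[OF B0] by (intro mult_right_mono B) auto
      qed
    qed measurable
  qed simp_all
qed

text \<open>The exponent 3/2 belongs to v, so the square in the numerator is y^2 and tames d (q^2 +
  y^2) even for q = 0. In the application p is the numerator of the theta term, so the excluded case
  contributes zero.\<close>

lemma theta_kernel_1_3:
  fixes c d p q :: real
  assumes c: "c > 0" and d: "d > 0" and s: "Re s > 0" and p: "p \<noteq> 0"
  defines "k \<equiv> \<lambda>x y. y\<^sup>2 / (d * (q\<^sup>2 + y\<^sup>2) * (c * (p\<^sup>2 + x\<^sup>2) + d * (q\<^sup>2 + y\<^sup>2)))"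
  shows "integrable lborel (\<lambda>(x, y). k x y * exp (- Re s * (c * x\<^sup>2 + d * y\<^sup>2)))"
    and "wedge_integral (\<lambda>t v. of_real (exp (- (c * p\<^sup>2 * t + d * q\<^sup>2 * v))) * weight13 s t v) =
      of_real (2 * d * sqrt (c * d) / pi) * (LBINT (x, y). of_real (k x y) * exp (- s * of_real (c * x\<^sup>2 + d * y\<^sup>2)))"
proof -
  have B: "y\<^sup>2 / (d * (q\<^sup>2 + y\<^sup>2)) \<le> 1 / d" for y :: real
    using d by (cases "y = 0") (auto simp: field_simps add_nonneg_pos)
  have g: "integrable lborel (\<lambda>x::real. 1 * exp (- r * (c * x\<^sup>2)))" if "r > 0" for r
    using integrable_power_gauss[of "r * c" 0] that c by (simp add: mult.assoc)
  note K = laplace_kernel_bounded[OF c d s _ _ _ _ _ g B, where p = p, unfolded mult_1]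
  show "integrable lborel (\<lambda>(x, y). k x y * exp (- Re s * (c * x\<^sup>2 + d * y\<^sup>2)))"
    unfolding k_def by (rule K(1)) (use p in auto)
  have "of_real (exp (- (c * p\<^sup>2 * t + d * q\<^sup>2 * (t + u)))) * weight13 s t (t + u) =
      of_real (2 * d * sqrt (c * d) / pi) * (of_real (exp (- (c * p\<^sup>2 * t + d * q\<^sup>2 * (t + u)))) *
      ((LBINT x. of_real 1 * exp (- (of_real t + s) * of_real (c * x\<^sup>2))) *
       (LBINT y. of_real (y\<^sup>2) * exp (- (of_real (t + u) + s) * of_real (d * y\<^sup>2)))))" if "t > 0" "u > 0" for t u
  proof -
    have 1: "Re (of_real t + s) > 0" and 2: "Re (of_real (t + u) + s) > 0"
      using s that by auto
    have pi': "2 * d * sqrt (c * d) / pi = sqrt (c / pi) * (2 * d * sqrt (d / pi))"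
      by (simp add: real_sqrt_mult real_sqrt_divide field_simps)
    have "weight13 s t (t + u) = (1 / csqrt (of_real t + s)) * (1 / (of_real (t + u) + s) powr (3 / 2))"
      by (simp add: weight13_def)
    then show ?thesis
      unfolding cgauss_moment_0[OF 1 c] cgauss_moment_2[OF 2 d] pi' of_real_mult by (simp add: mult_ac)
  qed
  then have "wedge_integral (\<lambda>t v. of_real (exp (- (c * p\<^sup>2 * t + d * q\<^sup>2 * v))) * weight13 s t v) =
     wedge_integral (\<lambda>t v. of_real (2 * d * sqrt (c * d) / pi) * (of_real (exp (- (c * p\<^sup>2 * t + d * q\<^sup>2 * v))) *
      ((LBINT x. of_real 1 * exp (- (of_real t + s) * of_real (c * x\<^sup>2))) *
       (LBINT y. of_real (y\<^sup>2) * exp (- (of_real v + s) * of_real (d * y\<^sup>2))))))"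
    by (intro set_lebesgue_integral_cong allI impI) auto
  also have "\<dots> = of_real (2 * d * sqrt (c * d) / pi) * (LBINT (x, y). of_real (k x y) * exp (- s * of_real (c * x\<^sup>2 + d * y\<^sup>2)))"
    unfolding k_def set_integral_mult_right by (subst K(2)) (use p in auto)
  finally show "wedge_integral (\<lambda>t v. of_real (exp (- (c * p\<^sup>2 * t + d * q\<^sup>2 * v))) * weight13 s t v) =
      of_real (2 * d * sqrt (c * d) / pi) * (LBINT (x, y). of_real (k x y) * exp (- s * of_real (c * x\<^sup>2 + d * y\<^sup>2)))" .
qed

text \<open>Here the square is x^2 and gives no control of d (q^2 + y^2) at y = 0, so q must be
  nonzero. In the application q is the numerator of the \<open>theta5\<close> term.\<close>

lemma theta_kernel_3_1:
  fixes c d p q :: real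
  assumes c: "c > 0" and d: "d > 0" and s: "Re s > 0" and q: "q \<noteq> 0"
  defines "k \<equiv> \<lambda>x y. x\<^sup>2 / (d * (q\<^sup>2 + y\<^sup>2) * (c * (p\<^sup>2 + x\<^sup>2) + d * (q\<^sup>2 + y\<^sup>2)))"
  shows "integrable lborel (\<lambda>(x, y). k x y * exp (- Re s * (c * x\<^sup>2 + d * y\<^sup>2)))"
    and "wedge_integral (\<lambda>t v. of_real (exp (- (c * p\<^sup>2 * t + d * q\<^sup>2 * v))) * weight31 s t v) =
      of_real (2 * c * sqrt (c * d) / pi) * (LBINT (x, y). of_real (k x y) * exp (- s * of_real (c * x\<^sup>2 + d * y\<^sup>2)))"
proof -
  have B: "1 / (d * (q\<^sup>2 + y\<^sup>2)) \<le> 1 / (d * q\<^sup>2)" for y :: real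
    using d q by (intro frac_le) (auto simp: mult_left_mono)
  have g: "integrable lborel (\<lambda>x::real. x\<^sup>2 * exp (- r * (c * x\<^sup>2)))" if "r > 0" for r
    using integrable_power_gauss[of "r * c" 2] that c by (simp add: mult.assoc)
  note K = laplace_kernel_bounded[OF c d s _ _ _ _ _ g B, where p = p, unfolded mult_1_right]
  show "integrable lborel (\<lambda>(x, y). k x y * exp (- Re s * (c * x\<^sup>2 + d * y\<^sup>2)))"
    unfolding k_def by (rule K(1)) (use q in auto)
  have "of_real (exp (- (c * p\<^sup>2 * t + d * q\<^sup>2 * (t + u)))) * weight31 s t (t + u) =
      of_real (2 * c * sqrt (c * d) / pi) * (of_real (exp (- (c * p\<^sup>2 * t + d * q\<^sup>2 * (t + u)))) *
      ((LBINT x. of_real (x\<^sup>2) * exp (- (of_real t + s) * of_real (c * x\<^sup>2))) *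
       (LBINT y. of_real 1 * exp (- (of_real (t + u) + s) * of_real (d * y\<^sup>2)))))" if "t > 0" "u > 0" for t u
  proof -
    have 1: "Re (of_real t + s) > 0" and 2: "Re (of_real (t + u) + s) > 0"
      using s that by auto
    have pi': "2 * c * sqrt (c * d) / pi = (2 * c * sqrt (c / pi)) * sqrt (d / pi)"
      by (simp add: real_sqrt_mult real_sqrt_divide field_simps)
    have "weight31 s t (t + u) = (1 / (of_real t + s) powr (3 / 2)) * (1 / csqrt (of_real (t + u) + s))"
      by (simp add: weight31_def)
    then show ?thesis
      unfolding cgauss_moment_0[OF 2 d] cgauss_moment_2[OF 1 c] pi' of_real_mult by (simp add: mult_ac)
  qed
  then have "wedge_integral (\<lambda>t v. of_real (exp (- (c * p\<^sup>2 * t + d * q\<^sup>2 * v))) * weight31 s t v) =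
     wedge_integral (\<lambda>t v. of_real (2 * c * sqrt (c * d) / pi) * (of_real (exp (- (c * p\<^sup>2 * t + d * q\<^sup>2 * v))) *
      ((LBINT x. of_real (x\<^sup>2) * exp (- (of_real t + s) * of_real (c * x\<^sup>2))) *
       (LBINT y. of_real 1 * exp (- (of_real v + s) * of_real (d * y\<^sup>2))))))"
    by (intro set_lebesgue_integral_cong allI impI) auto
  also have "\<dots> = of_real (2 * c * sqrt (c * d) / pi) * (LBINT (x, y). of_real (k x y) * exp (- s * of_real (c * x\<^sup>2 + d * y\<^sup>2)))"
    unfolding k_def set_integral_mult_right by (subst K(2)) (use q in auto)
  finally show "wedge_integral (\<lambda>t v. of_real (exp (- (c * p\<^sup>2 * t + d * q\<^sup>2 * v))) * weight31 s t v) =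
      of_real (2 * c * sqrt (c * d) / pi) * (LBINT (x, y). of_real (k x y) * exp (- s * of_real (c * x\<^sup>2 + d * y\<^sup>2)))" .
qed

section \<open>Uniform bounds for theta sums over symmetric windows\<close>

lemma sum_int_telescope:
  fixes D :: "int \<Rightarrow> real"
  assumes "a \<le> b + 1"
  shows "(\<Sum>k=a..b. D (k + 1) - D k) = D (b + 1) - D a"
proof -
  have "(\<Sum>k=a..a - 1 + int n. D (k + 1) - D k) = D (a + int n) - D a" for n
  proof (induction n)
    case (Suc n)
    have "{a..a - 1 + int (Suc n)} = insert (a + int n) {a..a - 1 + int n}"
      by auto
    then show ?case
      using Suc by (simp add: algebra_simps)
  qed simp
  from this[of "nat (b + 1 - a)"] show ?thesis
    using assms by simp
qed

text \<open>Comparison with the arctangent. At distance at least 1 from zero, a term is below the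
  increment of the primitive A over [x - 1, x + 1]; these increments telescope to four values of A,
  each at most 2 / sqrt c. At most two integers remain, each contributing at most 1. The bound is
  uniform in \<beta> and K.\<close>

lemma sum_inverse_square_le:
  fixes \<beta> c :: real and K :: "int set"
  assumes c: "c > 0" and K: "finite K"
  shows "(\<Sum>k\<in>K. 1 / (1 + c * (\<beta> + k)\<^sup>2)) \<le> 2 + 8 / sqrt c"
proof -
  define A where "A x = arctan (sqrt c * x) / sqrt c" for x
  define a where "a x = 1 / (1 + c * x\<^sup>2)" for x
  have A: "(A has_real_derivative a x) (at x)" for x
  proof -
    have "(A has_real_derivative (inverse (1 + (sqrt c * x)\<^sup>2) * sqrt c) / sqrt c) (at x)"
      unfolding A_def by (intro DERIV_cdivide DERIV_chain2[OF DERIV_arctan] DERIV_cmult_Id)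
    moreover have "(inverse (1 + (sqrt c * x)\<^sup>2) * sqrt c) / sqrt c = a x"
      using c by (simp add: a_def inverse_eq_divide power_mult_distrib del: times_divide_eq_left)
    ultimately show ?thesis
      by simp
  qed
  have a1: "a x \<le> 1" "a x > 0" for x
    using c by (auto simp: a_def add_pos_nonneg)
  have amono: "a x \<le> a y" if "y\<^sup>2 \<le> x\<^sup>2" for x y
    unfolding a_def using c that by (intro divide_left_mono mult_pos_pos add_pos_nonneg) auto
  have Amono: "A x \<le> A y" if "x \<le> y" for x y
    using c that by (simp add: A_def divide_right_mono arctan_le_iff)
  have abound: "\<bar>A x\<bar> \<le> 2 / sqrt c" for x
  proof -
    have "\<bar>arctan (sqrt c * x)\<bar> \<le> 2"
      using arctan_lbound[of "sqrt c * x"] arctan_ubound[of "sqrt c * x"] pi_less_4 by linarith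
    then show ?thesis
      using c by (simp add: A_def divide_right_mono)
  qed
  have large: "a x \<le> A (x + 1) - A (x - 1)" if "\<bar>x\<bar> \<ge> 1" for x
  proof (cases "x \<ge> 1")
    case True
    obtain \<xi> where \<xi>: "x - 1 < \<xi>" "\<xi> < x" "A x - A (x - 1) = (x - (x - 1)) * a \<xi>"
      using MVT2[of "x - 1" x A a] A by auto
    have "a x \<le> a \<xi>"
      using \<xi> True by (intro amono power_mono) auto
    then show ?thesis
      using \<xi>(3) Amono[of x "x + 1"] by simp
  next
    case False
    then have "x \<le> -1" using that by auto
    obtain \<xi> where \<xi>: "x < \<xi>" "\<xi> < x + 1" "A (x + 1) - A x = (x + 1 - x) * a \<xi>"
      using MVT2[of x "x + 1" A a] A by auto
    have "a x \<le> a \<xi>"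
      using \<xi> \<open>x \<le> -1\<close> power_mono[of "-\<xi>" "-x" 2] by (intro amono) auto
    then show ?thesis
      using \<xi>(3) Amono[of "x - 1" x] by simp
  qed
  define M where "M = Max (insert 0 (abs ` K))"
  have M: "\<bar>k\<bar> \<le> M" if "k \<in> K" for k
    using K that by (auto simp: M_def intro: Max_ge)
  have M0: "M \<ge> 0"
    using K by (auto simp: M_def intro: Max_ge)
  \<comment> \<open>Adding A at two neighbouring points makes the overlapping increments of length 2
    telescope.\<close>
  define D where "D k = A (\<beta> + of_int k) + A (\<beta> + of_int k - 1)" for k :: int
  have D: "D (k + 1) - D k = A (\<beta> + k + 1) - A (\<beta> + k - 1)" for k
    by (simp add: D_def algebra_simps)
  let ?S = "{k::int. \<bar>\<beta> + k\<bar> < 1}"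
  have S: "?S \<subseteq> {\<lfloor>- \<beta>\<rfloor>, \<lfloor>- \<beta>\<rfloor> + 1}"
  proof
    fix k :: int assume "k \<in> ?S"
    then have "k = \<lfloor>- \<beta>\<rfloor> \<or> k = \<lfloor>- \<beta>\<rfloor> + 1"
      unfolding mem_Collect_eq by linarith
    then show "k \<in> {\<lfloor>- \<beta>\<rfloor>, \<lfloor>- \<beta>\<rfloor> + 1}" by simp
  qed
  have split: "(\<Sum>k\<in>K. a (\<beta> + k)) = (\<Sum>k\<in>K \<inter> ?S. a (\<beta> + k)) + (\<Sum>k\<in>K - ?S. a (\<beta> + k))"
    by (rule sum.Int_Diff[OF K])
  have "(\<Sum>k\<in>K \<inter> ?S. a (\<beta> + k)) \<le> (\<Sum>k\<in>K \<inter> ?S. 1)"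
    by (intro sum_mono a1)
  also have "\<dots> = real (card (K \<inter> ?S))"
    by simp
  also have "\<dots> \<le> real (card {\<lfloor>- \<beta>\<rfloor>, \<lfloor>- \<beta>\<rfloor> + 1})"
    using S by (intro of_nat_mono card_mono) auto
  also have "\<dots> = 2"
    by simp
  finally have small: "(\<Sum>k\<in>K \<inter> ?S. a (\<beta> + k)) \<le> 2" .
  have "(\<Sum>k\<in>K - ?S. a (\<beta> + k)) \<le> (\<Sum>k\<in>K - ?S. D (k + 1) - D k)"
    using large by (intro sum_mono) (simp add: D)
  also have "\<dots> \<le> (\<Sum>k=-M..M. D (k + 1) - D k)"
    using M Amono by (intro sum_mono2) (auto simp: D abs_le_iff minus_le_iff)
  also have "\<dots> = D (M + 1) - D (- M)"
    using M0 by (intro sum_int_telescope) simp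
  also have "\<dots> \<le> 8 / sqrt c"
    using abound[of "\<beta> + M + 1"] abound[of "\<beta> + M"] abound[of "\<beta> - M"] abound[of "\<beta> - M - 1"]
    by (simp add: D_def algebra_simps)
  finally show ?thesis
    using small split by (simp add: a_def)
qed

lemma exp_minus_le_inverse:
  fixes y :: real
  assumes "y \<ge> 0"
  shows "exp (- y) \<le> 1 / (1 + y)"
  using exp_ge_add_one_self[of y] assms by (simp add: exp_minus field_simps)

lemma sum_gauss_le:
  fixes \<beta> c :: real and K :: "int set"
  assumes c: "c > 0" and K: "finite K"
  shows "(\<Sum>k\<in>K. exp (- (c * (\<beta> + k)\<^sup>2))) \<le> 2 + 8 / sqrt c"
proof -
  have "(\<Sum>k\<in>K. exp (- (c * (\<beta> + k)\<^sup>2))) \<le> (\<Sum>k\<in>K. 1 / (1 + c * (\<beta> + k)\<^sup>2))"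
    using c by (intro sum_mono exp_minus_le_inverse) auto
  then show ?thesis
    using sum_inverse_square_le[OF assms, of \<beta>] by linarith
qed

lemma exp_ge_quadratic:
  fixes y :: real
  assumes "y \<ge> 0"
  shows "1 + y + y\<^sup>2 / 2 \<le> exp y"
  using exp_lower_Taylor_quadratic[OF assms] by simp

text \<open>Twice each term is compared with the increment over [x - 1, x + 1] of the primitive E.
  The errors are governed by the derivative h' and add up to order 1 / sqrt c. The increments
  telescope to E at the two ends of the window; E is even and the ends are symmetric up to distance
  2, so this difference is of order 1 / sqrt c as well.\<close>

lemma odd_gauss_sum_small:
  fixes p L c :: real
  assumes c: "0 < c" "c \<le> 1"
  shows "\<bar>\<Sum>k::int | \<bar>p + 2 * of_int k\<bar> \<le> L. (p + 2 * of_int k) * exp (- (c * (p + 2 * of_int k)\<^sup>2))\<bar> \<le> 100 / sqrt c"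
proof -
  define E where "E x = - exp (- (c * x\<^sup>2)) / (2 * c)" for x
  define h where "h x = x * exp (- (c * x\<^sup>2))" for x
  define h' where "h' x = (1 - 2 * c * x\<^sup>2) * exp (- (c * x\<^sup>2))" for x
  have E: "(E has_real_derivative h x) (at x)" for x
    unfolding E_def h_def using c by (auto intro!: derivative_eq_intros simp: field_simps)
  have h: "(h has_real_derivative h' x) (at x)" for x
    unfolding h_def h'_def by (auto intro!: derivative_eq_intros simp: field_simps power2_eq_square)
  have hle: "\<bar>h x\<bar> \<le> 1 / sqrt c" for x
  proof -
    have "(sqrt c * \<bar>x\<bar>)\<^sup>2 = c * x\<^sup>2"
      using c by (simp add: power_mult_distrib)
    moreover have "2 * (sqrt c * \<bar>x\<bar>) \<le> 1 + (sqrt c * \<bar>x\<bar>)\<^sup>2"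
      using zero_le_power2[of "sqrt c * \<bar>x\<bar> - 1"] by (simp add: power2_eq_square algebra_simps)
    moreover have "0 \<le> sqrt c * \<bar>x\<bar>"
      using c by simp
    ultimately have "sqrt c * \<bar>x\<bar> \<le> exp (c * x\<^sup>2)"
      using exp_ge_add_one_self[of "c * x\<^sup>2"] by linarith
    then show ?thesis
      using c by (simp add: h_def abs_mult exp_minus field_simps)
  qed
  \<comment> \<open>12 = 4 * 3: the derivative at \<zeta> is at most 4 / (1 + c \<zeta>^2), and
    replacing \<zeta> by a point at distance at most 1 costs a factor 3 because c \<le> 1.\<close>
  have h'le: "\<bar>h' \<zeta>\<bar> \<le> 12 / (1 + c * x\<^sup>2)" if "\<bar>\<zeta> - x\<bar> \<le> 1" for \<zeta> x
  proof -
    define y where "y = c * \<zeta>\<^sup>2"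
    have y: "y \<ge> 0" using c by (simp add: y_def)
    have "\<bar>h' \<zeta>\<bar> \<le> (1 + 2 * y) * exp (- y)"
      using y by (auto simp: h'_def y_def abs_mult mult.assoc intro!: mult_right_mono)
    also have "\<dots> \<le> 4 / (1 + y)"
    proof -
      have "(1 + 2 * y) * (1 + y) \<le> 4 * (1 + y + y\<^sup>2 / 2)"
        using y by (simp add: power2_eq_square algebra_simps)
      also have "\<dots> \<le> 4 * exp y"
        using exp_ge_quadratic[OF y] by simp
      finally show ?thesis
        using y by (simp add: exp_minus field_simps)
    qed
    also have "\<dots> \<le> 12 / (1 + c * x\<^sup>2)"
    proof -
      have "x\<^sup>2 \<le> (\<bar>\<zeta>\<bar> + 1)\<^sup>2"
        using that by (intro abs_le_square_iff[THEN iffD1]) auto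
      also have "\<dots> \<le> 3 * \<zeta>\<^sup>2 + 3 / 2"
        using zero_le_power2[of "2 * \<bar>\<zeta>\<bar> - 1"] by (simp add: power2_eq_square algebra_simps)
      finally have "c * x\<^sup>2 \<le> c * (3 * \<zeta>\<^sup>2 + 3 / 2)"
        using c by (intro mult_left_mono) auto
      then have "1 + c * x\<^sup>2 \<le> 3 * (1 + y)"
        using c by (simp add: y_def algebra_simps)
      moreover have "1 + c * x\<^sup>2 > 0"
        using c by (simp add: add_pos_nonneg)
      ultimately show ?thesis
        using y by (simp add: field_simps)
    qed
    finally show ?thesis .
  qed
  have trm: "\<bar>2 * h x - (E (x + 1) - E (x - 1))\<bar> \<le> 24 / (1 + c * x\<^sup>2)" for x
  proof -
    obtain \<xi> where \<xi>: "x - 1 < \<xi>" "\<xi> < x + 1" "E (x + 1) - E (x - 1) = (x + 1 - (x - 1)) * h \<xi>"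
      using MVT2[of "x - 1" "x + 1" E h] E by auto
    have "\<bar>h \<xi> - h x\<bar> \<le> 12 / (1 + c * x\<^sup>2) * \<bar>\<xi> - x\<bar>"
    proof (rule field_differentiable_bound[of "cball x 1" h h', unfolded real_norm_def])
      show "(h has_field_derivative h' z) (at z within cball x 1)" if "z \<in> cball x 1" for z
        using h by (rule has_field_derivative_at_within)
      show "\<bar>h' z\<bar> \<le> 12 / (1 + c * x\<^sup>2)" if "z \<in> cball x 1" for z
        using that by (intro h'le) (auto simp: dist_real_def)
    qed (use \<xi> in \<open>auto simp: dist_real_def\<close>)
    also have "\<dots> \<le> 12 / (1 + c * x\<^sup>2) * 1"
      using \<xi> c by (intro mult_left_mono) auto
    finally show ?thesis
      using \<xi>(3) by simp
  qed
  define a b where "a = \<lceil>(- L - p) / 2\<rceil>" and "b = \<lfloor>(L - p) / 2\<rfloor>"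
  have K: "{k::int. \<bar>p + 2 * of_int k\<bar> \<le> L} = {a..b}"
  proof -
    have "\<bar>p + 2 * of_int k\<bar> \<le> L \<longleftrightarrow> (- L - p) / 2 \<le> k \<and> k \<le> (L - p) / 2" for k :: int
      by (auto simp: abs_le_iff field_simps)
    then show ?thesis
      unfolding a_def b_def atLeastAtMost_def atLeast_def atMost_def Int_def ceiling_le_iff le_floor_iff by simp
  qed
  show ?thesis
  proof (cases "a \<le> b")
    case True
    define D where "D k = E (p + 2 * of_int k - 1)" for k :: int
    have D: "D (k + 1) - D k = E (p + 2 * of_int k + 1) - E (p + 2 * of_int k - 1)" for k
      by (simp add: D_def algebra_simps)
    have "(\<Sum>k=a..b. D (k + 1) - D k) = D (b + 1) - D a"
      using True by (intro sum_int_telescope) simp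
    \<comment> \<open>Evenness of E reflects the lower end, so that both arguments lie within 1 of
      L.\<close>
    also have "\<dots> = E (p + 2 * of_int b + 1) - E (1 - p - 2 * of_int a)"
      by (simp add: D_def E_def algebra_simps power2_eq_square)
    also have "\<bar>\<dots>\<bar> \<le> 1 / sqrt c * \<bar>(p + 2 * of_int b + 1) - (1 - p - 2 * of_int a)\<bar>"
    proof (rule field_differentiable_bound[of UNIV E h, unfolded real_norm_def])
      show "(E has_field_derivative h z) (at z within UNIV)" for z
        using E by simp
    qed (use hle in auto)
    also have "\<dots> \<le> 1 / sqrt c * 2"
    proof (intro mult_left_mono)
      have "(- L - p) / 2 \<le> a" "a < (- L - p) / 2 + 1" "b \<le> (L - p) / 2" "b > (L - p) / 2 - 1"
        unfolding a_def b_def by linarith+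
      then show "\<bar>(p + 2 * of_int b + 1) - (1 - p - 2 * of_int a)\<bar> \<le> 2"
        by (simp add: field_simps abs_le_iff)
    qed (use c in auto)
    finally have bnd: "\<bar>\<Sum>k=a..b. D (k + 1) - D k\<bar> \<le> 2 / sqrt c" by simp
    have "\<bar>\<Sum>k=a..b. 2 * h (p + 2 * of_int k) - (D (k + 1) - D k)\<bar> \<le> (\<Sum>k=a..b. 24 / (1 + c * (p + 2 * of_int k)\<^sup>2))"
      unfolding D by (intro order_trans[OF sum_abs] sum_mono trm)
    also have "\<dots> = 24 * (\<Sum>k=a..b. 1 / (1 + (4 * c) * (p / 2 + k)\<^sup>2))"
      by (simp add: sum_distrib_left power2_eq_square algebra_simps)
    also have "\<dots> \<le> 24 * (2 + 8 / sqrt (4 * c))"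
      using c by (intro mult_left_mono sum_inverse_square_le) auto
    also have "\<dots> = 48 + 96 / sqrt c"
      by (simp add: real_sqrt_mult)
    also have "(\<Sum>k=a..b. 2 * h (p + 2 * of_int k) - (D (k + 1) - D k)) = 2 * (\<Sum>k=a..b. h (p + 2 * of_int k)) - (\<Sum>k=a..b. D (k + 1) - D k)"
      by (simp only: sum_subtractf sum_distrib_left)
    finally have "2 * \<bar>\<Sum>k=a..b. h (p + 2 * of_int k)\<bar> \<le> 48 + 96 / sqrt c + 2 / sqrt c"
      using bnd by linarith
    moreover have "1 / sqrt c \<ge> 1"
      using c by simp
    ultimately have "\<bar>\<Sum>k=a..b. h (p + 2 * of_int k)\<bar> \<le> 100 / sqrt c"
      by simp
    then show ?thesis
      unfolding K h_def .
  qed (use c K in auto)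
qed

lemma shifted_int_gap:
  fixes \<beta> :: real
  obtains \<delta> where "\<delta> > 0" "\<delta> \<le> 1" "\<And>k::int. \<beta> + k \<noteq> 0 \<Longrightarrow> \<bar>\<beta> + k\<bar> \<ge> \<delta>"
proof (cases "\<beta> \<in> \<int>")
  case True
  then obtain m :: int where m: "\<beta> = m"
    by (auto elim: Ints_cases)
  have "\<bar>\<beta> + k\<bar> \<ge> 1" if "\<beta> + k \<noteq> 0" for k :: int
  proof -
    have "m + k \<noteq> 0"
      using that m by auto
    then have "\<bar>m + k\<bar> \<ge> 1"
      by linarith
    then show ?thesis
      unfolding m by linarith
  qed
  then show ?thesis
    using that[of 1] by simp
next
  case False
  define \<delta> where "\<delta> = min (frac \<beta>) (1 - frac \<beta>)"
  have "\<delta> > 0" "\<delta> \<le> 1"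
    using False frac_lt_1[of \<beta>] frac_gt_0_iff[of \<beta>] by (auto simp: \<delta>_def min_def)
  moreover have "\<bar>\<beta> + k\<bar> \<ge> \<delta>" for k :: int
  proof (cases "k \<ge> - \<lfloor>\<beta>\<rfloor>")
    case True
    then show ?thesis by (simp add: \<delta>_def frac_def)
  next
    case False
    then have "k + 1 \<le> - \<lfloor>\<beta>\<rfloor>" by simp
    then have "real_of_int k + 1 \<le> - real_of_int \<lfloor>\<beta>\<rfloor>" by linarith
    then show ?thesis by (simp add: \<delta>_def frac_def)
  qed
  ultimately show ?thesis
    using that[of \<delta>] by simp
qed

text \<open>An integrable profile: t^(-1/2) at 0, the singularity that survives the cancellation,
  and t^(-3/2) at infinity, the decay of the weights. Its primitive is 2 arctan (sqrt t).\<close>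

definition \<mu> :: "real \<Rightarrow> real" where
  "\<mu> t = 1 / (sqrt t * (1 + t))"

lemma \<mu>_nonneg: "t > 0 \<Longrightarrow> \<mu> t \<ge> 0"
  by (simp add: \<mu>_def)

lemma \<mu>_antimono: "0 < t \<Longrightarrow> t \<le> t' \<Longrightarrow> \<mu> t' \<le> \<mu> t"
  unfolding \<mu>_def by (intro divide_left_mono mult_mono) auto

lemma \<mu>_integrable: "set_integrable lborel {0<..} \<mu>"
proof -
  have "((\<lambda>t. 2 * arctan (sqrt t)) \<longlongrightarrow> 2 * (pi / 2)) at_top"
    by (intro tendsto_intros filterlim_compose[OF tendsto_arctan_at_top] sqrt_at_top)
  moreover have "((\<lambda>t. 2 * arctan (sqrt t)) \<longlongrightarrow> 2 * arctan (sqrt 0)) (at_right 0)"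
    by (intro tendsto_intros)
  moreover have "((\<lambda>t. 2 * arctan (sqrt t)) has_real_derivative \<mu> t) (at t)" if "t > 0" for t
  proof -
    have "((\<lambda>t. 2 * arctan (sqrt t)) has_real_derivative 2 * (inverse (1 + (sqrt t)\<^sup>2) * (inverse (sqrt t) / 2))) (at t)"
      using that by (intro DERIV_cmult DERIV_chain2[OF DERIV_arctan] DERIV_real_sqrt)
    then show ?thesis
      using that by (simp add: \<mu>_def inverse_eq_divide mult.commute)
  qed
  moreover have "isCont \<mu> t" if "t > 0" for t
    unfolding \<mu>_def using that by (auto intro!: continuous_intros)
  ultimately have "set_integrable lborel (einterval (ereal 0) \<infinity>) \<mu>"
    using \<mu>_nonneg by (intro interval_integral_FTC_nonneg[where F = "\<lambda>t. 2 * arctan (sqrt t)"];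
        auto simp: ereal_tendsto_simps)
  then show ?thesis
    by simp
qed

text \<open>For c \<le> 1 this is the cancellation estimate. For c > 1 absolute values suffice:
  nonzero points of the coset keep distance \<delta> from 0, and the exponential gives c^(-2), below
  c^(-3/2). The constant is independent of p because p moves through the coset of \<beta> from row
  to row of the lattice.\<close>

lemma odd_gauss_sum_bound:
  fixes \<beta> :: real
  obtains C where "C > 0"
    "\<And>p L c. p - \<beta> \<in> \<int> \<Longrightarrow> c > 0 \<Longrightarrow>
      \<bar>\<Sum>k::int | \<bar>p + 2 * of_int k\<bar> \<le> L. (p + 2 * of_int k) * exp (- (c * (p + 2 * of_int k)\<^sup>2))\<bar> \<le> C * \<mu> c"
proof -
  obtain \<delta> where \<delta>: "\<delta> > 0" "\<delta> \<le> 1" "\<And>k::int. \<beta> + k \<noteq> 0 \<Longrightarrow> \<bar>\<beta> + k\<bar> \<ge> \<delta>"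
    using shifted_int_gap[of \<beta>] by blast
  define C where "C = 200 + 48 / \<delta> ^ 3"
  have "\<bar>\<Sum>k::int | \<bar>p + 2 * of_int k\<bar> \<le> L. (p + 2 * of_int k) * exp (- (c * (p + 2 * of_int k)\<^sup>2))\<bar> \<le> C * \<mu> c"
    if p: "p - \<beta> \<in> \<int>" and c: "c > 0" for p L c
  proof (cases "c \<le> 1")
    case True
    have "\<bar>\<Sum>k::int | \<bar>p + 2 * of_int k\<bar> \<le> L. (p + 2 * of_int k) * exp (- (c * (p + 2 * of_int k)\<^sup>2))\<bar> \<le> 100 / sqrt c"
      by (rule odd_gauss_sum_small[OF c True])
    also have "\<dots> \<le> 200 * \<mu> c"
    proof -
      have "200 / (sqrt c * 2) \<le> 200 / (sqrt c * (1 + c))"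
        using c True by (intro divide_left_mono mult_left_mono) auto
      then show ?thesis
        by (simp add: \<mu>_def)
    qed
    also have "\<dots> \<le> C * \<mu> c"
      using \<mu>_nonneg[OF c] \<delta> by (intro mult_right_mono) (auto simp: C_def)
    finally show ?thesis .
  next
    case False
    let ?K = "{k::int. \<bar>p + 2 * of_int k\<bar> \<le> L}"
    have fin: "finite ?K"
    proof (rule finite_subset)
      show "?K \<subseteq> {\<lceil>(- L - p) / 2\<rceil>..\<lfloor>(L - p) / 2\<rfloor>}"
        by (auto simp: ceiling_le_iff le_floor_iff)
    qed simp
    obtain m :: int where m: "p = \<beta> + m"
      using p by (auto elim!: Ints_cases simp: algebra_simps)
    have trm: "\<bar>x * exp (- (c * x\<^sup>2))\<bar> \<le> 4 / (c\<^sup>2 * \<delta> ^ 3) * (1 / (1 + x\<^sup>2))" if x: "x = p + 2 * of_int k" for x and k :: int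
    proof (cases "x = 0")
      case False
      have "\<beta> + of_int (m + 2 * k) = x"
        using x m by simp
      then have x\<delta>: "\<bar>x\<bar> \<ge> \<delta>"
        using \<delta>(3)[of "m + 2 * k"] False by simp
      have "\<delta>\<^sup>2 \<le> x\<^sup>2"
        using x\<delta> \<delta> power_mono[of \<delta> "\<bar>x\<bar>" 2] by simp
      moreover have "x\<^sup>2 * \<delta>\<^sup>2 \<le> x\<^sup>2 * 1"
        using \<delta> by (intro mult_left_mono) (auto simp: power_le_one)
      ultimately have 1: "\<delta>\<^sup>2 * (1 + x\<^sup>2) \<le> 2 * x\<^sup>2"
        by (simp add: algebra_simps)
      have "(c * x\<^sup>2)\<^sup>2 / 2 \<le> exp (c * x\<^sup>2)"
        using exp_ge_quadratic[of "c * x\<^sup>2"] c by (smt (verit) mult_nonneg_nonneg zero_le_power2)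
      then have 2: "exp (- (c * x\<^sup>2)) \<le> 2 / (c\<^sup>2 * (x\<^sup>2)\<^sup>2)"
        using c False by (simp add: exp_minus field_simps power_mult_distrib)
      have 3: "\<delta> ^ 3 * (1 + x\<^sup>2) \<le> 2 * \<bar>x\<bar> ^ 3"
      proof -
        have "\<delta> * (\<delta>\<^sup>2 * (1 + x\<^sup>2)) \<le> \<bar>x\<bar> * (2 * x\<^sup>2)"
          by (rule mult_mono[OF x\<delta> 1]) (use \<delta> in \<open>auto intro: mult_nonneg_nonneg\<close>)
        then show ?thesis
          by (simp add: power2_eq_square power3_eq_cube algebra_simps)
      qed
      have "\<bar>x * exp (- (c * x\<^sup>2))\<bar> \<le> \<bar>x\<bar> * (2 / (c\<^sup>2 * (x\<^sup>2)\<^sup>2))"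
        using mult_left_mono[OF 2, of "\<bar>x\<bar>"] by (simp add: abs_mult)
      also have "\<dots> = 2 / (c\<^sup>2 * \<bar>x\<bar> ^ 3)"
      proof -
        have "(x\<^sup>2)\<^sup>2 = \<bar>x\<bar> * \<bar>x\<bar> ^ 3"
          by (simp add: power2_eq_square power3_eq_cube)
        then show ?thesis
          using False by (simp add: field_simps)
      qed
      also have "\<dots> \<le> 4 / (c\<^sup>2 * \<delta> ^ 3) * (1 / (1 + x\<^sup>2))"
      proof -
        have "4 / (c\<^sup>2 * (2 * \<bar>x\<bar> ^ 3)) \<le> 4 / (c\<^sup>2 * (\<delta> ^ 3 * (1 + x\<^sup>2)))"
          using 3 c False \<delta> by (intro divide_left_mono mult_left_mono mult_pos_pos) (auto simp: add_pos_nonneg)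
        then show ?thesis
          by (simp add: mult.assoc)
      qed
      finally show ?thesis .
    qed (use c \<delta> in simp)
    have "\<bar>\<Sum>k\<in>?K. (p + 2 * of_int k) * exp (- (c * (p + 2 * of_int k)\<^sup>2))\<bar> \<le>
        (\<Sum>k\<in>?K. 4 / (c\<^sup>2 * \<delta> ^ 3) * (1 / (1 + (p + 2 * of_int k)\<^sup>2)))"
      by (intro order_trans[OF sum_abs] sum_mono) (rule trm[OF refl])
    also have "\<dots> = 4 / (c\<^sup>2 * \<delta> ^ 3) * (\<Sum>k\<in>?K. 1 / (1 + 4 * (p / 2 + k)\<^sup>2))"
      by (simp add: sum_distrib_left power2_eq_square algebra_simps)
    also have "\<dots> \<le> 4 / (c\<^sup>2 * \<delta> ^ 3) * (2 + 8 / sqrt 4)"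
      using \<delta> by (intro mult_left_mono sum_inverse_square_le fin) auto
    also have "\<dots> = 24 / \<delta> ^ 3 * (1 / c\<^sup>2)"
      by simp
    also have "\<dots> \<le> 24 / \<delta> ^ 3 * (2 * \<mu> c)"
    proof (intro mult_left_mono)
      have "sqrt c * (1 + c) \<le> c * (2 * c)"
        using False real_sqrt_le_mono[of c "c\<^sup>2"] by (intro mult_mono) (auto simp: power2_eq_square)
      then have "2 / (c * (2 * c)) \<le> 2 / (sqrt c * (1 + c))"
        using c by (intro divide_left_mono mult_pos_pos) auto
      then show "1 / c\<^sup>2 \<le> 2 * \<mu> c"
        by (simp add: \<mu>_def power2_eq_square)
    qed (use \<delta> in auto)
    also have "\<dots> = 48 / \<delta> ^ 3 * \<mu> c"
      by simp
    also have "\<dots> \<le> C * \<mu> c"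
      using \<mu>_nonneg[OF c] \<delta> by (intro mult_right_mono) (auto simp: C_def)
    finally show ?thesis .
  qed
  moreover have "C > 0"
    using \<delta> by (auto simp: C_def intro: add_pos_pos)
  ultimately show ?thesis
    using that by blast
qed

text \<open>The inner sum is bounded with cancellation, the sum over l by absolute values as a
  Gaussian sum. The radii L l are arbitrary, so all truncations with symmetric rows share one
  constant.\<close>

lemma theta_partial_sum_bound:
  fixes \<beta> :: real
  obtains C where "C > 0"
    "\<And>(p :: int \<Rightarrow> real) L J \<gamma> c d t u. (\<And>l. p l - \<beta> \<in> \<int>) \<Longrightarrow> finite J \<Longrightarrow> c \<ge> 1 \<Longrightarrow> d \<ge> 1 \<Longrightarrow> t > 0 \<Longrightarrow> u > 0 \<Longrightarrow>
      \<bar>\<Sum>l\<in>J. \<Sum>m::int | \<bar>p l + 2 * of_int m\<bar> \<le> L l. (p l + 2 * of_int m) * exp (- (c * (p l + 2 * of_int m)\<^sup>2 * t + d * (\<gamma> + of_int l)\<^sup>2 * u))\<bar>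
        \<le> C * \<mu> t * (2 + 8 / sqrt u)"
proof -
  obtain C where C: "C > 0" "\<And>p L c. p - \<beta> \<in> \<int> \<Longrightarrow> c > 0 \<Longrightarrow>
      \<bar>\<Sum>k::int | \<bar>p + 2 * of_int k\<bar> \<le> L. (p + 2 * of_int k) * exp (- (c * (p + 2 * of_int k)\<^sup>2))\<bar> \<le> C * \<mu> c"
    using odd_gauss_sum_bound by blast
  have "\<bar>\<Sum>l\<in>J. \<Sum>m::int | \<bar>p l + 2 * of_int m\<bar> \<le> L l. (p l + 2 * of_int m) * exp (- (c * (p l + 2 * of_int m)\<^sup>2 * t + d * (\<gamma> + of_int l)\<^sup>2 * u))\<bar>
        \<le> C * \<mu> t * (2 + 8 / sqrt u)"
    if p: "\<And>l. p l - \<beta> \<in> \<int>" and J: "finite J" and c: "c \<ge> 1" and d: "d \<ge> 1" and t: "t > 0" and u: "u > 0"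
    for p :: "int \<Rightarrow> real" and L J \<gamma> c d t u
  proof -
    have split: "x * exp (- (c * x\<^sup>2 * t + d * y\<^sup>2 * u)) = exp (- (d * u * y\<^sup>2)) * (x * exp (- (c * t * x\<^sup>2)))" for x y :: real
      by (simp add: algebra_simps flip: exp_add)
    have "\<bar>\<Sum>l\<in>J. \<Sum>m::int | \<bar>p l + 2 * of_int m\<bar> \<le> L l. (p l + 2 * of_int m) * exp (- (c * (p l + 2 * of_int m)\<^sup>2 * t + d * (\<gamma> + of_int l)\<^sup>2 * u))\<bar>
      = \<bar>\<Sum>l\<in>J. exp (- (d * u * (\<gamma> + of_int l)\<^sup>2)) *
          (\<Sum>m::int | \<bar>p l + 2 * of_int m\<bar> \<le> L l. (p l + 2 * of_int m) * exp (- (c * t * (p l + 2 * of_int m)\<^sup>2)))\<bar>"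
      unfolding split sum_distrib_left ..
    also have "\<dots> \<le> (\<Sum>l\<in>J. exp (- (d * u * (\<gamma> + of_int l)\<^sup>2)) * (C * \<mu> t))"
    proof (intro order_trans[OF sum_abs] sum_mono)
      fix l
      have "\<bar>\<Sum>m::int | \<bar>p l + 2 * of_int m\<bar> \<le> L l. (p l + 2 * of_int m) * exp (- (c * t * (p l + 2 * of_int m)\<^sup>2))\<bar> \<le> C * \<mu> (c * t)"
        using c t by (intro C p) auto
      also have "\<dots> \<le> C * \<mu> t"
        using c t C(1) by (intro mult_left_mono \<mu>_antimono) auto
      finally show "\<bar>exp (- (d * u * (\<gamma> + of_int l)\<^sup>2)) *
          (\<Sum>m::int | \<bar>p l + 2 * of_int m\<bar> \<le> L l. (p l + 2 * of_int m) * exp (- (c * t * (p l + 2 * of_int m)\<^sup>2)))\<bar>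
          \<le> exp (- (d * u * (\<gamma> + of_int l)\<^sup>2)) * (C * \<mu> t)"
        by (simp add: abs_mult)
    qed
    also have "\<dots> = C * \<mu> t * (\<Sum>l\<in>J. exp (- (d * u * (\<gamma> + of_int l)\<^sup>2)))"
      by (simp add: sum_distrib_left mult_ac)
    also have "\<dots> \<le> C * \<mu> t * (2 + 8 / sqrt u)"
    proof (intro mult_left_mono)
      have "(\<Sum>l\<in>J. exp (- (d * u * (\<gamma> + of_int l)\<^sup>2))) \<le> 2 + 8 / sqrt (d * u)"
        using d u by (intro sum_gauss_le J) auto
      also have "\<dots> \<le> 2 + 8 / sqrt u"
        using d u by (intro add_left_mono divide_left_mono) auto
      finally show "(\<Sum>l\<in>J. exp (- (d * u * (\<gamma> + of_int l)\<^sup>2))) \<le> 2 + 8 / sqrt u" .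
    qed (use C(1) \<mu>_nonneg[OF t] in auto)
    finally show ?thesis .
  qed
  then show ?thesis
    using that C(1) by blast
qed

section \<open>Cotangent sums over windows\<close>

text \<open>Logarithmic derivative of the reflection formula for Gamma.\<close>

lemma Digamma_reflection:
  fixes z :: complex
  assumes "z \<notin> \<int>"
  shows "Digamma (1 - z) - Digamma z = of_real pi * cot (of_real pi * z)"
proof -
  have z': "1 - z \<notin> \<int>"
    using assms Ints_diff[of 1 "1 - z"] by auto
  have nz: "z \<notin> \<int>\<^sub>\<le>\<^sub>0" "1 - z \<notin> \<int>\<^sub>\<le>\<^sub>0"
    using assms z' nonpos_Ints_subset_Ints by blast+
  have sin: "sin (of_real pi * z) \<noteq> 0"
  proof
    assume "sin (of_real pi * z) = 0"
    then obtain n :: int where "of_real pi * z = of_real n * of_real pi"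
      by (auto simp: sin_eq_0 mult.commute)
    then have "z = of_int n"
      by (simp add: mult.commute)
    with assms show False by simp
  qed
  have "((\<lambda>w. Gamma w * Gamma (1 - w)) has_field_derivative
      Gamma z * Gamma (1 - z) * (Digamma z - Digamma (1 - z))) (at z)"
    using nz by (auto intro!: derivative_eq_intros simp: algebra_simps)
  moreover have "(\<lambda>w. Gamma w * Gamma (1 - w)) = (\<lambda>w::complex. of_real pi / sin (of_real pi * w))"
    by (intro ext Gamma_reflection_complex)
  moreover have "((\<lambda>w::complex. of_real pi / sin (of_real pi * w)) has_field_derivative
      - (of_real pi * (of_real pi * cos (of_real pi * z))) / (sin (of_real pi * z))\<^sup>2) (at z)"
    using sin by (auto intro!: derivative_eq_intros simp: power2_eq_square)
  ultimately have "Gamma z * Gamma (1 - z) * (Digamma z - Digamma (1 - z)) =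
      - (of_real pi * (of_real pi * cos (of_real pi * z))) / (sin (of_real pi * z))\<^sup>2"
    using DERIV_unique by metis
  then have eq: "of_real pi / sin (of_real pi * z) * (Digamma z - Digamma (1 - z)) =
      - (of_real pi * (of_real pi * cos (of_real pi * z))) / (sin (of_real pi * z))\<^sup>2"
    unfolding Gamma_reflection_complex .
  have "of_real pi / sin (of_real pi * z) * (Digamma (1 - z) - Digamma z) =
      - (of_real pi / sin (of_real pi * z) * (Digamma z - Digamma (1 - z)))"
    by (simp only: mult_minus_right[symmetric] minus_diff_eq)
  also have "\<dots> = of_real pi / sin (of_real pi * z) * (of_real pi * (cos (of_real pi * z) / sin (of_real pi * z)))"
    unfolding eq by (simp add: power2_eq_square)
  finally have "of_real pi / sin (of_real pi * z) * (Digamma (1 - z) - Digamma z) =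
      of_real pi / sin (of_real pi * z) * (of_real pi * (cos (of_real pi * z) / sin (of_real pi * z)))" .
  moreover have "of_real pi / sin (of_real pi * z) \<noteq> 0"
    using sin by simp
  ultimately show ?thesis
    unfolding mult_left_cancel[OF \<open>of_real pi / sin (of_real pi * z) \<noteq> 0\<close>] by (simp add: cot_def)
qed

lemma sum_int_symmetric_split:
  fixes g :: "int \<Rightarrow> 'a::comm_monoid_add"
  shows "(\<Sum>k=- int m..int m - 1. g k) = (\<Sum>n<m. g (int n)) + (\<Sum>n<m. g (- int n - 1))"
proof (induction m)
  case (Suc m)
  have "{- int (Suc m)..int (Suc m) - 1} = insert (int m) (insert (- int m - 1) {- int m..int m - 1})"
    by auto
  then show ?case
    using Suc by (simp add: add_ac)
qed simp

text \<open>The limits for Digamma at z and at 1 - z carry the same logarithm, which cancels in the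
  difference. Negative indices enter as - n - 1, whence the half-open window from - m to m -
  1.\<close>

lemma cot_partial_fractions:
  fixes z :: complex
  assumes "z \<notin> \<int>"
  shows "(\<lambda>m. \<Sum>k=- int m..int m - 1. 1 / (z + of_int k)) \<longlonglongrightarrow> of_real pi * cot (of_real pi * z)"
proof -
  have nz: "z \<noteq> 0" "1 - z \<noteq> 0"
    using assms by auto
  have "(\<lambda>m. (of_real (ln (real m)) - (\<Sum>n<m. inverse (1 - z + of_nat n))) -
      (of_real (ln (real m)) - (\<Sum>n<m. inverse (z + of_nat n)))) \<longlonglongrightarrow> Digamma (1 - z) - Digamma z"
    by (intro tendsto_diff Digamma_LIMSEQ nz)
  moreover have "(of_real (ln (real m)) - (\<Sum>n<m. inverse (1 - z + of_nat n))) -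
      (of_real (ln (real m)) - (\<Sum>n<m. inverse (z + of_nat n))) = (\<Sum>k=- int m..int m - 1. 1 / (z + of_int k))" for m
  proof -
    have "1 / (z + of_int (- int n - 1)) = - inverse (1 - z + of_nat n)" for n
    proof -
      have "z + of_int (- int n - 1) = - (1 - z + of_nat n)"
        by simp
      then show ?thesis
        by (simp only: inverse_eq_divide divide_minus_right)
    qed
    then show ?thesis
      unfolding sum_int_symmetric_split by (simp add: sum_negf inverse_eq_divide)
  qed
  ultimately show ?thesis
    by (simp add: Digamma_reflection[OF assms])
qed

lemma cot_complex_eq:
  fixes x a :: real
  assumes "x \<noteq> 0"
  shows "cot (of_real pi * Complex a x) = Complex (\<G> a x) (- \<F> a x)"
proof -
  let ?s = "sin (pi * a)" and ?c = "cos (pi * a)" and ?S = "sinh (pi * x)" and ?C = "cosh (pi * x)"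
  have cs: "?s\<^sup>2 + ?c\<^sup>2 = 1" "?C\<^sup>2 = ?S\<^sup>2 + 1"
    by (simp_all add: cosh_square_eq)
  have S0: "?S \<noteq> 0"
    using assms by simp
  have sin: "sin (of_real pi * Complex a x) = Complex (?s * ?C) (?c * ?S)"
    and cos: "cos (of_real pi * Complex a x) = Complex (?c * ?C) (- (?s * ?S))"
    by (auto simp: complex_eq_iff Re_sin Im_sin Re_cos Im_cos cosh_def sinh_def field_simps)
  have D: "cosh (2 * pi * x) - cos (2 * pi * a) = 2 * (?S\<^sup>2 + ?s\<^sup>2)"
  proof -
    have "cosh (2 * pi * x) = 2 * ?C\<^sup>2 - 1" "cos (2 * pi * a) = 2 * ?c\<^sup>2 - 1"
      using cosh_double_cosh[of "pi * x"] cos_double_cos[of "pi * a"] by (simp_all add: mult.assoc)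
    moreover have "?c\<^sup>2 = 1 - ?s\<^sup>2"
      by (rule cos_squared_eq)
    ultimately show ?thesis
      using cs(2) by (simp add: algebra_simps)
  qed
  have nrm: "(?s * ?C)\<^sup>2 + (?c * ?S)\<^sup>2 = ?S\<^sup>2 + ?s\<^sup>2"
  proof -
    have "(?s * ?C)\<^sup>2 + (?c * ?S)\<^sup>2 = ?s\<^sup>2 * (?S\<^sup>2 + 1) + (1 - ?s\<^sup>2) * ?S\<^sup>2"
      by (simp only: power_mult_distrib cs(2) cos_squared_eq[of "pi * a"])
    then show ?thesis by (simp add: algebra_simps)
  qed
  have "\<G> a x = ?s * ?c / (?S\<^sup>2 + ?s\<^sup>2)"
    unfolding \<G>_def D using sin_double[of "pi * a"] by (simp add: mult.assoc del: distrib_left_numeral)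
  moreover have "\<F> a x = ?S * ?C / (?S\<^sup>2 + ?s\<^sup>2)"
    unfolding \<F>_def D using sinh_double[of "pi * x"] by (simp add: mult.assoc del: distrib_left_numeral)
  moreover have "?c * ?C * (?s * ?C) - ?s * ?S * (?c * ?S) = ?s * ?c"
  proof -
    have "?c * ?C * (?s * ?C) - ?s * ?S * (?c * ?S) = ?s * ?c * (?C\<^sup>2 - ?S\<^sup>2)"
      by (simp add: power2_eq_square algebra_simps)
    then show ?thesis using cs by simp
  qed
  moreover have "- (?s * ?S) * (?s * ?C) - ?c * ?C * (?c * ?S) = - (?S * ?C)"
  proof -
    have "- (?s * ?S) * (?s * ?C) - ?c * ?C * (?c * ?S) = - (?S * ?C) * (?s * ?s + ?c * ?c)"
      by (simp add: algebra_simps del: sin_cos_squared_add3)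
    also have "?s * ?s + ?c * ?c = ?s\<^sup>2 + ?c\<^sup>2"
      by (simp only: power2_eq_square)
    finally have "- (?s * ?S) * (?s * ?C) - ?c * ?C * (?c * ?S) = - (?S * ?C) * (?s\<^sup>2 + ?c\<^sup>2)" .
    then show ?thesis using cs by simp
  qed
  ultimately show ?thesis
    unfolding cot_def sin cos by (simp add: complex_eq_iff Re_divide Im_divide nrm)
qed

text \<open>Real part and negated imaginary part of the cotangent series at \<beta> + i x. Only the
  second series converges absolutely, so the first depends on the shape of the windows.\<close>

lemma \<G>_\<F>_symmetric_limits:
  fixes \<beta> x :: real
  assumes "x \<noteq> 0"
  shows "(\<lambda>m. \<Sum>k=- int m..int m - 1. (\<beta> + of_int k) / ((\<beta> + of_int k)\<^sup>2 + x\<^sup>2)) \<longlonglongrightarrow> pi * \<G> \<beta> x"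
    and "(\<lambda>m. \<Sum>k=- int m..int m - 1. x / ((\<beta> + of_int k)\<^sup>2 + x\<^sup>2)) \<longlonglongrightarrow> pi * \<F> \<beta> x"
proof -
  have "Complex \<beta> x \<notin> \<int>"
    using assms by (auto elim!: Ints_cases simp: complex_eq_iff)
  from cot_partial_fractions[OF this]
  have lim: "(\<lambda>m. \<Sum>k=- int m..int m - 1. 1 / (Complex \<beta> x + of_int k)) \<longlonglongrightarrow> of_real pi * Complex (\<G> \<beta> x) (- \<F> \<beta> x)"
    by (simp only: cot_complex_eq[OF assms])
  have "Re (1 / (Complex \<beta> x + of_int k)) = (\<beta> + of_int k) / ((\<beta> + of_int k)\<^sup>2 + x\<^sup>2)"
    "- Im (1 / (Complex \<beta> x + of_int k)) = x / ((\<beta> + of_int k)\<^sup>2 + x\<^sup>2)" for k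
    by (simp_all add: Re_divide Im_divide)
  with tendsto_Re[OF lim] tendsto_minus[OF tendsto_Im[OF lim]]
  show "(\<lambda>m. \<Sum>k=- int m..int m - 1. (\<beta> + of_int k) / ((\<beta> + of_int k)\<^sup>2 + x\<^sup>2)) \<longlonglongrightarrow> pi * \<G> \<beta> x"
    "(\<lambda>m. \<Sum>k=- int m..int m - 1. x / ((\<beta> + of_int k)\<^sup>2 + x\<^sup>2)) \<longlonglongrightarrow> pi * \<F> \<beta> x"
    by (simp_all flip: sum_negf)
qed

text \<open>Two windows of length about \<open>2 L\<close> whose centres differ by \<open>\<rho>\<close> differ
  only in about \<open>4 \<bar>\<rho>\<bar>\<close> integers, all of absolute value about \<open>L\<close>.\<close>
lemma window_difference:
  fixes f :: "int \<Rightarrow> real" and \<rho> L :: real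
  assumes "L \<ge> 0"
  defines "D \<equiv> {k::int. L - \<bar>\<rho>\<bar> \<le> \<bar>real_of_int k\<bar> \<and> \<bar>real_of_int k\<bar> \<le> L + \<bar>\<rho>\<bar> + 1}"
  shows "finite D" "real (card D) \<le> 4 * \<bar>\<rho>\<bar> + 4"
    "\<bar>(\<Sum>k | \<bar>\<rho> + of_int k\<bar> \<le> L. f k) - (\<Sum>k=-\<lceil>L\<rceil>..\<lceil>L\<rceil> - 1. f k)\<bar> \<le> (\<Sum>k\<in>D. \<bar>f k\<bar>)"
proof -
  define A where "A = {\<lceil>L - \<bar>\<rho>\<bar>\<rceil>..\<lfloor>L + \<bar>\<rho>\<bar> + 1\<rfloor>}"
  have DA: "D \<subseteq> A \<union> uminus ` A"
  proof
    fix k assume "k \<in> D"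
    then have "\<bar>k\<bar> \<in> A"
      unfolding D_def A_def mem_Collect_eq atLeastAtMost_iff ceiling_le_iff le_floor_iff by simp
    then show "k \<in> A \<union> uminus ` A"
      by (cases "k \<ge> 0") (auto simp: image_iff intro: bexI[of _ "-k"])
  qed
  then show fin: "finite D"
    by (rule finite_subset) (simp add: A_def)
  have cardA: "real (card A) \<le> 2 * \<bar>\<rho>\<bar> + 2"
  proof -
    have "real_of_int (\<lfloor>L + \<bar>\<rho>\<bar> + 1\<rfloor> - \<lceil>L - \<bar>\<rho>\<bar>\<rceil> + 1) \<le> 2 * \<bar>\<rho>\<bar> + 2"
      by linarith
    then show ?thesis
      unfolding A_def card_atLeastAtMost_int by (simp add: of_nat_nat max_def)
  qed
  have "card D \<le> card (A \<union> uminus ` A)"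
    using DA by (intro card_mono) (simp_all add: A_def)
  also have "\<dots> \<le> card A + card A"
    by (intro order_trans[OF card_Un_le] add_left_mono card_image_le) (simp add: A_def)
  finally show "real (card D) \<le> 4 * \<bar>\<rho>\<bar> + 4"
    using cardA by linarith
  define K where "K = {k::int. \<bar>\<rho> + of_int k\<bar> \<le> L}"
  define I where "I = {-\<lceil>L\<rceil>..\<lceil>L\<rceil> - 1}"
  have finK: "finite K"
  proof (rule finite_subset)
    show "K \<subseteq> {\<lceil>- L - \<rho>\<rceil>..\<lfloor>L - \<rho>\<rfloor>}"
      by (auto simp: K_def ceiling_le_iff le_floor_iff)
  qed simp
  have KI: "K - I \<subseteq> D" and IK: "I - K \<subseteq> D"
  proof -
    show "K - I \<subseteq> D"
    proof
      fix k assume k: "k \<in> K - I"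
      then have "k < -\<lceil>L\<rceil> \<or> k \<ge> \<lceil>L\<rceil>"
        by (auto simp: I_def)
      then have "\<bar>real_of_int k\<bar> \<ge> L"
        by linarith
      moreover have "\<bar>\<rho> + of_int k\<bar> \<le> L"
        using k by (simp add: K_def)
      ultimately show "k \<in> D"
        unfolding D_def mem_Collect_eq by linarith
    qed
    show "I - K \<subseteq> D"
    proof
      fix k assume k: "k \<in> I - K"
      then have "-\<lceil>L\<rceil> \<le> k" "k \<le> \<lceil>L\<rceil> - 1"
        by (auto simp: I_def)
      then have "\<bar>real_of_int k\<bar> \<le> L + 1"
        by linarith
      moreover have "\<bar>\<rho> + of_int k\<bar> > L"
        using k by (simp add: K_def)
      ultimately show "k \<in> D"
        unfolding D_def mem_Collect_eq by linarith
    qed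
  qed
  have "(\<Sum>k\<in>K. f k) - (\<Sum>k\<in>I. f k) = (\<Sum>k\<in>K - I. f k) - (\<Sum>k\<in>I - K. f k)"
    using finK sum.Int_Diff[of K f I] sum.Int_Diff[of I f K] by (simp add: I_def Int_commute)
  then have "\<bar>(\<Sum>k\<in>K. f k) - (\<Sum>k\<in>I. f k)\<bar> \<le> (\<Sum>k\<in>K - I. \<bar>f k\<bar>) + (\<Sum>k\<in>I - K. \<bar>f k\<bar>)"
    using sum_abs[of f "K - I"] sum_abs[of f "I - K"] by linarith
  also have "\<dots> = (\<Sum>k\<in>(K - I) \<union> (I - K). \<bar>f k\<bar>)"
    using finK by (intro sum.union_disjoint[symmetric]) (auto simp: I_def)
  also have "\<dots> \<le> (\<Sum>k\<in>D. \<bar>f k\<bar>)"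
    using KI IK fin by (intro sum_mono2) auto
  finally show "\<bar>(\<Sum>k | \<bar>\<rho> + of_int k\<bar> \<le> L. f k) - (\<Sum>k=-\<lceil>L\<rceil>..\<lceil>L\<rceil> - 1. f k)\<bar> \<le> (\<Sum>k\<in>D. \<bar>f k\<bar>)"
    by (simp add: K_def I_def)
qed

section \<open>Window sums with a displaced centre\<close>

lemma \<G>_term_bound:
  fixes \<beta> :: real
  shows "\<exists>M>0. (\<forall>(k::int) x. \<bar>(\<beta> + k) / ((\<beta> + k)\<^sup>2 + x\<^sup>2)\<bar> \<le> M / (1 + \<bar>real_of_int k\<bar>)) \<and>
    (\<forall>(k::int). \<beta> + k \<noteq> 0 \<longrightarrow> 1 / \<bar>\<beta> + k\<bar> \<le> M)"
proof -
  obtain \<delta> where \<delta>: "\<delta> > 0" "\<delta> \<le> 1" "\<And>k::int. \<beta> + k \<noteq> 0 \<Longrightarrow> \<bar>\<beta> + k\<bar> \<ge> \<delta>"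
    using shifted_int_gap[of \<beta>] by blast
  define M where "M = (1 + \<bar>\<beta>\<bar>) / \<delta> + 1"
  have M: "M > 0"
    using \<delta> by (simp add: M_def add_nonneg_pos)
  have "\<bar>(\<beta> + k) / ((\<beta> + k)\<^sup>2 + x\<^sup>2)\<bar> \<le> M / (1 + \<bar>real_of_int k\<bar>)" for k :: int and x
  proof (cases "\<beta> + k = 0")
    case False
    define y where "y = \<beta> + k"
    have y: "\<bar>y\<bar> \<ge> \<delta>" "y \<noteq> 0"
      using \<delta> False by (auto simp: y_def)
    have "1 + \<bar>real_of_int k\<bar> \<le> (1 + \<bar>\<beta>\<bar>) * 1 + \<bar>y\<bar>"
      by (simp add: y_def)
    also have "\<dots> \<le> (1 + \<bar>\<beta>\<bar>) * (\<bar>y\<bar> / \<delta>) + \<bar>y\<bar>"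
      using y \<delta> by (intro add_right_mono mult_left_mono) auto
    also have "\<dots> = M * \<bar>y\<bar>"
      by (simp add: M_def algebra_simps)
    finally have "1 + \<bar>real_of_int k\<bar> \<le> M * \<bar>y\<bar>" .
    then have "1 / \<bar>y\<bar> \<le> M / (1 + \<bar>real_of_int k\<bar>)"
      using y by (simp add: field_simps)
    moreover have "\<bar>y / (y\<^sup>2 + x\<^sup>2)\<bar> \<le> 1 / \<bar>y\<bar>"
    proof -
      have "\<bar>y\<bar> / (y\<^sup>2 + x\<^sup>2) \<le> \<bar>y\<bar> / y\<^sup>2"
        using y by (intro divide_left_mono mult_pos_pos) (auto simp: add_pos_nonneg)
      also have "\<dots> = 1 / \<bar>y\<bar>"
        using y abs_mult_self_eq[of y] by (simp add: power2_eq_square divide_eq_eq eq_divide_eq)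
      finally show ?thesis by simp
    qed
    ultimately show ?thesis
      by (simp add: y_def)
  qed (use M in simp)
  moreover have "1 / \<bar>\<beta> + k\<bar> \<le> M" if "\<beta> + k \<noteq> 0" for k :: int
  proof -
    have "1 / \<bar>\<beta> + k\<bar> \<le> 1 / \<delta>"
      using \<delta>(1) \<delta>(3)[OF that] by (intro divide_left_mono) (auto simp: that)
    also have "\<dots> \<le> M"
      using \<delta> by (simp add: M_def field_simps)
    finally show ?thesis .
  qed
  ultimately show ?thesis
    using M by blast
qed

text \<open>A fixed displacement changes the symmetric window by a bounded number of integers, all
  near L or - L, where the terms are of order 1/L.\<close>

lemma \<G>_window_limit:
  fixes \<beta> \<sigma> x :: real and L :: "nat \<Rightarrow> real"
  assumes x: "x \<noteq> 0" and L: "filterlim L at_top sequentially"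
  shows "(\<lambda>N. \<Sum>k | \<bar>\<beta> + \<sigma> + of_int k\<bar> \<le> L N. (\<beta> + of_int k) / ((\<beta> + of_int k)\<^sup>2 + x\<^sup>2)) \<longlonglongrightarrow> pi * \<G> \<beta> x"
proof -
  let ?f = "\<lambda>k::int. (\<beta> + of_int k) / ((\<beta> + of_int k)\<^sup>2 + x\<^sup>2)"
  define \<rho> where "\<rho> = \<beta> + \<sigma>"
  obtain M where M: "M > 0" "\<And>(k::int) x. \<bar>(\<beta> + k) / ((\<beta> + k)\<^sup>2 + x\<^sup>2)\<bar> \<le> M / (1 + \<bar>real_of_int k\<bar>)"
    using \<G>_term_bound[of \<beta>] by auto
  have "filterlim (\<lambda>N. nat \<lceil>L N\<rceil>) at_top sequentially"
    unfolding filterlim_at_top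
  proof
    fix Z :: nat
    have "eventually (\<lambda>N. L N \<ge> real Z) sequentially"
      using L by (simp add: filterlim_at_top)
    then show "eventually (\<lambda>N. Z \<le> nat \<lceil>L N\<rceil>) sequentially"
      by eventually_elim linarith
  qed
  then have lim: "(\<lambda>N. \<Sum>k=- int (nat \<lceil>L N\<rceil>)..int (nat \<lceil>L N\<rceil>) - 1. ?f k) \<longlonglongrightarrow> pi * \<G> \<beta> x"
    by (rule filterlim_compose[OF \<G>_\<F>_symmetric_limits(1)[OF x]])
  have "(\<lambda>N. (\<Sum>k | \<bar>\<rho> + of_int k\<bar> \<le> L N. ?f k) - (\<Sum>k=- int (nat \<lceil>L N\<rceil>)..int (nat \<lceil>L N\<rceil>) - 1. ?f k)) \<longlonglongrightarrow> 0"
  proof (rule Lim_null_comparison)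
    have "eventually (\<lambda>N. L N > \<bar>\<rho>\<bar>) sequentially"
      using L by (simp add: filterlim_at_top_dense)
    then show "eventually (\<lambda>N. norm ((\<Sum>k | \<bar>\<rho> + of_int k\<bar> \<le> L N. ?f k) - (\<Sum>k=- int (nat \<lceil>L N\<rceil>)..int (nat \<lceil>L N\<rceil>) - 1. ?f k))
        \<le> (4 * \<bar>\<rho>\<bar> + 4) * (M / (1 + (L N - \<bar>\<rho>\<bar>)))) sequentially"
    proof eventually_elim
      case (elim N)
      let ?D = "{k::int. L N - \<bar>\<rho>\<bar> \<le> \<bar>real_of_int k\<bar> \<and> \<bar>real_of_int k\<bar> \<le> L N + \<bar>\<rho>\<bar> + 1}"
      have L0: "L N \<ge> 0" using elim by linarith
      have "\<bar>(\<Sum>k | \<bar>\<rho> + of_int k\<bar> \<le> L N. ?f k) - (\<Sum>k=-\<lceil>L N\<rceil>..\<lceil>L N\<rceil> - 1. ?f k)\<bar> \<le> (\<Sum>k\<in>?D. \<bar>?f k\<bar>)"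
        by (rule window_difference(3)[OF L0])
      also have "\<dots> \<le> (\<Sum>k\<in>?D. M / (1 + (L N - \<bar>\<rho>\<bar>)))"
      proof (intro sum_mono order_trans[OF M(2)] divide_left_mono mult_pos_pos)
      qed (use M elim in auto)
      also have "\<dots> = real (card ?D) * (M / (1 + (L N - \<bar>\<rho>\<bar>)))"
        by simp
      also have "\<dots> \<le> (4 * \<bar>\<rho>\<bar> + 4) * (M / (1 + (L N - \<bar>\<rho>\<bar>)))"
        using M elim by (intro mult_right_mono window_difference(2)[OF L0]) auto
      finally show ?case
        using L0 by simp
    qed
    have "filterlim (\<lambda>N. (1 - \<bar>\<rho>\<bar>) + L N) at_top sequentially"
      by (rule filterlim_tendsto_add_at_top[OF tendsto_const L])
    then have "(\<lambda>N. M / (1 + (L N - \<bar>\<rho>\<bar>))) \<longlonglongrightarrow> 0"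
      by (intro tendsto_divide_0[OF tendsto_const] filterlim_at_top_imp_at_infinity) (simp add: algebra_simps)
    from tendsto_mult_right_zero[OF this]
    show "(\<lambda>N. (4 * \<bar>\<rho>\<bar> + 4) * (M / (1 + (L N - \<bar>\<rho>\<bar>)))) \<longlonglongrightarrow> 0" .
  qed
  from tendsto_add[OF this lim] show ?thesis
    by (simp add: \<rho>_def)
qed

text \<open>The displacement \<sigma> will grow with the row, so its cost must be explicit. The
  symmetric windows are bounded by convergence at x = 1 and an absolutely convergent correction. The
  displaced window adds at most about 4 |\<sigma>| terms, and Cauchy-Schwarz turns their number into
  a square root. This is summable against 1 / (1 + l^2); a cost linear in \<sigma> would not
  be.\<close>

lemma \<G>_window_bound:
  fixes \<beta> :: real
  obtains C where "C > 0"
    "\<And>\<sigma> x L. \<bar>\<Sum>k::int | \<bar>\<beta> + \<sigma> + of_int k\<bar> \<le> L. (\<beta> + of_int k) / ((\<beta> + of_int k)\<^sup>2 + x\<^sup>2)\<bar> \<le> C * (1 + x\<^sup>2) * (1 + sqrt \<bar>\<sigma>\<bar>)"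
proof -
  define f where "f x k = (\<beta> + of_int k) / ((\<beta> + of_int k)\<^sup>2 + x\<^sup>2)" for x and k :: int
  obtain M where M: "M > 0" "\<And>k x. \<bar>f x k\<bar> \<le> M / (1 + \<bar>real_of_int k\<bar>)"
    "\<And>k::int. \<beta> + k \<noteq> 0 \<Longrightarrow> 1 / \<bar>\<beta> + k\<bar> \<le> M"
    unfolding f_def using \<G>_term_bound[of \<beta>] by auto
  have "convergent (\<lambda>m. \<Sum>k=- int m..int m - 1. f 1 k)"
    using \<G>_\<F>_symmetric_limits(1)[of 1 \<beta>] by (auto simp: convergent_def f_def)
  then have "Bseq (\<lambda>m. \<Sum>k=- int m..int m - 1. f 1 k)"
    by (rule convergent_imp_Bseq)
  then obtain B where B: "B > 0" "\<And>m. \<bar>\<Sum>k=- int m..int m - 1. f 1 k\<bar> \<le> B"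
    by (auto simp: Bseq_def)
  have diff: "\<bar>f x k - f 1 k\<bar> \<le> (1 + x\<^sup>2) * M * (1 / (1 + 1 * (\<beta> + of_int k)\<^sup>2))" for x k
  proof (cases "\<beta> + of_int k = 0")
    case False
    define y where "y = \<beta> + of_int k"
    have y: "y \<noteq> 0" "1 / \<bar>y\<bar> \<le> M"
      using False M(3) by (auto simp: y_def)
    have pos: "y\<^sup>2 + x\<^sup>2 > 0" "y\<^sup>2 + 1 > 0"
      using y by (auto simp: add_pos_nonneg)
    have "f x k - f 1 k = (y * (y\<^sup>2 + 1) - y * (y\<^sup>2 + x\<^sup>2)) / ((y\<^sup>2 + x\<^sup>2) * (y\<^sup>2 + 1))"
      unfolding f_def y_def[symmetric] using pos by (simp only: diff_frac_eq less_imp_neq[symmetric] not_False_eq_True power_one)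
    also have "y * (y\<^sup>2 + 1) - y * (y\<^sup>2 + x\<^sup>2) = (1 - x\<^sup>2) * y"
      by (simp add: algebra_simps)
    finally have "f x k - f 1 k = (1 - x\<^sup>2) * (y / (y\<^sup>2 + x\<^sup>2)) * (1 / (1 + y\<^sup>2))"
      by (simp add: add.commute)
    then have "\<bar>f x k - f 1 k\<bar> = \<bar>1 - x\<^sup>2\<bar> * \<bar>y / (y\<^sup>2 + x\<^sup>2)\<bar> * (1 / (1 + y\<^sup>2))"
      using pos by (simp add: abs_mult)
    also have "\<bar>y / (y\<^sup>2 + x\<^sup>2)\<bar> = \<bar>y\<bar> / (y\<^sup>2 + x\<^sup>2)"
      using pos by simp
    also have "\<bar>1 - x\<^sup>2\<bar> * (\<bar>y\<bar> / (y\<^sup>2 + x\<^sup>2)) * (1 / (1 + y\<^sup>2)) \<le> (1 + x\<^sup>2) * M * (1 / (1 + y\<^sup>2))"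
    proof (intro mult_right_mono mult_mono)
      have "\<bar>y\<bar> / (y\<^sup>2 + x\<^sup>2) \<le> \<bar>y\<bar> / y\<^sup>2"
        using y by (intro divide_left_mono mult_pos_pos) (auto simp: add_pos_nonneg)
      also have "\<dots> = 1 / \<bar>y\<bar>"
        using y abs_mult_self_eq[of y] by (simp add: power2_eq_square divide_eq_eq eq_divide_eq)
      finally show "\<bar>y\<bar> / (y\<^sup>2 + x\<^sup>2) \<le> M"
        using y by linarith
      show "\<bar>1 - x\<^sup>2\<bar> \<le> 1 + x\<^sup>2"
        using zero_le_power2[of x] by linarith
    qed (use pos in auto)
    finally show ?thesis
      by (simp add: y_def)
  qed (use M in \<open>simp add: f_def\<close>)
  have sym: "\<bar>\<Sum>k=- int m..int m - 1. f x k\<bar> \<le> (B + 10 * M) * (1 + x\<^sup>2)" for x m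
  proof -
    have "\<bar>\<Sum>k=- int m..int m - 1. f x k - f 1 k\<bar> \<le> (\<Sum>k=- int m..int m - 1. (1 + x\<^sup>2) * M * (1 / (1 + 1 * (\<beta> + of_int k)\<^sup>2)))"
      by (intro order_trans[OF sum_abs] sum_mono diff)
    also have "\<dots> = (1 + x\<^sup>2) * M * (\<Sum>k=- int m..int m - 1. 1 / (1 + 1 * (\<beta> + of_int k)\<^sup>2))"
      by (simp only: sum_distrib_left)
    also have "\<dots> \<le> (1 + x\<^sup>2) * M * (2 + 8 / sqrt 1)"
      using M by (intro mult_left_mono sum_inverse_square_le) auto
    finally have "\<bar>\<Sum>k=- int m..int m - 1. f x k\<bar> \<le> B + (1 + x\<^sup>2) * M * 10"
      using B(2)[of m] by (simp add: sum_subtractf)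
    also have "\<dots> \<le> (B + 10 * M) * (1 + x\<^sup>2)"
      using B(1) by (simp add: algebra_simps)
    finally show ?thesis .
  qed
  define C where "C = B + 10 * M + 4 * M * (sqrt (4 * \<bar>\<beta>\<bar> + 4) + 2)"
  have C: "C > 0"
    using B M unfolding C_def by (intro add_pos_nonneg add_pos_pos mult_nonneg_nonneg) auto
  have "\<bar>\<Sum>k::int | \<bar>\<beta> + \<sigma> + of_int k\<bar> \<le> L. f x k\<bar> \<le> C * (1 + x\<^sup>2) * (1 + sqrt \<bar>\<sigma>\<bar>)" for \<sigma> x L
  proof (cases "L \<ge> 0")
    case True
    define \<rho> where "\<rho> = \<beta> + \<sigma>"
    let ?D = "{k::int. L - \<bar>\<rho>\<bar> \<le> \<bar>real_of_int k\<bar> \<and> \<bar>real_of_int k\<bar> \<le> L + \<bar>\<rho>\<bar> + 1}"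
    have fin: "finite ?D"
      by (rule window_difference(1)[OF True])
    have "(\<Sum>k\<in>?D. \<bar>f x k\<bar>) = (\<Sum>k\<in>?D. \<bar>1\<bar> * \<bar>f x k\<bar>)"
      by simp
    \<comment> \<open>Cauchy-Schwarz: the first factor counts the exceptional integers, the second
      is bounded because the squares of the terms are summable uniformly in x.\<close>
    also have "\<dots> \<le> sqrt (\<Sum>k\<in>?D. 1\<^sup>2) * sqrt (\<Sum>k\<in>?D. (f x k)\<^sup>2)"
      using L2_set_mult_ineq[of "\<lambda>_. 1" "f x" ?D] by (simp add: L2_set_def)
    also have "\<dots> \<le> sqrt (4 * \<bar>\<rho>\<bar> + 4) * sqrt (M\<^sup>2 * 10)"
    proof (intro mult_mono)
      show "sqrt (\<Sum>k\<in>?D. 1\<^sup>2) \<le> sqrt (4 * \<bar>\<rho>\<bar> + 4)"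
        using window_difference(2)[OF True, of \<rho>] by simp
      have "(f x k)\<^sup>2 \<le> M\<^sup>2 * (1 / (1 + 1 * (0 + of_int k)\<^sup>2))" for k
      proof -
        have "(f x k)\<^sup>2 \<le> (M / (1 + \<bar>real_of_int k\<bar>))\<^sup>2"
          using M(2)[of x k] by (intro abs_le_square_iff[THEN iffD1]) (use M in auto)
        also have "\<dots> \<le> M\<^sup>2 * (1 / (1 + 1 * (0 + of_int k)\<^sup>2))"
        proof -
          have "1 + (real_of_int k)\<^sup>2 \<le> (1 + \<bar>real_of_int k\<bar>)\<^sup>2"
            by (simp add: power2_eq_square algebra_simps)
          then have "M\<^sup>2 / (1 + \<bar>real_of_int k\<bar>)\<^sup>2 \<le> M\<^sup>2 / (1 + (real_of_int k)\<^sup>2)"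
            by (intro divide_left_mono mult_pos_pos) (auto simp: add_pos_nonneg)
          then show ?thesis by (simp add: power_divide)
        qed
        finally show ?thesis .
      qed
      then have "(\<Sum>k\<in>?D. (f x k)\<^sup>2) \<le> (\<Sum>k\<in>?D. M\<^sup>2 * (1 / (1 + 1 * (0 + of_int k)\<^sup>2)))"
        by (rule sum_mono)
      also have "\<dots> = M\<^sup>2 * (\<Sum>k\<in>?D. 1 / (1 + 1 * (0 + of_int k)\<^sup>2))"
        by (simp only: sum_distrib_left)
      also have "\<dots> \<le> M\<^sup>2 * (2 + 8 / sqrt 1)"
        by (intro mult_left_mono sum_inverse_square_le fin) auto
      finally show "sqrt (\<Sum>k\<in>?D. (f x k)\<^sup>2) \<le> sqrt (M\<^sup>2 * 10)"
        by simp
    qed (auto intro: sum_nonneg)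
    also have "\<dots> \<le> sqrt (4 * \<bar>\<rho>\<bar> + 4) * (4 * M)"
    proof (intro mult_left_mono)
      show "sqrt (M\<^sup>2 * 10) \<le> 4 * M"
        using M by (intro real_le_lsqrt) (auto simp: power_mult_distrib)
    qed auto
    finally have tail0: "(\<Sum>k\<in>?D. \<bar>f x k\<bar>) \<le> sqrt (4 * \<bar>\<rho>\<bar> + 4) * (4 * M)" .
    have "sqrt (4 * \<bar>\<rho>\<bar> + 4) \<le> sqrt (4 * \<bar>\<beta>\<bar> + 4) + 2 * sqrt \<bar>\<sigma>\<bar>"
    proof -
      have "sqrt (4 * \<bar>\<rho>\<bar> + 4) \<le> sqrt ((4 * \<bar>\<beta>\<bar> + 4) + 4 * \<bar>\<sigma>\<bar>)"
        using abs_triangle_ineq[of \<beta> \<sigma>] by (simp add: \<rho>_def)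
      also have "\<dots> \<le> sqrt (4 * \<bar>\<beta>\<bar> + 4) + sqrt (4 * \<bar>\<sigma>\<bar>)"
        by (rule sqrt_add_le_add_sqrt) auto
      finally show ?thesis
        by (simp add: real_sqrt_mult)
    qed
    then have tail: "(\<Sum>k\<in>?D. \<bar>f x k\<bar>) \<le> (sqrt (4 * \<bar>\<beta>\<bar> + 4) + 2 * sqrt \<bar>\<sigma>\<bar>) * (4 * M)"
      using M by (intro order_trans[OF tail0] mult_right_mono) auto
    have "\<bar>\<Sum>k=-\<lceil>L\<rceil>..\<lceil>L\<rceil> - 1. f x k\<bar> \<le> (B + 10 * M) * (1 + x\<^sup>2)"
      using sym[where m = "nat \<lceil>L\<rceil>" and x = x] True by simp
    then have "\<bar>\<Sum>k::int | \<bar>\<rho> + of_int k\<bar> \<le> L. f x k\<bar> \<le> (B + 10 * M) * (1 + x\<^sup>2) + (sqrt (4 * \<bar>\<beta>\<bar> + 4) + 2 * sqrt \<bar>\<sigma>\<bar>) * (4 * M)"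
      using window_difference(3)[OF True, where \<rho> = \<rho> and f = "f x"] tail by linarith
    also have "(B + 10 * M) * (1 + x\<^sup>2) + (sqrt (4 * \<bar>\<beta>\<bar> + 4) + 2 * sqrt \<bar>\<sigma>\<bar>) * (4 * M) \<le> C * (1 + x\<^sup>2) * (1 + sqrt \<bar>\<sigma>\<bar>)"
    proof -
      define e g r where "e = (1 + x\<^sup>2)" and "g = sqrt (4 * \<bar>\<beta>\<bar> + 4)" and "r = sqrt \<bar>\<sigma>\<bar>"
      have 1: "e \<ge> 1" "g \<ge> 0" "r \<ge> 0"
        by (auto simp: e_def g_def r_def)
      have "(B + 10 * M) * e \<le> (B + 10 * M) * e * (1 + r)"
        using 1 B M mult_left_mono[of 1 "1 + r" "(B + 10 * M) * e"] by simp
      moreover have "(g + 2 * r) * (4 * M) \<le> (g + 2) * (1 + r) * (4 * M) * e"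
      proof -
        have "(g + 2 * r) * (4 * M) \<le> (g + 2) * (1 + r) * (4 * M)"
          using 1 M by (intro mult_right_mono) (auto simp: algebra_simps)
        also have "\<dots> * 1 \<le> (g + 2) * (1 + r) * (4 * M) * e"
          using 1 M by (intro mult_left_mono) auto
        finally show ?thesis by simp
      qed
      ultimately show ?thesis
        unfolding C_def e_def[symmetric] g_def[symmetric] r_def[symmetric] by (simp add: algebra_simps)
    qed
    finally show ?thesis
      by (simp add: \<rho>_def)
  next
    case False
    then have "{k::int. \<bar>\<beta> + \<sigma> + of_int k\<bar> \<le> L} = {}"
      by auto
    then show ?thesis
      using C by simp
  qed
  then show ?thesis
    using that C unfolding f_def by blast
qed

section \<open>Sums over the integers as integrals for the counting measure\<close>

text \<open>In this form a limit of sums over rows is an instance of dominated convergence.\<close>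

lemma integrable_count_space_bounded_sums:
  fixes g :: "int \<Rightarrow> real"
  assumes "\<And>k. g k \<ge> 0" "\<And>K. finite K \<Longrightarrow> sum g K \<le> B"
  shows "integrable (count_space UNIV) g"
proof -
  have "g summable_on UNIV"
    using assms by (intro nonneg_bdd_above_summable_on bdd_aboveI2[where M = B]) auto
  then have "(\<lambda>k. norm (g k)) summable_on UNIV"
    using assms(1) by simp
  then have "Infinite_Set_Sum.abs_summable_on g UNIV"
    by (simp only: abs_summable_equivalent)
  then show ?thesis
    by (simp add: Infinite_Set_Sum.abs_summable_on_def)
qed

text \<open>The series converges absolutely by the arctangent comparison; the symmetric windows then
  only identify its value through the cotangent.\<close>

lemma \<F>_integral_count_space:
  fixes \<beta> x :: real
  assumes x: "x \<noteq> 0"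
  shows "integrable (count_space UNIV) (\<lambda>k::int. x / ((\<beta> + of_int k)\<^sup>2 + x\<^sup>2))"
    and "(\<integral>k. x / ((\<beta> + of_int k)\<^sup>2 + x\<^sup>2) \<partial>count_space UNIV) = pi * \<F> \<beta> x"
proof -
  let ?f = "\<lambda>k::int. x / ((\<beta> + of_int k)\<^sup>2 + x\<^sup>2)"
  have "integrable (count_space UNIV) (\<lambda>k::int. 1 / (1 + (1 / x\<^sup>2) * (\<beta> + of_int k)\<^sup>2))"
    using x by (intro integrable_count_space_bounded_sums[OF _ sum_inverse_square_le]) auto
  then have "integrable (count_space UNIV) (\<lambda>k::int. 1 / x * (1 / (1 + (1 / x\<^sup>2) * (\<beta> + of_int k)\<^sup>2)))"
    by (rule integrable_mult_right)
  moreover have "1 / x * (1 / (1 + (1 / x\<^sup>2) * (\<beta> + of_int k)\<^sup>2)) = ?f k" for k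
  proof -
    have "1 + (1 / x\<^sup>2) * (\<beta> + of_int k)\<^sup>2 = ((\<beta> + of_int k)\<^sup>2 + x\<^sup>2) / x\<^sup>2"
      using x by (simp add: field_simps)
    then show ?thesis
      using x by (simp add: power2_eq_square)
  qed
  ultimately show int: "integrable (count_space UNIV) ?f"
    by simp
  have "(\<lambda>m. \<integral>k. indicator {- int m..int m - 1} k * ?f k \<partial>count_space UNIV) \<longlonglongrightarrow> (\<integral>k. ?f k \<partial>count_space UNIV)"
  proof (rule integral_dominated_convergence[where w = "\<lambda>k. \<bar>?f k\<bar>"])
    show "AE k in count_space UNIV. (\<lambda>m. indicator {- int m..int m - 1} k * ?f k) \<longlonglongrightarrow> ?f k"
    proof (intro AE_I2 tendsto_eventually)
      fix k :: int
      \<comment> \<open>The threshold has the summand 1 because the window ends at m - 1.\<close>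
      show "eventually (\<lambda>m. indicator {- int m..int m - 1} k * ?f k = ?f k) sequentially"
        using eventually_ge_at_top[of "nat \<bar>k\<bar> + 1"] by eventually_elim (auto simp: indicator_def)
    qed
    show "AE k in count_space UNIV. norm (indicator {- int m..int m - 1} k * ?f k) \<le> \<bar>?f k\<bar>" for m
      by (intro AE_I2) (auto simp: indicator_def)
    show "integrable (count_space UNIV) (\<lambda>k. \<bar>?f k\<bar>)"
      by (rule integrable_abs[OF int])
  qed simp_all
  moreover have "(\<integral>k. indicator {- int m..int m - 1} k * ?f k \<partial>count_space UNIV) = (\<Sum>k=- int m..int m - 1. ?f k)" for m
  proof -
    have "finite {k. indicator {- int m..int m - 1} k * ?f k \<noteq> 0}"
      by (rule finite_subset[of _ "{- int m..int m - 1}"]) (auto simp: indicator_def)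
    then have "(\<integral>k. indicator {- int m..int m - 1} k * ?f k \<partial>count_space UNIV) =
        (\<Sum>k | indicator {- int m..int m - 1} k * ?f k \<noteq> 0. indicator {- int m..int m - 1} k * ?f k)"
      by (simp only: lebesgue_integral_count_space_finite_support UNIV_I simp_thms)
    also have "\<dots> = (\<Sum>k=- int m..int m - 1. ?f k)"
      by (rule sum.mono_neutral_cong_left) (auto simp: indicator_def)
    finally show ?thesis .
  qed
  ultimately show "(\<integral>k. ?f k \<partial>count_space UNIV) = pi * \<F> \<beta> x"
    using \<G>_\<F>_symmetric_limits(2)[OF x, of \<beta>] LIMSEQ_unique by simp
qed

text \<open>The majorant for sums over rows: a quadratic weight times the square-root cost of a
  displaced window. It is comparable with (1 + |j|)^(-3/2).\<close>

lemma integrable_sqrt_over_square: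
  fixes \<gamma> :: real
  shows "integrable (count_space UNIV) (\<lambda>j::int. (1 + sqrt \<bar>\<gamma> + of_int j\<bar>) / (1 + (\<gamma> + of_int j)\<^sup>2))"
proof -
  define h where "h n = (real n + 1) powr (- (3 / 2))" for n
  have "summable (\<lambda>n. real (Suc n) powr (- (3 / 2)))"
    using summable_real_powr_iff[of "- (3 / 2)"] summable_Suc_iff[of "\<lambda>n. real n powr (- (3 / 2))"] by simp
  then have sh: "summable h"
    by (simp add: h_def[abs_def] add.commute)
  have h0: "h n \<ge> 0" for n
    by (simp add: h_def)
  have sums: "(\<Sum>k\<in>K. h (nat \<bar>k\<bar>)) \<le> 2 * suminf h" if K: "finite K" for K
  proof -
    have "(\<Sum>k\<in>S. h (nat \<bar>k\<bar>)) \<le> suminf h" if "finite S" "inj_on (\<lambda>k. nat \<bar>k\<bar>) S" for S :: "int set"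
    proof -
      have "(\<Sum>k\<in>S. h (nat \<bar>k\<bar>)) = (\<Sum>n\<in>(\<lambda>k. nat \<bar>k\<bar>) ` S. h n)"
        using that by (subst sum.reindex) auto
      also have "\<dots> \<le> suminf h"
        using that h0 by (intro sum_le_suminf sh) auto
      finally show ?thesis .
    qed
    moreover have "inj_on (\<lambda>k. nat \<bar>k\<bar>) (K \<inter> {0..})" "inj_on (\<lambda>k. nat \<bar>k\<bar>) (K - {0..})"
      by (auto simp: inj_on_def)
    ultimately have "(\<Sum>k\<in>K \<inter> {0..}. h (nat \<bar>k\<bar>)) \<le> suminf h" "(\<Sum>k\<in>K - {0..}. h (nat \<bar>k\<bar>)) \<le> suminf h"
      using K by (meson finite_Int finite_Diff)+
    then show ?thesis
      unfolding sum.Int_Diff[OF K, of "\<lambda>k. h (nat \<bar>k\<bar>)" "{0..}"] by linarith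
  qed
  define C where "C = (1 + sqrt \<bar>\<gamma>\<bar>) * (2 * (1 + \<gamma>\<^sup>2)) * 4"
  have int: "integrable (count_space UNIV) (\<lambda>k::int. C * h (nat \<bar>k\<bar>))"
    by (intro integrable_mult_right integrable_count_space_bounded_sums[OF h0 sums])
  show ?thesis
  proof (rule Bochner_Integration.integrable_bound[OF int])
    have "(1 + sqrt \<bar>\<gamma> + of_int j\<bar>) / (1 + (\<gamma> + of_int j)\<^sup>2) \<le> C * h (nat \<bar>j\<bar>)" for j :: int
    proof -
      define r where "r = 1 + \<bar>real_of_int j\<bar>"
      have r: "r \<ge> 1" by (simp add: r_def)
      have "sqrt \<bar>\<gamma> + of_int j\<bar> \<le> sqrt (\<bar>\<gamma>\<bar> + \<bar>real_of_int j\<bar>)"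
        by simp
      also have "\<dots> \<le> sqrt \<bar>\<gamma>\<bar> + sqrt \<bar>real_of_int j\<bar>"
        by (rule sqrt_add_le_add_sqrt) auto
      finally have a: "sqrt \<bar>\<gamma> + of_int j\<bar> \<le> sqrt \<bar>\<gamma>\<bar> + sqrt \<bar>real_of_int j\<bar>" .
      have s: "1 + sqrt \<bar>\<gamma> + of_int j\<bar> \<le> (1 + sqrt \<bar>\<gamma>\<bar>) * (2 * sqrt r)"
      proof -
        have "sqrt \<bar>real_of_int j\<bar> \<le> sqrt r"
          by (simp add: r_def)
        moreover have "1 \<le> sqrt r" using r by simp
        moreover have "sqrt \<bar>\<gamma>\<bar> * 1 \<le> sqrt \<bar>\<gamma>\<bar> * sqrt r"
          using r by (intro mult_left_mono) auto
        moreover have "0 \<le> sqrt \<bar>\<gamma>\<bar> * sqrt r"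
          using r by simp
        moreover have "(1 + sqrt \<bar>\<gamma>\<bar>) * (2 * sqrt r) = 2 * sqrt r + 2 * (sqrt \<bar>\<gamma>\<bar> * sqrt r)"
          by (simp add: algebra_simps)
        ultimately show ?thesis
          using a by linarith
      qed
      have "(real_of_int j)\<^sup>2 \<le> 2 * (\<gamma> + of_int j)\<^sup>2 + 2 * \<gamma>\<^sup>2"
        using zero_le_power2[of "2 * \<gamma> + of_int j"] by (simp add: power2_eq_square algebra_simps)
      then have j1: "1 + (real_of_int j)\<^sup>2 \<le> 2 * (1 + \<gamma>\<^sup>2) * (1 + (\<gamma> + of_int j)\<^sup>2)"
      proof -
        have "2 * (1 + \<gamma>\<^sup>2) * (1 + (\<gamma> + of_int j)\<^sup>2) =
            2 + 2 * \<gamma>\<^sup>2 + 2 * (\<gamma> + of_int j)\<^sup>2 + 2 * (\<gamma>\<^sup>2 * (\<gamma> + of_int j)\<^sup>2)"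
          by (simp add: algebra_simps)
        moreover have "\<gamma>\<^sup>2 * (\<gamma> + of_int j)\<^sup>2 \<ge> 0"
          by simp
        ultimately show ?thesis
          using \<open>(real_of_int j)\<^sup>2 \<le> 2 * (\<gamma> + of_int j)\<^sup>2 + 2 * \<gamma>\<^sup>2\<close> by linarith
      qed
      have j2: "r\<^sup>2 \<le> 2 * (1 + (real_of_int j)\<^sup>2)"
        using zero_le_power2[of "1 - \<bar>real_of_int j\<bar>"] by (simp add: r_def power2_eq_square algebra_simps)
      have q: "r\<^sup>2 / (4 * (1 + \<gamma>\<^sup>2)) \<le> 1 + (\<gamma> + of_int j)\<^sup>2"
      proof -
        have "r\<^sup>2 \<le> 4 * (1 + \<gamma>\<^sup>2) * (1 + (\<gamma> + of_int j)\<^sup>2)"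
          using order_trans[OF j2 mult_left_mono[OF j1, of 2]] by (simp add: algebra_simps)
        moreover have "4 * (1 + \<gamma>\<^sup>2) > 0"
          by (simp add: add_pos_nonneg)
        ultimately show ?thesis
          by (subst pos_divide_le_eq) (simp_all add: mult_ac)
      qed
      have "(1 + sqrt \<bar>\<gamma> + of_int j\<bar>) / (1 + (\<gamma> + of_int j)\<^sup>2) \<le> (1 + sqrt \<bar>\<gamma>\<bar>) * (2 * sqrt r) / (r\<^sup>2 / (4 * (1 + \<gamma>\<^sup>2)))"
        using s q r by (intro frac_le) (auto simp: add_pos_nonneg)
      also have "\<dots> = C * (sqrt r / r\<^sup>2)"
        by (simp add: C_def)
      also have "sqrt r / r\<^sup>2 = r powr (1 / 2) / r powr 2"
        using r by (simp add: powr_half_sqrt)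
      also have "\<dots> = r powr (1 / 2 - 2)"
        by (rule powr_diff[symmetric])
      also have "\<dots> = h (nat \<bar>j\<bar>)"
        by (simp add: h_def r_def add.commute)
      finally show ?thesis .
    qed
    then show "AE j in count_space UNIV. norm ((1 + sqrt \<bar>\<gamma> + of_int j\<bar>) / (1 + (\<gamma> + of_int j)\<^sup>2)) \<le> norm (C * h (nat \<bar>j\<bar>))"
      by (intro AE_I2) (smt (verit) divide_nonneg_nonneg real_norm_def real_sqrt_ge_zero zero_le_power2)
  qed simp
qed

section \<open>Lattice terms as plane integrals\<close>

text \<open>Every linear map needed is such a shear, possibly preceded by an exchange of
  coordinates, so the affine substitution in the inner one-dimensional integral is enough.\<close>

lemma nn_integral_shear:
  fixes c e :: real
  assumes [measurable]: "f \<in> borel_measurable (borel :: (real \<times> real) measure)" and c: "c \<noteq> 0"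
  shows "(\<integral>\<^sup>+w. f w \<partial>lborel) = ennreal \<bar>c\<bar> * (\<integral>\<^sup>+w. f (c * fst w + e * snd w, snd w) \<partial>lborel)"
proof -
  have [measurable]: "f \<in> borel_measurable (borel \<Otimes>\<^sub>M borel)"
    using assms(1) by (simp add: borel_prod)
  have "(\<integral>\<^sup>+w. f w \<partial>lborel) = (\<integral>\<^sup>+y. \<integral>\<^sup>+x. f (x, y) \<partial>lborel \<partial>lborel)"
    by (simp add: lborel_pair.nn_integral_snd lborel_prod)
  also have "\<dots> = (\<integral>\<^sup>+y. ennreal \<bar>c\<bar> * (\<integral>\<^sup>+x. f (e * y + c * x, y) \<partial>lborel) \<partial>lborel)"
    by (intro nn_integral_cong nn_integral_real_affine c) measurable
  also have "\<dots> = ennreal \<bar>c\<bar> * (\<integral>\<^sup>+y. \<integral>\<^sup>+x. f (e * y + c * x, y) \<partial>lborel \<partial>lborel)"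
    by (intro nn_integral_cmult) measurable
  also have "(\<integral>\<^sup>+y. \<integral>\<^sup>+x. f (e * y + c * x, y) \<partial>lborel \<partial>lborel) = (\<integral>\<^sup>+w. f (c * fst w + e * snd w, snd w) \<partial>lborel)"
    using lborel_pair.nn_integral_snd[of "\<lambda>w. f (c * fst w + e * snd w, snd w)"]
    by (simp add: lborel_prod add.commute)
  finally show ?thesis .
qed

lemma lborel_shear:
  fixes c e :: real
  assumes c: "c \<noteq> 0"
  shows "lborel = density (distr lborel borel (\<lambda>w. (c * fst w + e * snd w, snd w))) (\<lambda>_. ennreal \<bar>c\<bar>)"
proof (rule measure_eqI)
  fix A :: "(real \<times> real) set" assume "A \<in> sets lborel"
  then have [measurable]: "A \<in> sets borel" by simp
  have [measurable]: "(\<lambda>w. (c * fst w + e * snd w, snd w)) \<in> borel_measurable (borel :: (real \<times> real) measure)"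
    by (simp flip: borel_prod)
  have "emeasure lborel A = (\<integral>\<^sup>+w. indicator A w \<partial>lborel)"
    by simp
  also have "\<dots> = ennreal \<bar>c\<bar> * (\<integral>\<^sup>+w. indicator A (c * fst w + e * snd w, snd w) \<partial>lborel)"
    by (rule nn_integral_shear[OF _ c]) measurable
  also have "\<dots> = emeasure (density (distr lborel borel (\<lambda>w. (c * fst w + e * snd w, snd w))) (\<lambda>_. ennreal \<bar>c\<bar>)) A"
    by (subst emeasure_density, simp, simp, subst nn_integral_cmult, simp, subst nn_integral_distr) simp_all
  finally show "emeasure lborel A = \<dots>" .
qed simp

lemma integrable_shear:
  fixes h :: "real \<times> real \<Rightarrow> 'a::{banach,second_countable_topology}" and c e :: real
  assumes h: "integrable lborel h" and c: "c \<noteq> 0"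
  shows "integrable lborel (\<lambda>w. h (c * fst w + e * snd w, snd w))"
    and "integral\<^sup>L lborel h = \<bar>c\<bar> *\<^sub>R (LBINT w. h (c * fst w + e * snd w, snd w))"
proof -
  let ?T = "\<lambda>w::real \<times> real. (c * fst w + e * snd w, snd w)"
  have [measurable]: "?T \<in> borel_measurable borel"
    by (simp flip: borel_prod)
  have [measurable]: "h \<in> borel_measurable borel"
    using borel_measurable_integrable[OF h] by simp
  have "integrable lborel (\<lambda>w. \<bar>c\<bar> *\<^sub>R h (?T w))"
    using h by (subst (asm) lborel_shear[OF c, of e]) (simp add: integrable_density integrable_distr_eq)
  from integrable_scaleR_right[OF this, of "1 / \<bar>c\<bar>"] show int: "integrable lborel (\<lambda>w. h (?T w))"
    using c by simp
  show "integral\<^sup>L lborel h = \<bar>c\<bar> *\<^sub>R (LBINT w. h (?T w))"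
    using int by (subst lborel_shear[OF c, of e]) (simp add: integral_density integral_distr)
qed

lemma integrable_swap_plane:
  fixes h :: "real \<times> real \<Rightarrow> 'a::{banach,second_countable_topology}"
  assumes h: "integrable lborel h"
  shows "integrable lborel (\<lambda>w. h (snd w, fst w))" "(LBINT w. h (snd w, fst w)) = integral\<^sup>L lborel h"
proof -
  have h': "integrable (lborel \<Otimes>\<^sub>M lborel) h"
    using h by (simp add: lborel_prod)
  show "integrable lborel (\<lambda>w. h (snd w, fst w))"
    using lborel_pair.integrable_product_swap[OF h'] by (simp add: lborel_prod case_prod_unfold)
  show "(LBINT w. h (snd w, fst w)) = integral\<^sup>L lborel h"
    using lborel_pair.integral_product_swap[of h] borel_measurable_integrable[OF h']
    by (simp add: lborel_prod case_prod_unfold)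
qed

text \<open>The coordinates in which \<open>2 Q w = 3/2 (2 w\<^sub>1 + w\<^sub>2)\<^sup>2 + 1/2 w\<^sub>2\<^sup>2
  = 1/2 (3 w\<^sub>1 + 2 w\<^sub>2)\<^sup>2 + 3/2 w\<^sub>1\<^sup>2\<close> is diagonal.\<close>
lemma integral_Q_coordinates:
  fixes h :: "real \<times> real \<Rightarrow> complex"
  assumes h: "integrable lborel h"
  shows "integrable lborel (\<lambda>w. h (2 * fst w + snd w, snd w))"
    and "(LBINT w. h (2 * fst w + snd w, snd w)) = integral\<^sup>L lborel h / 2"
    and "integrable lborel (\<lambda>w. h (3 * fst w + 2 * snd w, fst w))"
    and "(LBINT w. h (3 * fst w + 2 * snd w, fst w)) = integral\<^sup>L lborel h / 2"
proof -
  show "integrable lborel (\<lambda>w. h (2 * fst w + snd w, snd w))"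
    "(LBINT w. h (2 * fst w + snd w, snd w)) = integral\<^sup>L lborel h / 2"
    using integrable_shear[OF h, of 2 1] by (simp_all add: scaleR_conv_of_real)
  \<comment> \<open>The map (x, y) to (3x + 2y, x) is the exchange of coordinates followed by this
    shear.\<close>
  have 1: "integrable lborel (\<lambda>w. h (2 * fst w + 3 * snd w, snd w))"
    by (rule integrable_shear(1)[OF h]) simp
  have 2: "integral\<^sup>L lborel h = 2 * (LBINT w. h (2 * fst w + 3 * snd w, snd w))"
    using integrable_shear(2)[OF h, of 2 3] by (simp add: scaleR_conv_of_real)
  show "integrable lborel (\<lambda>w. h (3 * fst w + 2 * snd w, fst w))"
    "(LBINT w. h (3 * fst w + 2 * snd w, fst w)) = integral\<^sup>L lborel h / 2"
    using integrable_swap_plane[OF 1] unfolding 2 by (simp_all add: add.commute)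
qed

lemma integral_odd_fst:
  fixes h :: "real \<times> real \<Rightarrow> complex"
  assumes "integrable lborel h" "\<And>x y. h (- x, y) = - h (x, y)"
  shows "integral\<^sup>L lborel h = 0"
proof -
  have "h (- 1 * fst w + 0 * snd w, snd w) = - h w" for w
    using assms(2)[of "fst w" "snd w"] by simp
  then have "integral\<^sup>L lborel h = - integral\<^sup>L lborel h"
    using integrable_shear(2)[OF assms(1), of "-1" 0] by simp
  then show ?thesis by simp
qed

section \<open>The quadratic form and its Gaussian\<close>

lemma Q_eq: "Q (x, y) = 3 * x\<^sup>2 + y\<^sup>2 + 3 * x * y"
  by (simp add: Q_def)

lemma Q_measurable [measurable]: "Q \<in> borel_measurable borel"
  unfolding Q_def case_prod_unfold by measurable

lemma Q_lower: "Q (x, y) \<ge> (x\<^sup>2 + y\<^sup>2) / 6"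
proof -
  \<comment> \<open>The constant 1/6 is a convenient number below the smaller eigenvalue 2 - sqrt 13
    / 2 of Q.\<close>
  have "Q (x, y) - (x\<^sup>2 + y\<^sup>2) / 6 = 5 / 6 * (y + 9 / 5 * x)\<^sup>2 + 2 / 15 * x\<^sup>2"
    by (simp add: Q_eq power2_eq_square field_simps)
  also have "\<dots> \<ge> 0"
    by simp
  finally show ?thesis by simp
qed

lemma Q_pos: "(x, y) \<noteq> (0, 0) \<Longrightarrow> Q (x, y) > 0"
  using Q_lower[of x y] by (smt (verit) divide_pos_pos prod.inject sum_power2_gt_zero_iff)

lemma Q_nonneg: "Q w \<ge> 0"
  using Q_lower[of "fst w" "snd w"] by (smt (verit) divide_nonneg_nonneg prod.collapse zero_le_power2)

text \<open>With s = - i \<tau> this is the exponential of the theorem, and Re s = Im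
  \<tau>.\<close>

definition gauss :: "complex \<Rightarrow> real \<times> real \<Rightarrow> complex" where
  "gauss s w = exp (- s * of_real (2 * pi * Q w))"

lemma gauss_measurable [measurable]: "gauss s \<in> borel_measurable borel"
  unfolding gauss_def by measurable

lemma norm_gauss: "norm (gauss s w) = exp (- Re s * (2 * pi * Q w))"
  by (simp add: gauss_def norm_exp_eq_Re)

lemma gauss_majorant_integrable:
  assumes "Re s > 0"
  shows "integrable lborel (\<lambda>w. C * (1 + (fst w)\<^sup>2)\<^sup>2 * (1 + (snd w)\<^sup>2)\<^sup>2 * norm (gauss s w))"
proof -
  \<comment> \<open>This is 2 \<pi> Re s times the constant 1/6 of \<open>Q_lower\<close>.\<close>
  define r where "r = pi * Re s / 3"
  have r: "r > 0"
    using assms by (simp add: r_def)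
  have "integrable lborel (\<lambda>x::real. (1 + x\<^sup>2)\<^sup>2 * exp (- r * x\<^sup>2))"
  proof -
    have "integrable lborel (\<lambda>x::real. x ^ 0 * exp (- r * x\<^sup>2) + 2 * (x ^ 2 * exp (- r * x\<^sup>2)) + x ^ 4 * exp (- r * x\<^sup>2))"
      by (intro Bochner_Integration.integrable_add integrable_mult_right integrable_power_gauss r)
    then show ?thesis
      by (simp add: power2_eq_square power4_eq_xxxx algebra_simps)
  qed
  note this' = this
  have "integrable lborel (\<lambda>(x::real, y::real). (C * ((1 + x\<^sup>2)\<^sup>2 * exp (- r * x\<^sup>2))) * ((1 + y\<^sup>2)\<^sup>2 * exp (- r * y\<^sup>2)))"
    by (intro integral_pair_times(1) integrable_mult_right this')
  then show ?thesis
  proof (rule Bochner_Integration.integrable_bound)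
    show "AE w in lborel. norm (C * (1 + (fst w)\<^sup>2)\<^sup>2 * (1 + (snd w)\<^sup>2)\<^sup>2 * norm (gauss s w)) \<le>
      norm (case w of (x, y) \<Rightarrow> (C * ((1 + x\<^sup>2)\<^sup>2 * exp (- r * x\<^sup>2))) * ((1 + y\<^sup>2)\<^sup>2 * exp (- r * y\<^sup>2)))"
    proof (intro AE_I2, clarify)
      fix x y :: real
      have "- Re s * (2 * pi * Q (x, y)) \<le> - Re s * (2 * pi * ((x\<^sup>2 + y\<^sup>2) / 6))"
        using Q_lower[of x y] assms by (intro mult_left_mono_neg mult_left_mono) auto
      also have "\<dots> = - r * x\<^sup>2 + - r * y\<^sup>2"
        by (simp add: r_def field_simps)
      finally have "norm (gauss s (x, y)) \<le> exp (- r * x\<^sup>2) * exp (- r * y\<^sup>2)"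
        by (simp add: norm_gauss flip: exp_add)
      then have "(\<bar>C\<bar> * ((1 + x\<^sup>2)\<^sup>2 * (1 + y\<^sup>2)\<^sup>2)) * norm (gauss s (x, y)) \<le>
          (\<bar>C\<bar> * ((1 + x\<^sup>2)\<^sup>2 * (1 + y\<^sup>2)\<^sup>2)) * (exp (- r * x\<^sup>2) * exp (- r * y\<^sup>2))"
        by (rule mult_left_mono) auto
      then show "norm (C * (1 + (fst (x, y))\<^sup>2)\<^sup>2 * (1 + (snd (x, y))\<^sup>2)\<^sup>2 * norm (gauss s (x, y))) \<le>
         norm ((C * ((1 + x\<^sup>2)\<^sup>2 * exp (- r * x\<^sup>2))) * ((1 + y\<^sup>2)\<^sup>2 * exp (- r * y\<^sup>2)))"
        by (simp add: abs_mult mult_ac)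
    qed
  qed measurable
qed

text \<open>Off these three lines no denominator in \<open>g2\<close> or in the lattice sums
  vanishes.\<close>

lemma AE_plane_generic:
  "AE w in (lborel :: (real \<times> real) measure). fst w \<noteq> 0 \<and> snd w \<noteq> 0 \<and> snd w + 3 * fst w / 2 \<noteq> 0"
proof -
  have "AE w in (lborel \<Otimes>\<^sub>M lborel :: (real \<times> real) measure). fst w \<noteq> 0 \<and> snd w \<noteq> 0 \<and> snd w + 3 * fst w / 2 \<noteq> 0"
  proof (rule lborel_pair.AE_pair_measure)
    show "{w \<in> space (lborel \<Otimes>\<^sub>M lborel). fst w \<noteq> (0::real) \<and> snd w \<noteq> (0::real) \<and> snd w + 3 * fst w / 2 \<noteq> 0} \<in> sets (lborel \<Otimes>\<^sub>M lborel)"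
      by measurable
    show "AE x in lborel. AE y in lborel. fst (x, y) \<noteq> (0::real) \<and> snd (x, y) \<noteq> (0::real) \<and> snd (x, y) + 3 * fst (x, y) / 2 \<noteq> 0"
      using AE_lborel_singleton[of "0::real"]
    proof eventually_elim
      case (elim x)
      show ?case
        using AE_lborel_singleton[of "0::real"] AE_lborel_singleton[of "- 3 * x / 2"]
        by eventually_elim (use elim in auto)
    qed
  qed
  then show ?thesis
    by (simp only: lborel_prod)
qed

section \<open>Rational kernels attached to a lattice point\<close>

text \<open>For a = 0 the first formula would read b y / (x (b^2 + y^2)), with a pole along x = 0
  that is not integrable. The subtracted quotient, the same with y + 3x/2 in place of y, cancels the
  pole. It is itself odd in x for fixed y + 3x/2, a reflection that preserves Q, so formally it
  carries no principal value. This is the origin of the second case of \<open>g2\<close>.\<close>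

definition summand :: "real \<times> real \<Rightarrow> real \<times> real \<Rightarrow> real" where
  "summand = (\<lambda>(a, b) (x, y).
     if a \<noteq> 0 then (a * y\<^sup>2 + b * x * y) / ((a\<^sup>2 + x\<^sup>2) * (b\<^sup>2 + y\<^sup>2))
     else b / x * (y / (b\<^sup>2 + y\<^sup>2) - (y + 3 * x / 2) / (b\<^sup>2 + (y + 3 * x / 2)\<^sup>2)))"

lemma summand_measurable [measurable]: "summand n \<in> borel_measurable borel"
  unfolding summand_def case_prod_unfold by measurable

text \<open>These are the Laplace kernels of the three theta terms, up to constants. The squared
  form in the numerator is the diagonal coordinate of w whose weight has exponent 3/2.\<close>

definition kernel3 :: "real \<times> real \<Rightarrow> real \<times> real \<Rightarrow> real" where
  "kernel3 = (\<lambda>(a, b) (x, y). (2 * a + b) * y\<^sup>2 / ((b\<^sup>2 + y\<^sup>2) * (Q (a, b) + Q (x, y))))"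

definition kernel4 :: "real \<times> real \<Rightarrow> real \<times> real \<Rightarrow> real" where
  "kernel4 = (\<lambda>(a, b) (x, y). (3 * a + 2 * b) * x\<^sup>2 / ((a\<^sup>2 + x\<^sup>2) * (Q (a, b) + Q (x, y))))"

definition kernel5 :: "real \<times> real \<Rightarrow> real \<times> real \<Rightarrow> real" where
  "kernel5 = (\<lambda>(a, b) (x, y). a * (3 * x + 2 * y)\<^sup>2 / ((a\<^sup>2 + x\<^sup>2) * (Q (a, b) + Q (x, y))))"

text \<open>With \<open>u = a + i x\<close>, \<open>v = b + i y\<close> one has \<open>Q (a, b) + Q (x, y) = 3 \<bar>u\<bar>\<^sup>2 + \<bar>v\<bar>\<^sup>2 + 3 Re (u v\<^sup>*)\<close>
  and \<open>a y + b x = Im (u v)\<close>. Multiplying the two and dividing by \<open>\<bar>u\<bar>\<^sup>2 \<bar>v\<bar>\<^sup>2\<close> splits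
  the summand into the theta kernels and remainders that are odd under a reflection preserving \<open>Q\<close>.\<close>
lemma summand_split:
  assumes "(a, b) \<noteq> (0, 0)" "x \<noteq> 0" "y \<noteq> 0"
  shows "2 * summand (a, b) (x, y) = 3 * kernel3 (a, b) (x, y) - 3 / 2 * kernel4 (a, b) (x, y) + kernel5 (a, b) (x, y) / 2
    + 3 * b * (2 * x + y) * y / ((b\<^sup>2 + y\<^sup>2) * (Q (a, b) + Q (x, y)))
    + (if a \<noteq> 0 then b * x * (3 * x + 2 * y) / ((a\<^sup>2 + x\<^sup>2) * (Q (a, b) + Q (x, y)))
       else - (3 / 4) * b * x * (3 * x + 2 * y) / ((b\<^sup>2 + (3 * x + 2 * y)\<^sup>2 / 4) * (Q (a, b) + Q (x, y))))"
proof -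
  define p q N where "p = a\<^sup>2 + x\<^sup>2" and "q = b\<^sup>2 + y\<^sup>2" and "N = Q (a, b) + Q (x, y)"
  have pq: "p \<noteq> 0" "q \<noteq> 0"
    using assms by (auto simp: p_def q_def add_nonneg_eq_0_iff)
  have N: "N \<noteq> 0"
    using Q_pos[OF assms(1)] Q_nonneg[of "(x, y)"] by (simp add: N_def)
  show ?thesis
  proof (cases "a = 0")
    case False
    let ?U = "3 * ((2 * a + b) * y\<^sup>2 + b * (2 * x + y) * y)"
    let ?V = "(a * (3 * x + 2 * y)\<^sup>2 - 3 * (3 * a + 2 * b) * x\<^sup>2) / 2 + b * x * (3 * x + 2 * y)"
    \<comment> \<open>The partial fraction identity: \<open>?U\<close> stays over q,
      \<open>?V\<close> over p, and each holds theta kernels together with one odd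
      remainder.\<close>
    have "2 * (a * y\<^sup>2 + b * x * y) * N = p * ?U + q * ?V"
      by (simp add: N_def p_def q_def Q_eq power2_eq_square field_simps)
    then have "2 * (a * y\<^sup>2 + b * x * y) / (p * q) = ?U / (q * N) + ?V / (p * N)"
      using pq N by (simp add: frac_eq_eq add_frac_eq mult_ac)
        (simp add: algebra_simps)
    moreover have "?U / (q * N) = 3 * ((2 * a + b) * y\<^sup>2 / (q * N)) + 3 * b * (2 * x + y) * y / (q * N)"
      by (simp add: add_divide_distrib distrib_left mult.assoc)
    moreover have "?V / (p * N) = a * (3 * x + 2 * y)\<^sup>2 / (p * N) / 2 - 3 / 2 * ((3 * a + 2 * b) * x\<^sup>2 / (p * N)) + b * x * (3 * x + 2 * y) / (p * N)"
    proof -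
      have "((u - 3 * v) / 2 + w) / D = u / D / 2 - 3 / 2 * (v / D) + w / D" for u v w D :: real
        by (simp add: add_divide_distrib diff_divide_distrib)
      from this[of "a * (3 * x + 2 * y)\<^sup>2" "(3 * a + 2 * b) * x\<^sup>2"] show ?thesis
        by (simp only: mult.assoc)
    qed
    ultimately show ?thesis
      using False by (simp add: summand_def kernel3_def kernel4_def kernel5_def flip: p_def q_def N_def)
  next
    case True
    define z m where "z = y + 3 * x / 2" and "m = b\<^sup>2 + z\<^sup>2"
    have b: "b \<noteq> 0"
      using assms True by simp
    have m: "m \<noteq> 0"
      using b by (simp add: m_def add_nonneg_eq_0_iff)
    \<comment> \<open>Writing N relative to each denominator splits y / q and z / m into polynomial
      and proper parts after multiplication by N. The polynomial parts differ by - 3x/2, which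
      cancels the factor 1/x.\<close>
    have Nq: "N = q + 3 * x * (x + y)" and Nm: "N = m + 3 / 4 * x\<^sup>2"
      by (simp_all add: N_def q_def m_def z_def True Q_eq power2_eq_square field_simps)
    have 1: "N * (y / q) = y + 3 * x * (x + y) * y / q"
      unfolding Nq using pq by (simp add: field_simps)
    have 2: "N * (z / m) = z + 3 / 4 * x\<^sup>2 * z / m"
      unfolding Nm using m by (simp add: field_simps)
    have "N * (y / q - z / m) = (y - z) + 3 * x * (x + y) * y / q - 3 / 4 * x\<^sup>2 * z / m"
      unfolding right_diff_distrib 1 2 by simp
    also have "y - z = - 3 / 2 * x"
      by (simp add: z_def)
    finally have "y / q - z / m = (- 3 / 2 * x + 3 * x * (x + y) * y / q - 3 / 4 * x\<^sup>2 * z / m) / N"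
      using N by (simp add: field_simps)
    then have "2 * (b / x * (y / q - z / m)) = 2 * (b / x * ((- 3 / 2 * x + 3 * x * (x + y) * y / q - 3 / 4 * x\<^sup>2 * z / m) / N))"
      by simp
    also have "\<dots> = - 3 * b / N + 6 * b * (x + y) * y / (q * N) - 3 / 2 * b * x * z / (m * N)"
    proof -
      have "2 * (b / x * ((- 3 / 2 * x + 3 * x * r - 3 / 4 * x\<^sup>2 * u) / N)) = - 3 * b / N + 6 * b * r / N - 3 / 2 * b * x * u / N" for r u
        using assms(2) by (simp add: add_divide_distrib diff_divide_distrib distrib_left right_diff_distrib power2_eq_square mult_ac)
      from this[of "(x + y) * y / q" "z / m"] show ?thesis
        by (simp only: times_divide_eq_right times_divide_eq_left divide_divide_eq_left mult.assoc)
    qed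
    also have "6 * b * (x + y) * y / (q * N) = 3 * (b * y\<^sup>2 / (q * N)) + 3 * b * (2 * x + y) * y / (q * N)"
      by (simp add: power2_eq_square flip: add_divide_distrib) (simp add: algebra_simps)
    also have "3 / 2 * b * x * z = 3 / 4 * b * x * (3 * x + 2 * y)"
      by (simp add: z_def field_simps)
    finally have "2 * (b / x * (y / q - z / m)) = - 3 * b / N + (3 * (b * y\<^sup>2 / (q * N)) + 3 * b * (2 * x + y) * y / (q * N))
        - 3 / 4 * b * x * (3 * x + 2 * y) / (m * N)" .
    moreover have "b\<^sup>2 + (3 * x + 2 * y)\<^sup>2 / 4 = m"
      by (simp add: m_def z_def power2_eq_square field_simps)
    moreover have "Q (0, b) + Q (x, y) = N"
      by (simp add: N_def True)
    ultimately show ?thesis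
      using True assms(2) by (simp add: summand_def kernel3_def kernel4_def kernel5_def z_def[symmetric] m_def[symmetric] flip: q_def)
  qed
qed


section \<open>From theta terms to kernels\<close>

text \<open>Summand of \<open>theta3\<close> at \<open>(\<i> * t, \<i> * v)\<close>; the two
  definitions after it do the same for \<open>theta4\<close> and \<open>theta5\<close>. For v = t
  the exponent is - 2 \<pi> Q (n) t.\<close>

definition term3 :: "real \<times> real \<Rightarrow> real \<Rightarrow> real \<Rightarrow> real" where
  "term3 n t v = (2 * fst n + snd n) * exp (- (3 * pi / 2 * (2 * fst n + snd n)\<^sup>2 * t + pi / 2 * (snd n)\<^sup>2 * v))"

definition term4 :: "real \<times> real \<Rightarrow> real \<Rightarrow> real \<Rightarrow> real" where
  "term4 n t v = (3 * fst n + 2 * snd n) * exp (- (pi / 2 * (3 * fst n + 2 * snd n)\<^sup>2 * t + 3 * pi / 2 * (fst n)\<^sup>2 * v))"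

definition term5 :: "real \<times> real \<Rightarrow> real \<Rightarrow> real \<Rightarrow> real" where
  "term5 n t v = fst n * exp (- (pi / 2 * (3 * fst n + 2 * snd n)\<^sup>2 * t + 3 * pi / 2 * (fst n)\<^sup>2 * v))"

lemma kernel_measurable [measurable]:
  "kernel3 n \<in> borel_measurable borel" "kernel4 n \<in> borel_measurable borel" "kernel5 n \<in> borel_measurable borel"
  unfolding kernel3_def kernel4_def kernel5_def case_prod_unfold by measurable

text \<open>One statement for both diagonal coordinate systems. T is (2x + y, y) or (3x + 2y, x),
  each of Jacobian 2, and c d takes the same value in both, so for \<open>weight13\<close> all
  constants collapse to sqrt 3 / \<pi>. For \<open>weight31\<close> the ratio c / d
  survives.\<close>

lemma theta_term_integral:
  fixes T :: "real \<times> real \<Rightarrow> real \<times> real" and c d p q M :: real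
  assumes s: "Re s > 0" and c: "c > 0" and d: "d > 0" and cd: "c * d = 3 * pi\<^sup>2 / 4"
    and T: "\<And>h :: real \<times> real \<Rightarrow> complex. integrable lborel h \<Longrightarrow> integrable lborel (\<lambda>w. h (T w))"
      "\<And>h :: real \<times> real \<Rightarrow> complex. integrable lborel h \<Longrightarrow> (LBINT w. h (T w)) = integral\<^sup>L lborel h / 2"
    and M: "c * p\<^sup>2 + d * q\<^sup>2 = 2 * pi * M" and Q: "\<And>w. c * (fst (T w))\<^sup>2 + d * (snd (T w))\<^sup>2 = 2 * pi * Q w"
  defines "F \<equiv> \<lambda>u w. u\<^sup>2 / ((q\<^sup>2 + (snd (T w))\<^sup>2) * (M + Q w))"
  shows "p \<noteq> 0 \<Longrightarrow> integrable lborel (\<lambda>w. of_real (F (snd (T w)) w) * gauss s w)"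
    and "p \<noteq> 0 \<Longrightarrow> wedge_integral (\<lambda>t v. of_real (exp (- (c * p\<^sup>2 * t + d * q\<^sup>2 * v))) * weight13 s t v) =
      of_real (sqrt 3 / pi) * (LBINT w. of_real (F (snd (T w)) w) * gauss s w)"
    and "q \<noteq> 0 \<Longrightarrow> integrable lborel (\<lambda>w. of_real (F (fst (T w)) w) * gauss s w)"
    and "q \<noteq> 0 \<Longrightarrow> wedge_integral (\<lambda>t v. of_real (exp (- (c * p\<^sup>2 * t + d * q\<^sup>2 * v))) * weight31 s t v) =
      of_real (sqrt 3 * c / (pi * d)) * (LBINT w. of_real (F (fst (T w)) w) * gauss s w)"
proof -
  define k where "k u x y = u\<^sup>2 / (d * (q\<^sup>2 + y\<^sup>2) * (c * (p\<^sup>2 + x\<^sup>2) + d * (q\<^sup>2 + y\<^sup>2)))" for u x y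
  have sqrt_cd: "sqrt (c * d) = sqrt 3 * pi / 2"
    by (simp add: cd real_sqrt_mult real_sqrt_divide)
  have transport: "integrable lborel (\<lambda>w. of_real (F (g (T w)) w) * gauss s w)"
    "(LBINT (x, y). of_real (k (g (x, y)) x y) * exp (- s * of_real (c * x\<^sup>2 + d * y\<^sup>2))) =
      of_real (1 / (pi * d)) * (LBINT w. of_real (F (g (T w)) w) * gauss s w)"
    if [measurable]: "g \<in> borel_measurable borel"
      and int: "integrable lborel (\<lambda>(x, y). k (g (x, y)) x y * exp (- Re s * (c * x\<^sup>2 + d * y\<^sup>2)))"
    for g :: "real \<times> real \<Rightarrow> real"
  proof -
    let ?h = "\<lambda>w. case w of (x, y) \<Rightarrow> of_real (k (g (x, y)) x y) * exp (- s * of_real (c * x\<^sup>2 + d * y\<^sup>2))"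
    have h: "integrable lborel ?h"
    proof (rule Bochner_Integration.integrable_bound[OF int])
      show "AE w in lborel. norm (?h w) \<le> norm (case w of (x, y) \<Rightarrow> k (g (x, y)) x y * exp (- Re s * (c * x\<^sup>2 + d * y\<^sup>2)))"
        by (intro AE_I2) (auto simp: norm_mult norm_exp_eq_Re abs_mult)
      show "?h \<in> borel_measurable lborel"
        unfolding k_def case_prod_unfold prod.collapse by measurable
    qed
    \<comment> \<open>The first denominator contributes d, the second 2 \<pi>; the Jacobian then
      turns 1 / (2 \<pi> d) into 1 / (\<pi> d).\<close>
    have hT: "?h (T w) = of_real (1 / (2 * pi * d)) * (of_real (F (g (T w)) w) * gauss s w)" for w
    proof -
      have "c * (p\<^sup>2 + (fst (T w))\<^sup>2) + d * (q\<^sup>2 + (snd (T w))\<^sup>2) = 2 * pi * (M + Q w)"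
        using M Q[of w] by (simp add: distrib_left)
      then have "k (g (T w)) (fst (T w)) (snd (T w)) = 1 / (2 * pi * d) * F (g (T w)) w"
        by (simp add: k_def F_def)
      then show ?thesis
        unfolding case_prod_unfold prod.collapse gauss_def Q by simp
    qed
    have "integrable lborel (\<lambda>w. of_real (2 * pi * d) * ?h (T w))"
      by (intro integrable_mult_right T(1) h)
    then show "integrable lborel (\<lambda>w. of_real (F (g (T w)) w) * gauss s w)"
      unfolding hT using d by simp
    show "integral\<^sup>L lborel ?h = of_real (1 / (pi * d)) * (LBINT w. of_real (F (g (T w)) w) * gauss s w)"
      using T(2)[OF h] unfolding hT integral_mult_right_zero by simp
  qed
  show "integrable lborel (\<lambda>w. of_real (F (snd (T w)) w) * gauss s w)"
    "wedge_integral (\<lambda>t v. of_real (exp (- (c * p\<^sup>2 * t + d * q\<^sup>2 * v))) * weight13 s t v) =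
      of_real (sqrt 3 / pi) * (LBINT w. of_real (F (snd (T w)) w) * gauss s w)" if "p \<noteq> 0"
  proof -
    note K = theta_kernel_1_3[OF c d s that, of q, folded k_def]
    note tr = transport[of snd, unfolded snd_conv, OF _ K(1)]
    show "integrable lborel (\<lambda>w. of_real (F (snd (T w)) w) * gauss s w)"
      by (rule tr(1)) measurable
    show "wedge_integral (\<lambda>t v. of_real (exp (- (c * p\<^sup>2 * t + d * q\<^sup>2 * v))) * weight13 s t v) =
        of_real (sqrt 3 / pi) * (LBINT w. of_real (F (snd (T w)) w) * gauss s w)"
      unfolding K(2) sqrt_cd by (subst tr(2)) (use d in \<open>simp_all add: field_simps\<close>)
  qed
  show "integrable lborel (\<lambda>w. of_real (F (fst (T w)) w) * gauss s w)"
    "wedge_integral (\<lambda>t v. of_real (exp (- (c * p\<^sup>2 * t + d * q\<^sup>2 * v))) * weight31 s t v) =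
      of_real (sqrt 3 * c / (pi * d)) * (LBINT w. of_real (F (fst (T w)) w) * gauss s w)" if "q \<noteq> 0"
  proof -
    note K = theta_kernel_3_1[OF c d s that, of p, folded k_def]
    note tr = transport[of fst, unfolded fst_conv, OF _ K(1)]
    show "integrable lborel (\<lambda>w. of_real (F (fst (T w)) w) * gauss s w)"
      by (rule tr(1)) measurable
    show "wedge_integral (\<lambda>t v. of_real (exp (- (c * p\<^sup>2 * t + d * q\<^sup>2 * v))) * weight31 s t v) =
        of_real (sqrt 3 * c / (pi * d)) * (LBINT w. of_real (F (fst (T w)) w) * gauss s w)"
      unfolding K(2) sqrt_cd by (subst tr(2)) (use d in \<open>simp_all add: field_simps\<close>)
  qed
qed

lemma theta_terms_integral:
  assumes s: "Re s > 0"
  shows "integrable lborel (\<lambda>w. of_real (kernel3 (a, b) w) * gauss s w)"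
    and "wedge_integral (\<lambda>t v. of_real (term3 (a, b) t v) * weight13 s t v) =
      of_real (sqrt 3 / pi) * (LBINT w. of_real (kernel3 (a, b) w) * gauss s w)"
    and "integrable lborel (\<lambda>w. of_real (kernel4 (a, b) w) * gauss s w)"
    and "wedge_integral (\<lambda>t v. of_real (term4 (a, b) t v) * weight13 s t v) =
      of_real (sqrt 3 / pi) * (LBINT w. of_real (kernel4 (a, b) w) * gauss s w)"
    and "integrable lborel (\<lambda>w. of_real (kernel5 (a, b) w) * gauss s w)"
    and "wedge_integral (\<lambda>t v. of_real (term5 (a, b) t v) * weight31 s t v) =
      of_real (sqrt 3 / (3 * pi)) * (LBINT w. of_real (kernel5 (a, b) w) * gauss s w)"
proof -
  have e: "3 * pi / 2 * (2 * fst w + snd w)\<^sup>2 + pi / 2 * (snd w)\<^sup>2 = 2 * pi * Q w"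
    "pi / 2 * (3 * fst w + 2 * snd w)\<^sup>2 + 3 * pi / 2 * (fst w)\<^sup>2 = 2 * pi * Q w" for w
    by (cases w; simp add: Q_eq power2_eq_square field_simps)+
  have cd: "3 * pi / 2 > 0" "pi / 2 > 0" "3 * pi / 2 * (pi / 2) = 3 * pi\<^sup>2 / 4" "pi / 2 * (3 * pi / 2) = 3 * pi\<^sup>2 / 4"
    by (simp_all add: power2_eq_square)
  note V3 = theta_term_integral[where T = "\<lambda>w. (2 * fst w + snd w, snd w)" and p = "2 * a + b" and q = b,
      OF s cd(1,2,3) integral_Q_coordinates(1,2) e(1)[of "(a, b)", unfolded fst_conv snd_conv], unfolded fst_conv snd_conv, OF _ _ e(1)]
  note V4 = theta_term_integral[where T = "\<lambda>w. (3 * fst w + 2 * snd w, fst w)" and p = "3 * a + 2 * b" and q = a,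
      OF s cd(2,1,4) integral_Q_coordinates(3,4) e(2)[of "(a, b)", unfolded fst_conv snd_conv], unfolded fst_conv snd_conv, OF _ _ e(2)]
  \<comment> \<open>Restores the numerator p of the theta term. For p = 0 both sides vanish, which
    covers the case left open by the kernel lemmas.\<close>
  have scale: "integrable lborel (\<lambda>w. of_real (p * f w) * gauss s w)"
    "wedge_integral (\<lambda>t v. of_real (p * g t v) * W t v) = of_real \<kappa> * (LBINT w. of_real (p * f w) * gauss s w)"
    if "p \<noteq> 0 \<Longrightarrow> integrable lborel (\<lambda>w. of_real (f w) * gauss s w)"
      and "p \<noteq> 0 \<Longrightarrow> wedge_integral (\<lambda>t v. of_real (g t v) * W t v) = of_real \<kappa> * (LBINT w. of_real (f w) * gauss s w)"
    for p \<kappa> and f :: "real \<times> real \<Rightarrow> real" and g W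
  proof -
    show "integrable lborel (\<lambda>w. of_real (p * f w) * gauss s w)"
      using that(1) by (cases "p = 0") (simp_all add: mult.assoc)
    show "wedge_integral (\<lambda>t v. of_real (p * g t v) * W t v) = of_real \<kappa> * (LBINT w. of_real (p * f w) * gauss s w)"
    proof (cases "p = 0")
      case False
      show ?thesis
        unfolding of_real_mult mult.assoc set_integral_mult_right integral_mult_right_zero that(2)[OF False]
        by simp
    qed simp
  qed
  have k3: "kernel3 (a, b) w = (2 * a + b) * ((snd w)\<^sup>2 / ((b\<^sup>2 + (snd w)\<^sup>2) * (Q (a, b) + Q w)))"
    and k4: "kernel4 (a, b) w = (3 * a + 2 * b) * ((fst w)\<^sup>2 / ((a\<^sup>2 + (fst w)\<^sup>2) * (Q (a, b) + Q w)))"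
    and k5: "kernel5 (a, b) w = a * ((3 * fst w + 2 * snd w)\<^sup>2 / ((a\<^sup>2 + (fst w)\<^sup>2) * (Q (a, b) + Q w)))" for w
    by (cases w; simp add: kernel3_def kernel4_def kernel5_def)+
  have \<kappa>: "sqrt 3 * (pi / 2) / (pi * (3 * pi / 2)) = sqrt 3 / (3 * pi)"
    by simp
  show "integrable lborel (\<lambda>w. of_real (kernel3 (a, b) w) * gauss s w)"
    "wedge_integral (\<lambda>t v. of_real (term3 (a, b) t v) * weight13 s t v) =
      of_real (sqrt 3 / pi) * (LBINT w. of_real (kernel3 (a, b) w) * gauss s w)"
    unfolding k3 term3_def fst_conv snd_conv by (rule scale; rule V3; assumption)+
  show "integrable lborel (\<lambda>w. of_real (kernel4 (a, b) w) * gauss s w)"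
    "wedge_integral (\<lambda>t v. of_real (term4 (a, b) t v) * weight13 s t v) =
      of_real (sqrt 3 / pi) * (LBINT w. of_real (kernel4 (a, b) w) * gauss s w)"
    unfolding k4 term4_def fst_conv snd_conv by (rule scale; rule V4; assumption)+
  show "integrable lborel (\<lambda>w. of_real (kernel5 (a, b) w) * gauss s w)"
    "wedge_integral (\<lambda>t v. of_real (term5 (a, b) t v) * weight31 s t v) =
      of_real (sqrt 3 / (3 * pi)) * (LBINT w. of_real (kernel5 (a, b) w) * gauss s w)"
    unfolding k5 term5_def fst_conv snd_conv by (rule scale; rule V4[unfolded \<kappa>]; assumption)+
qed

section \<open>Remainders that integrate to zero\<close>

lemma odd_gaussian_integral:
  fixes F :: "real \<times> real \<Rightarrow> real" and c d :: real
  assumes s: "Re s > 0" and c: "c > 0" and d: "d > 0" and [measurable]: "F \<in> borel_measurable borel"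
    and bound: "\<And>x y. \<bar>F (x, y)\<bar> \<le> C * (1 + x\<^sup>2) * (1 + y\<^sup>2)"
    and odd: "\<And>x y. F (- x, y) = - F (x, y)"
  shows "integrable lborel (\<lambda>w. of_real (F w) * exp (- s * of_real (c * (fst w)\<^sup>2 + d * (snd w)\<^sup>2)))" (is "integrable _ ?h")
    and "(LBINT w. of_real (F w) * exp (- s * of_real (c * (fst w)\<^sup>2 + d * (snd w)\<^sup>2))) = 0"
proof -
  have gi: "integrable lborel (\<lambda>x::real. (1 + x\<^sup>2) * exp (- Re s * (e * x\<^sup>2)))" if "e > 0" for e
  proof -
    have r: "Re s * e > 0"
      using s that by simp
    have "integrable lborel (\<lambda>x::real. x ^ 0 * exp (- (Re s * e) * x\<^sup>2) + x ^ 2 * exp (- (Re s * e) * x\<^sup>2))"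
      by (intro Bochner_Integration.integrable_add integrable_power_gauss r)
    then show ?thesis
      by (simp add: algebra_simps)
  qed
  show int: "integrable lborel ?h"
  proof (rule Bochner_Integration.integrable_bound)
    show "integrable lborel (\<lambda>(x::real, y::real). (C * ((1 + x\<^sup>2) * exp (- Re s * (c * x\<^sup>2)))) * ((1 + y\<^sup>2) * exp (- Re s * (d * y\<^sup>2))))"
      by (intro integral_pair_times(1) integrable_mult_right gi c d)
    show "AE w in lborel. norm (?h w) \<le>
       norm (case w of (x, y) \<Rightarrow> (C * ((1 + x\<^sup>2) * exp (- Re s * (c * x\<^sup>2)))) * ((1 + y\<^sup>2) * exp (- Re s * (d * y\<^sup>2))))"
    proof (intro AE_I2, clarify)
      fix x y :: real
      have "norm (?h (x, y)) = \<bar>F (x, y)\<bar> * (exp (- Re s * (c * x\<^sup>2)) * exp (- Re s * (d * y\<^sup>2)))"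
        by (simp add: norm_mult norm_exp_eq_Re distrib_left flip: exp_add)
      also have "\<dots> \<le> (C * (1 + x\<^sup>2) * (1 + y\<^sup>2)) * (exp (- Re s * (c * x\<^sup>2)) * exp (- Re s * (d * y\<^sup>2)))"
        by (intro mult_right_mono bound) auto
      also have "\<dots> = (C * ((1 + x\<^sup>2) * exp (- Re s * (c * x\<^sup>2)))) * ((1 + y\<^sup>2) * exp (- Re s * (d * y\<^sup>2)))"
        by (simp only: mult_ac)
      finally show "norm (?h (x, y)) \<le> norm ((C * ((1 + x\<^sup>2) * exp (- Re s * (c * x\<^sup>2)))) * ((1 + y\<^sup>2) * exp (- Re s * (d * y\<^sup>2))))"
        by simp
    qed
  qed measurable
  show "integral\<^sup>L lborel ?h = 0"
    by (rule integral_odd_fst[OF int]) (simp add: odd)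
qed

text \<open>Q is a combination of squares both of (2x + y, y) and of (x, 3x + 2y), so negating the
  first entry of either pair preserves it. The polynomial bound makes the vanishing integrals
  absolutely convergent.\<close>

lemma odd_remainder_integral:
  fixes F :: "real \<times> real \<Rightarrow> real"
  assumes s: "Re s > 0" and F: "F \<in> borel_measurable borel"
    and bound: "\<And>x y. \<bar>F (x, y)\<bar> \<le> C * (1 + x\<^sup>2) * (1 + y\<^sup>2)"
    and odd: "\<And>x y. F (- x, y) = - F (x, y)"
  shows "integrable lborel (\<lambda>w. of_real (F (2 * fst w + snd w, snd w)) * gauss s w)"
    and "(LBINT w. of_real (F (2 * fst w + snd w, snd w)) * gauss s w) = 0"
    and "integrable lborel (\<lambda>w. of_real (F (fst w, 3 * fst w + 2 * snd w)) * gauss s w)"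
    and "(LBINT w. of_real (F (fst w, 3 * fst w + 2 * snd w)) * gauss s w) = 0"
proof -
  let ?h = "\<lambda>c d w. of_real (F w) * exp (- s * of_real (c * (fst w)\<^sup>2 + d * (snd w)\<^sup>2))"
  have e1: "3 * pi / 2 * (2 * x + y)\<^sup>2 + pi / 2 * y\<^sup>2 = 2 * pi * Q (x, y)"
    and e2: "3 * pi / 2 * x\<^sup>2 + pi / 2 * (3 * x + 2 * y)\<^sup>2 = 2 * pi * Q (x, y)" for x y
    by (simp_all add: Q_eq power2_eq_square field_simps)
  have h: "integrable lborel (?h (3 * pi / 2) (pi / 2))" "integral\<^sup>L lborel (?h (3 * pi / 2) (pi / 2)) = 0"
    by (rule odd_gaussian_integral[OF s _ _ F bound odd]; simp)+
  have hg: "?h (3 * pi / 2) (pi / 2) (2 * fst w + snd w, snd w) = of_real (F (2 * fst w + snd w, snd w)) * gauss s w" for w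
    unfolding gauss_def fst_conv snd_conv e1 by simp
  show "integrable lborel (\<lambda>w. of_real (F (2 * fst w + snd w, snd w)) * gauss s w)"
    using integral_Q_coordinates(1)[OF h(1)] unfolding hg .
  show "(LBINT w. of_real (F (2 * fst w + snd w, snd w)) * gauss s w) = 0"
    using integral_Q_coordinates(2)[OF h(1)] unfolding hg h(2) by simp
  let ?g = "\<lambda>w. ?h (3 * pi / 2) (pi / 2) (snd w, fst w)"
  have g: "integrable lborel ?g" "integral\<^sup>L lborel ?g = 0"
    using integrable_swap_plane[OF h(1)] h(2) by simp_all
  have gg: "?g (3 * fst w + 2 * snd w, fst w) = of_real (F (fst w, 3 * fst w + 2 * snd w)) * gauss s w" for w
    unfolding gauss_def fst_conv snd_conv e2 by simp
  show "integrable lborel (\<lambda>w. of_real (F (fst w, 3 * fst w + 2 * snd w)) * gauss s w)"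
    using integral_Q_coordinates(3)[OF g(1)] unfolding gg .
  show "(LBINT w. of_real (F (fst w, 3 * fst w + 2 * snd w)) * gauss s w) = 0"
    using integral_Q_coordinates(4)[OF g(1)] unfolding gg g(2) by simp
qed

lemma lattice_term_integral:
  assumes s: "Re s > 0"
  shows "integrable lborel (\<lambda>w. of_real (summand (a, b) w) * gauss s w)"
    and "2 * wedge_integral (\<lambda>t v. of_real (term3 (a, b) t v) * weight13 s t v)
     - wedge_integral (\<lambda>t v. of_real (term4 (a, b) t v) * weight13 s t v)
     + wedge_integral (\<lambda>t v. of_real (term5 (a, b) t v) * weight31 s t v) =
      of_real (4 / (sqrt 3 * pi)) * (LBINT w. of_real (summand (a, b) w) * gauss s w)"
proof -
  let ?K3 = "\<lambda>w. of_real (kernel3 (a, b) w) * gauss s w"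
  let ?K4 = "\<lambda>w. of_real (kernel4 (a, b) w) * gauss s w"
  let ?K5 = "\<lambda>w. of_real (kernel5 (a, b) w) * gauss s w"
  let ?S = "\<lambda>w. of_real (summand (a, b) w) * gauss s w"
  note K = theta_terms_integral(1,3,5)[OF s, of a b]
  have *: "integrable lborel ?S \<and> 2 * integral\<^sup>L lborel ?S =
      3 * integral\<^sup>L lborel ?K3 - 3 / 2 * integral\<^sup>L lborel ?K4 + integral\<^sup>L lborel ?K5 / 2"
  proof (cases "(a, b) = (0, 0)")
    case True
    then have "kernel3 (a, b) = (\<lambda>w. 0)" "kernel4 (a, b) = (\<lambda>w. 0)" "kernel5 (a, b) = (\<lambda>w. 0)" "summand (a, b) = (\<lambda>w. 0)"
      by (auto simp: kernel3_def kernel4_def kernel5_def summand_def)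
    then show ?thesis by simp
  next
    case False
    define N where "N = Q (a, b)"
    have N: "N > 0"
      unfolding N_def by (rule Q_pos[OF False])
    \<comment> \<open>The remainders of \<open>summand_split\<close> in diagonal coordinates, where
      (3 x^2 + y^2) / 4 stands for Q.\<close>
    define F1 where "F1 w = (case w of (x, y) \<Rightarrow> 3 * b * x * y / ((b\<^sup>2 + y\<^sup>2) * (N + (3 * x\<^sup>2 + y\<^sup>2) / 4)))" for w
    define F2 where "F2 w = (case w of (x, y) \<Rightarrow> if a \<noteq> 0 then b * x * y / ((a\<^sup>2 + x\<^sup>2) * (N + (3 * x\<^sup>2 + y\<^sup>2) / 4))
        else - (3 / 4) * b * x * y / ((b\<^sup>2 + y\<^sup>2 / 4) * (N + (3 * x\<^sup>2 + y\<^sup>2) / 4)))" for w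
    have [measurable]: "F1 \<in> borel_measurable borel" "F2 \<in> borel_measurable borel"
      unfolding F1_def F2_def case_prod_unfold by measurable
    have amgm: "\<bar>u * v\<bar> \<le> u\<^sup>2 + v\<^sup>2" for u v :: real
      using sum_squares_bound[of "\<bar>u\<bar>" "\<bar>v\<bar>"] abs_ge_zero[of "u * v"] unfolding abs_mult power2_abs by linarith
    have lin: "\<bar>x\<bar> \<le> 1 + x\<^sup>2" for x :: real
      using amgm[of 1 x] by (simp add: power2_eq_square)
    \<comment> \<open>Here D is a sum of two squares and dominates a multiple of |u| by the
      inequality of means, so the quotient keeps only the linear factor v.\<close>
    have quot: "\<bar>u * v / (D * (N + e))\<bar> \<le> \<bar>v\<bar> / (\<kappa> * N)" if "\<kappa> * \<bar>u\<bar> \<le> D" "\<kappa> > 0" "e \<ge> 0" for u v D e \<kappa>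
    proof (cases "u = 0 \<or> v = 0")
      case False
      have "\<kappa> * \<bar>u\<bar> > 0"
        using False that by simp
      then have D: "D > 0"
        using that by linarith
      have "\<bar>u * v / (D * (N + e))\<bar> = \<bar>v\<bar> * \<bar>u\<bar> / (D * (N + e))"
        using D N that by (simp add: abs_mult)
      also have "\<dots> \<le> \<bar>v\<bar> * \<bar>u\<bar> / ((\<kappa> * \<bar>u\<bar>) * N)"
        using D N that \<open>\<kappa> * \<bar>u\<bar> > 0\<close> by (intro divide_left_mono mult_mono mult_pos_pos) auto
      also have "\<dots> = \<bar>v\<bar> / (\<kappa> * N)"
        using False by simp
      finally show ?thesis .
    qed (use N that in auto)
    have grow: "\<bar>v\<bar> * C \<le> C * (1 + x\<^sup>2) * (1 + y\<^sup>2)" if "C \<ge> 0" "v = x \<or> v = y" for x y v C :: real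
    proof -
      have "\<bar>v\<bar> \<le> (1 + x\<^sup>2) * (1 + y\<^sup>2)"
      proof -
        have "1 + x\<^sup>2 \<le> (1 + x\<^sup>2) * (1 + y\<^sup>2)" "1 + y\<^sup>2 \<le> (1 + x\<^sup>2) * (1 + y\<^sup>2)"
          by (simp_all add: algebra_simps)
        with lin[of x] lin[of y] that show ?thesis by auto
      qed
      then have "C * \<bar>v\<bar> \<le> C * ((1 + x\<^sup>2) * (1 + y\<^sup>2))"
        using that by (intro mult_left_mono)
      then show ?thesis
        by (simp add: mult_ac)
    qed
    have F1: "\<bar>F1 (x, y)\<bar> \<le> (3 / N) * (1 + x\<^sup>2) * (1 + y\<^sup>2)" for x y
    proof -
      have "\<bar>(b * y) * (3 * x) / ((b\<^sup>2 + y\<^sup>2) * (N + (3 * x\<^sup>2 + y\<^sup>2) / 4))\<bar> \<le> \<bar>3 * x\<bar> / (1 * N)"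
        using amgm[of b y] by (intro quot) auto
      also have "\<dots> = \<bar>x\<bar> * (3 / N)"
        by (simp add: abs_mult)
      also have "\<dots> \<le> (3 / N) * (1 + x\<^sup>2) * (1 + y\<^sup>2)"
        using N by (intro grow) auto
      finally show ?thesis
        by (simp add: F1_def mult_ac)
    qed
    define C2 where "C2 = (if a \<noteq> 0 then \<bar>b\<bar> / (\<bar>a\<bar> * N) else (3 / 4) / N)"
    have C2: "C2 \<ge> 0"
      using N by (simp add: C2_def)
    have F2: "\<bar>F2 (x, y)\<bar> \<le> C2 * (1 + x\<^sup>2) * (1 + y\<^sup>2)" for x y
    proof (cases "a = 0")
      case True
      have "\<bar>(b * y) * (- (3 / 4) * x) / ((b\<^sup>2 + y\<^sup>2 / 4) * (N + (3 * x\<^sup>2 + y\<^sup>2) / 4))\<bar> \<le> \<bar>- (3 / 4) * x\<bar> / (1 * N)"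
        using sum_squares_bound[of "\<bar>b\<bar>" "\<bar>y / 2\<bar>"] by (intro quot) (auto simp: power_divide abs_mult)
      also have "\<dots> = \<bar>x\<bar> * C2"
        by (simp add: True C2_def abs_mult)
      also have "\<dots> \<le> C2 * (1 + x\<^sup>2) * (1 + y\<^sup>2)"
        using C2 by (intro grow) auto
      finally show ?thesis
        by (simp add: F2_def True mult_ac)
    next
      case False
      have "\<bar>x * (b * y) / ((a\<^sup>2 + x\<^sup>2) * (N + (3 * x\<^sup>2 + y\<^sup>2) / 4))\<bar> \<le> \<bar>b * y\<bar> / (\<bar>a\<bar> * N)"
        using amgm[of a x] False by (intro quot) (auto simp: abs_mult)
      also have "\<dots> = \<bar>y\<bar> * C2"
        using False by (simp add: C2_def abs_mult)
      also have "\<dots> \<le> C2 * (1 + x\<^sup>2) * (1 + y\<^sup>2)"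
        using C2 by (intro grow) auto
      finally show ?thesis
        using False by (simp add: F2_def mult_ac)
    qed
    let ?R1 = "\<lambda>w. of_real (F1 (2 * fst w + snd w, snd w)) * gauss s w"
    let ?R2 = "\<lambda>w. of_real (F2 (fst w, 3 * fst w + 2 * snd w)) * gauss s w"
    have R1: "integrable lborel ?R1" "integral\<^sup>L lborel ?R1 = 0"
      by (rule odd_remainder_integral[OF s _ F1]; simp add: F1_def)+
    have R2: "integrable lborel ?R2" "integral\<^sup>L lborel ?R2 = 0"
      by (rule odd_remainder_integral[OF s _ F2]; simp add: F2_def)+
    have eq: "AE w in lborel. 3 / 2 * ?K3 w - 3 / 4 * ?K4 w + ?K5 w / 4 + ?R1 w / 2 + ?R2 w / 2 = ?S w"
      using AE_plane_generic
    proof eventually_elim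
      case (elim w)
      obtain x y where w: "w = (x, y)" by (cases w)
      have e1: "N + (3 * (2 * x + y)\<^sup>2 + y\<^sup>2) / 4 = Q (a, b) + Q (x, y)"
        and e2: "N + (3 * x\<^sup>2 + (3 * x + 2 * y)\<^sup>2) / 4 = Q (a, b) + Q (x, y)"
        by (simp_all add: N_def Q_eq power2_eq_square field_simps)
      have "2 * summand (a, b) w = 3 * kernel3 (a, b) w - 3 / 2 * kernel4 (a, b) w + kernel5 (a, b) w / 2
          + F1 (2 * fst w + snd w, snd w) + F2 (fst w, 3 * fst w + 2 * snd w)"
        using summand_split[OF False, of x y] elim unfolding w F1_def F2_def prod.case fst_conv snd_conv e1 e2 by simp
      then have "summand (a, b) w = 3 / 2 * kernel3 (a, b) w - 3 / 4 * kernel4 (a, b) w + kernel5 (a, b) w / 4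
          + F1 (2 * fst w + snd w, snd w) / 2 + F2 (fst w, 3 * fst w + 2 * snd w) / 2"
        by linarith
      then have c: "complex_of_real (summand (a, b) w) = 3 / 2 * of_real (kernel3 (a, b) w) - 3 / 4 * of_real (kernel4 (a, b) w)
          + of_real (kernel5 (a, b) w) / 4 + of_real (F1 (2 * fst w + snd w, snd w)) / 2 + of_real (F2 (fst w, 3 * fst w + 2 * snd w)) / 2"
        by simp
      show ?case
        unfolding c by (simp add: distrib_right left_diff_distrib mult.assoc)
    qed
    have lhs: "integrable lborel (\<lambda>w. 3 / 2 * ?K3 w - 3 / 4 * ?K4 w + ?K5 w / 4 + ?R1 w / 2 + ?R2 w / 2)"
      using K R1(1) R2(1) by (intro Bochner_Integration.integrable_add Bochner_Integration.integrable_diff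
          integrable_mult_right integrable_divide_zero)
    have S: "integrable lborel ?S"
      by (rule integrable_cong_AE_imp[OF lhs _ eq]) measurable
    have "integral\<^sup>L lborel ?S = (LBINT w. 3 / 2 * ?K3 w - 3 / 4 * ?K4 w + ?K5 w / 4 + ?R1 w / 2 + ?R2 w / 2)"
      by (rule integral_cong_AE[symmetric, OF _ _ eq]) measurable
    also have "\<dots> = 3 / 2 * integral\<^sup>L lborel ?K3 - 3 / 4 * integral\<^sup>L lborel ?K4 + integral\<^sup>L lborel ?K5 / 4"
      using K R1 R2 by (simp add: Bochner_Integration.integral_add Bochner_Integration.integral_diff)
    finally show ?thesis
      using S by simp
  qed
  then show "integrable lborel ?S" by blast
  \<comment> \<open>The coefficients 3, 3/2, 1/2 of \<open>summand_split\<close> are 3/2 times the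
    coefficients 2, 1, 1/3 of the theta integrals, and it expresses twice the summand; hence (2/3) *
    2 = 4/3.\<close>
  have r3: "complex_of_real (sqrt 3) * of_real (sqrt 3) = 3"
    by (simp flip: of_real_mult)
  have c: "complex_of_real (4 / (sqrt 3 * pi)) = of_real (sqrt 3 / pi) * (4 / 3)"
    using r3 by (simp add: field_simps)
  have "of_real (4 / (sqrt 3 * pi)) * integral\<^sup>L lborel ?S = of_real (sqrt 3 / pi) * (2 / 3) * (2 * integral\<^sup>L lborel ?S)"
    unfolding c by simp
  also have "\<dots> = 2 * (of_real (sqrt 3 / pi) * integral\<^sup>L lborel ?K3) - of_real (sqrt 3 / pi) * integral\<^sup>L lborel ?K4
      + of_real (sqrt 3 / (3 * pi)) * integral\<^sup>L lborel ?K5"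
    unfolding conjunct2[OF *] by (simp add: field_simps)
  finally show "2 * wedge_integral (\<lambda>t v. of_real (term3 (a, b) t v) * weight13 s t v)
     - wedge_integral (\<lambda>t v. of_real (term4 (a, b) t v) * weight13 s t v)
     + wedge_integral (\<lambda>t v. of_real (term5 (a, b) t v) * weight31 s t v) =
      of_real (4 / (sqrt 3 * pi)) * (LBINT w. of_real (summand (a, b) w) * gauss s w)"
    unfolding theta_terms_integral(2,4,6)[OF s] by simp
qed

section \<open>Elliptic truncation of the lattice\<close>

lemma csqrt_measurable [measurable]: "csqrt \<in> borel_measurable borel"
proof (subst borel_measurable_complex_iff, intro conjI)
  show "(\<lambda>z. Re (csqrt z)) \<in> borel_measurable borel"
    unfolding csqrt.sel by measurable
  show "(\<lambda>z. Im (csqrt z)) \<in> borel_measurable borel"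
    unfolding csqrt.sel sgn_real_def by measurable
qed

text \<open>Integer indices allow the rows of the lattice to be reparametrised by bijections of
  pairs of integers.\<close>

definition lattice_point :: "real \<times> real \<Rightarrow> int \<times> int \<Rightarrow> real \<times> real" where
  "lattice_point \<alpha> k = (fst \<alpha> + of_int (fst k), snd \<alpha> + of_int (snd k))"

lemma lattice_point_bij: "bij_betw (lattice_point \<alpha>) UNIV (shifted_lattice \<alpha>)"
  unfolding bij_betw_def
proof
  show "inj (lattice_point \<alpha>)"
    by (auto simp: inj_on_def lattice_point_def prod_eq_iff)
  have "range (lattice_point \<alpha>) = (\<lambda>m. \<alpha> + m) ` range (\<lambda>k. (real_of_int (fst k), real_of_int (snd k)))"
    unfolding image_image by (simp add: lattice_point_def[abs_def] plus_prod_def)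
  also have "range (\<lambda>k::int \<times> int. (real_of_int (fst k), real_of_int (snd k))) = \<int> \<times> \<int>"
    by (auto simp: Ints_def image_iff)
  finally show "range (lattice_point \<alpha>) = shifted_lattice \<alpha>"
    by (simp add: shifted_lattice_def)
qed

definition truncation :: "real \<times> real \<Rightarrow> nat \<Rightarrow> (int \<times> int) set" where
  "truncation \<alpha> N = {k. Q (lattice_point \<alpha> k) \<le> real N}"

lemma finite_truncation: "finite (truncation \<alpha> N)"
proof -
  define A where "A \<beta> = {i::int. \<bar>\<beta> + of_int i\<bar> \<le> 1 + 6 * real N}" for \<beta> :: real
  have fin: "finite (A \<beta>)" for \<beta>
  proof (rule finite_subset)
    show "A \<beta> \<subseteq> {\<lceil>- \<beta> - (1 + 6 * real N)\<rceil>..\<lfloor>1 + 6 * real N - \<beta>\<rfloor>}"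
      unfolding A_def by (auto simp: ceiling_le_iff le_floor_iff abs_le_iff)
  qed simp
  have le: "\<bar>x\<bar> \<le> 1 + x\<^sup>2" for x :: real
    using sum_squares_bound[of 1 "\<bar>x\<bar>"] by simp
  have "truncation \<alpha> N \<subseteq> A (fst \<alpha>) \<times> A (snd \<alpha>)"
  proof
    fix k assume "k \<in> truncation \<alpha> N"
    then have "(fst \<alpha> + of_int (fst k))\<^sup>2 + (snd \<alpha> + of_int (snd k))\<^sup>2 \<le> 6 * real N"
      using Q_lower[of "fst \<alpha> + of_int (fst k)" "snd \<alpha> + of_int (snd k)"]
      by (simp add: truncation_def lattice_point_def)
    then have "(fst \<alpha> + of_int (fst k))\<^sup>2 \<le> 6 * real N" "(snd \<alpha> + of_int (snd k))\<^sup>2 \<le> 6 * real N"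
      by (smt (verit) zero_le_power2)+
    then show "k \<in> A (fst \<alpha>) \<times> A (snd \<alpha>)"
      using le[of "fst \<alpha> + of_int (fst k)"] le[of "snd \<alpha> + of_int (snd k)"]
      by (auto simp: A_def mem_Times_iff)
  qed
  then show ?thesis
    using fin finite_subset by blast
qed

text \<open>Under this bound the series converges absolutely, so every exhausting sequence of finite
  sets gives the same sum. The truncations exhaust the lattice because Q is bounded on finite
  sets.\<close>

lemma lattice_sum_limit:
  fixes f :: "real \<times> real \<Rightarrow> complex"
  assumes bound: "\<And>a b. norm (f (a, b)) \<le> C * (1 / (1 + a\<^sup>2) * (1 / (1 + b\<^sup>2)))"
  shows "(\<lambda>N. \<Sum>k\<in>truncation \<alpha> N. f (lattice_point \<alpha> k)) \<longlonglongrightarrow> infsum f (shifted_lattice \<alpha>)"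
proof -
  define g where "g k = 1 / (1 + (fst \<alpha> + of_int (fst k))\<^sup>2) * (1 / (1 + (snd \<alpha> + of_int (snd k))\<^sup>2))" for k :: "int \<times> int"
  have g0: "g k \<ge> 0" for k
    by (simp add: g_def)
  have C: "C \<ge> 0"
    using order_trans[OF norm_ge_zero bound[of 0 0]] by simp
  have "g summable_on UNIV"
  proof (rule nonneg_bdd_above_summable_on[OF g0], rule bdd_aboveI2)
    fix F :: "(int \<times> int) set" assume "F \<in> {F. F \<subseteq> UNIV \<and> finite F}"
    then have F: "finite F" by simp
    have "sum g F \<le> sum g (fst ` F \<times> snd ` F)"
      using F g0 by (intro sum_mono2) (force simp: mem_Times_iff)+
    also have "\<dots> = (\<Sum>i\<in>fst ` F. 1 / (1 + 1 * (fst \<alpha> + of_int i)\<^sup>2)) * (\<Sum>j\<in>snd ` F. 1 / (1 + 1 * (snd \<alpha> + of_int j)\<^sup>2))"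
      by (simp add: g_def sum_product sum.cartesian_product case_prod_unfold)
    also have "\<dots> \<le> 10 * 10"
      using F sum_inverse_square_le[of 1 "fst ` F" "fst \<alpha>"] sum_inverse_square_le[of 1 "snd ` F" "snd \<alpha>"]
      by (intro mult_mono sum_nonneg) auto
    finally show "sum g F \<le> 10 * 10" .
  qed
  then have "(\<lambda>k. C * g k) summable_on UNIV"
    by (rule summable_on_cmult_right)
  then have "(\<lambda>k. norm (f (lattice_point \<alpha> k))) summable_on UNIV"
  proof (rule Infinite_Sum.abs_summable_on_comparison_test')
    show "norm (f (lattice_point \<alpha> k)) \<le> C * g k" for k
      using bound by (simp add: lattice_point_def g_def)
  qed
  then have "(\<lambda>k. f (lattice_point \<alpha> k)) summable_on UNIV"
    by (rule abs_summable_summable)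
  then have "((\<lambda>k. f (lattice_point \<alpha> k)) has_sum (\<Sum>\<^sub>\<infinity>k. f (lattice_point \<alpha> k))) UNIV"
    by (rule has_sum_infsum)
  then have "(sum (\<lambda>k. f (lattice_point \<alpha> k)) \<longlongrightarrow> (\<Sum>\<^sub>\<infinity>k. f (lattice_point \<alpha> k))) (finite_subsets_at_top UNIV)"
    by (simp add: has_sum_def)
  moreover have "filterlim (truncation \<alpha>) (finite_subsets_at_top UNIV) sequentially"
    unfolding filterlim_iff eventually_finite_subsets_at_top
  proof safe
    fix P and X :: "(int \<times> int) set"
    assume X: "finite X" "\<forall>Y. finite Y \<and> X \<subseteq> Y \<and> Y \<subseteq> UNIV \<longrightarrow> P Y"
    define M where "M = Max (insert 0 ((\<lambda>k. Q (lattice_point \<alpha> k)) ` X))"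
    have M: "Q (lattice_point \<alpha> k) \<le> M" if "k \<in> X" for k
      using X that by (auto simp: M_def intro: Max_ge)
    show "eventually (\<lambda>N. P (truncation \<alpha> N)) sequentially"
      using eventually_ge_at_top[of "nat \<lceil>M\<rceil>"]
    proof eventually_elim
      case (elim N)
      have "M \<le> real N"
        using elim by linarith
      then have "X \<subseteq> truncation \<alpha> N"
        using M order_trans by (fastforce simp: truncation_def)
      then show ?case
        using X(2) finite_truncation by blast
    qed
  qed
  ultimately have "(\<lambda>N. \<Sum>k\<in>truncation \<alpha> N. f (lattice_point \<alpha> k)) \<longlonglongrightarrow> (\<Sum>\<^sub>\<infinity>k. f (lattice_point \<alpha> k))"
    by (rule filterlim_compose)
  then show ?thesis
    by (simp add: infsum_reindex_bij_betw[OF lattice_point_bij])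
qed

section \<open>Limits and finite sums under iterated integrals\<close>

text \<open>Dominated convergence first in u and then in t, with the integrable product \<mu> t
  \<mu> u as majorant. Measurability of g comes from the pointwise limit, so it need not be proved
  for the theta series directly.\<close>

lemma iterated_integral_limit:
  fixes f :: "nat \<Rightarrow> real \<Rightarrow> real \<Rightarrow> complex"
  assumes [measurable]: "\<And>N. (\<lambda>(t, u). f N t u) \<in> borel_measurable (lborel \<Otimes>\<^sub>M lborel)"
    and bound: "\<And>N t u. t > 0 \<Longrightarrow> u > 0 \<Longrightarrow> norm (f N t u) \<le> C * (\<mu> t * \<mu> u)"
    and lim: "\<And>t u. t > 0 \<Longrightarrow> u > 0 \<Longrightarrow> (\<lambda>N. f N t u) \<longlonglongrightarrow> g t u"
  shows "(\<lambda>N. LBINT t:{0<..}. LBINT u:{0<..}. f N t u) \<longlonglongrightarrow> (LBINT t:{0<..}. LBINT u:{0<..}. g t u)"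
proof -
  have C: "C \<ge> 0"
  proof -
    have "0 \<le> C * (\<mu> 1 * \<mu> 1)"
      using order_trans[OF norm_ge_zero bound[of 1 1]] by simp
    moreover have "\<mu> 1 * \<mu> 1 > 0"
      by (simp add: \<mu>_def)
    ultimately show ?thesis
      by (simp add: zero_le_mult_iff)
  qed
  define I where "I t = indicator {0<..} t * \<mu> t" for t
  have I: "integrable lborel I"
    using \<mu>_integrable by (simp add: set_integrable_def I_def[abs_def])
  have inner_bound: "norm (indicator {0<..} u *\<^sub>R f N t u) \<le> C * \<mu> t * I u" if "t > 0" for N t u
    using bound[OF that, of u N] by (auto simp: I_def indicator_def mult.assoc)
  have meas: "(\<lambda>u. indicator {0<..} u *\<^sub>R f N t u) \<in> borel_measurable lborel" for N t
    by measurable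
  have limI: "(\<lambda>N. indicator {0<..} u *\<^sub>R f N t u) \<longlonglongrightarrow> indicator {0<..} u *\<^sub>R g t u" if "t > 0" for t u
    using lim[OF that, of u] by (auto simp: indicator_def)
  have inner: "(\<lambda>N. LBINT u:{0<..}. f N t u) \<longlonglongrightarrow> (LBINT u:{0<..}. g t u)" if t: "t > 0" for t
    unfolding set_lebesgue_integral_def
  proof (rule integral_dominated_convergence[where w = "\<lambda>u. C * \<mu> t * I u"])
    show "(\<lambda>u. indicator {0<..} u *\<^sub>R g t u) \<in> borel_measurable lborel"
      by (rule borel_measurable_LIMSEQ_metric[OF meas limI[OF t]])
  qed (use I meas limI[OF t] inner_bound[OF t] in auto)
  define h where "h N t = indicator {0<..} t *\<^sub>R (LBINT u:{0<..}. f N t u)" for N t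
  define h' where "h' t = indicator {0<..} t *\<^sub>R (LBINT u:{0<..}. g t u)" for t
  have hm: "h N \<in> borel_measurable lborel" for N
    unfolding h_def set_lebesgue_integral_def by measurable
  have hlim: "(\<lambda>N. h N t) \<longlonglongrightarrow> h' t" for t
    using inner[of t] by (auto simp: h_def h'_def indicator_def)
  have hbound: "norm (h N t) \<le> C * integral\<^sup>L lborel I * I t" for N t
  proof (cases "t > 0")
    case True
    have "norm (LBINT u:{0<..}. f N t u) \<le> (LBINT u. C * \<mu> t * I u)"
      unfolding set_lebesgue_integral_def
    proof (rule Bochner_Integration.integral_norm_bound_integral)
      show "integrable lborel (\<lambda>u. C * \<mu> t * I u)"
        using I by simp
      show "integrable lborel (\<lambda>u. indicator {0<..} u *\<^sub>R f N t u)"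
      proof (rule Bochner_Integration.integrable_bound[OF \<open>integrable lborel (\<lambda>u. C * \<mu> t * I u)\<close> meas])
        show "AE u in lborel. norm (indicator {0<..} u *\<^sub>R f N t u) \<le> norm (C * \<mu> t * I u)"
          using inner_bound[OF True, of _ N] order_trans abs_ge_self by (intro AE_I2) fastforce
      qed
    qed (rule inner_bound[OF True])
    also have "\<dots> = C * \<mu> t * integral\<^sup>L lborel I"
      by (rule integral_mult_right_zero)
    finally show ?thesis
      using True by (simp add: h_def I_def[of t] mult_ac)
  qed (simp add: h_def I_def)
  have "(\<lambda>N. integral\<^sup>L lborel (h N)) \<longlonglongrightarrow> integral\<^sup>L lborel h'"
  proof (rule integral_dominated_convergence[where w = "\<lambda>t. C * integral\<^sup>L lborel I * I t"])
    show "h' \<in> borel_measurable lborel"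
      by (rule borel_measurable_LIMSEQ_metric[OF hm hlim])
  qed (use I hm hlim hbound in auto)
  then show ?thesis
    unfolding h_def[abs_def] h'_def[abs_def] set_lebesgue_integral_def .
qed

text \<open>The constants may depend on i: exchanging a finite sum requires integrability of each
  term, not the cancellation between terms.\<close>

lemma iterated_integral_sum:
  fixes f :: "'i \<Rightarrow> real \<Rightarrow> real \<Rightarrow> complex"
  assumes [measurable]: "\<And>i. i \<in> T \<Longrightarrow> (\<lambda>(t, u). f i t u) \<in> borel_measurable (lborel \<Otimes>\<^sub>M lborel)"
    and bound: "\<And>i t u. i \<in> T \<Longrightarrow> t > 0 \<Longrightarrow> u > 0 \<Longrightarrow> norm (f i t u) \<le> C i * (\<mu> t * \<mu> u)"
  shows "(LBINT t:{0<..}. LBINT u:{0<..}. \<Sum>i\<in>T. f i t u) = (\<Sum>i\<in>T. LBINT t:{0<..}. LBINT u:{0<..}. f i t u)"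
proof -
  define I where "I t = indicator {0<..} t * \<mu> t" for t
  have I: "integrable lborel I"
    using \<mu>_integrable by (simp add: set_integrable_def I_def[abs_def])
  have inner_bound: "norm (indicator {0<..} u *\<^sub>R f i t u) \<le> C i * \<mu> t * I u" if "t > 0" "i \<in> T" for i t u
    using bound[OF that(2,1), of u] by (auto simp: I_def indicator_def mult.assoc)
  have inner: "integrable lborel (\<lambda>u. indicator {0<..} u *\<^sub>R f i t u)" if "t > 0" "i \<in> T" for i t
  proof (rule Bochner_Integration.integrable_bound)
    show "integrable lborel (\<lambda>u. C i * \<mu> t * I u)"
      using I by simp
    show "AE u in lborel. norm (indicator {0<..} u *\<^sub>R f i t u) \<le> norm (C i * \<mu> t * I u)"
      using inner_bound[OF that] order_trans abs_ge_self by (intro AE_I2) fastforce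
    show "(\<lambda>u. indicator {0<..} u *\<^sub>R f i t u) \<in> borel_measurable lborel"
      using that(2) by measurable
  qed
  have outer: "integrable lborel (\<lambda>t. indicator {0<..} t *\<^sub>R (LBINT u:{0<..}. f i t u))" if i: "i \<in> T" for i
  proof (rule Bochner_Integration.integrable_bound)
    show "integrable lborel (\<lambda>t. C i * integral\<^sup>L lborel I * I t)"
      using I by simp
    show "(\<lambda>t. indicator {0<..} t *\<^sub>R (LBINT u:{0<..}. f i t u)) \<in> borel_measurable lborel"
      unfolding set_lebesgue_integral_def using i by measurable
    have "norm (indicator {0<..} t *\<^sub>R (LBINT u:{0<..}. f i t u)) \<le> C i * integral\<^sup>L lborel I * I t" for t
    proof (cases "t > 0")
      case True
      have "norm (LBINT u:{0<..}. f i t u) \<le> (LBINT u. C i * \<mu> t * I u)"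
        unfolding set_lebesgue_integral_def
        by (rule Bochner_Integration.integral_norm_bound_integral[OF inner[OF True i] _ inner_bound[OF True i]]) (use I in simp)
      also have "\<dots> = C i * \<mu> t * integral\<^sup>L lborel I"
        by (rule integral_mult_right_zero)
      finally show ?thesis
        using True by (simp add: I_def[of t] mult_ac)
    qed (simp add: I_def)
    then show "AE t in lborel. norm (indicator {0<..} t *\<^sub>R (LBINT u:{0<..}. f i t u)) \<le> norm (C i * integral\<^sup>L lborel I * I t)"
      using order_trans abs_ge_self by (intro AE_I2) fastforce
  qed
  have "(LBINT t:{0<..}. LBINT u:{0<..}. \<Sum>i\<in>T. f i t u) = (LBINT t:{0<..}. \<Sum>i\<in>T. LBINT u:{0<..}. f i t u)"
  proof (intro set_lebesgue_integral_cong allI impI)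
    fix t :: real assume "t \<in> {0<..}"
    then show "(LBINT u:{0<..}. \<Sum>i\<in>T. f i t u) = (\<Sum>i\<in>T. LBINT u:{0<..}. f i t u)"
      unfolding set_lebesgue_integral_def scaleR_sum_right
      by (intro Bochner_Integration.integral_sum inner) auto
  qed simp
  also have "\<dots> = (\<Sum>i\<in>T. LBINT t:{0<..}. LBINT u:{0<..}. f i t u)"
    unfolding set_lebesgue_integral_def[where A = "{0<..}" and f = "\<lambda>t. \<Sum>i\<in>T. F i t" for F]
      set_lebesgue_integral_def[where A = "{0<..}" and f = "\<lambda>t. LBINT u:{0<..}. F t u" for F] scaleR_sum_right
    by (intro Bochner_Integration.integral_sum outer)
  finally show ?thesis .
qed

text \<open>The bijection chooses the direction in which the truncated lattice is sliced into
  windows.\<close>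

lemma sum_fibres:
  fixes \<phi> :: "int \<times> int \<Rightarrow> int \<times> int" and F :: "int \<times> int \<Rightarrow> 'a::comm_monoid_add"
  assumes T: "finite T" and \<phi>: "bij \<phi>"
  shows "(\<Sum>k\<in>T. F k) = (\<Sum>l\<in>fst ` (\<phi> -` T). \<Sum>m | \<phi> (l, m) \<in> T. F (\<phi> (l, m)))"
    and "finite (fst ` (\<phi> -` T))"
proof -
  have fin: "finite (\<phi> -` T)"
    using T \<phi> by (simp add: finite_vimageI bij_is_inj)
  then show "finite (fst ` (\<phi> -` T))"
    by simp
  have "(\<Sum>k\<in>T. F k) = (\<Sum>lm\<in>\<phi> -` T. F (\<phi> lm))"
  proof (rule sum.reindex_bij_betw[symmetric])
    show "bij_betw \<phi> (\<phi> -` T) T"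
      using \<phi> by (auto simp: bij_betw_def bij_def inj_on_def surj_def image_iff)
  qed
  also have "\<phi> -` T = Sigma (fst ` (\<phi> -` T)) (\<lambda>l. {m. \<phi> (l, m) \<in> T})"
    by (force simp: image_iff)
  also have "(\<Sum>lm\<in>\<dots>. F (\<phi> lm)) = (\<Sum>l\<in>fst ` (\<phi> -` T). \<Sum>m | \<phi> (l, m) \<in> T. F (\<phi> (l, m)))"
  proof (subst sum.Sigma)
    show "\<forall>l\<in>fst ` (\<phi> -` T). finite {m. \<phi> (l, m) \<in> T}"
    proof
      fix l
      have "{m. \<phi> (l, m) \<in> T} \<subseteq> snd ` (\<phi> -` T)"
        by force
      then show "finite {m. \<phi> (l, m) \<in> T}"
        using fin finite_subset by blast
    qed
  qed (use fin in auto)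
  finally show "(\<Sum>k\<in>T. F k) = (\<Sum>l\<in>fst ` (\<phi> -` T). \<Sum>m | \<phi> (l, m) \<in> T. F (\<phi> (l, m)))" .
qed

lemma term_measurable [measurable]:
  "(\<lambda>(t, u). term3 n t (t + u)) \<in> borel_measurable (lborel \<Otimes>\<^sub>M lborel)"
  "(\<lambda>(t, u). term4 n t (t + u)) \<in> borel_measurable (lborel \<Otimes>\<^sub>M lborel)"
  "(\<lambda>(t, u). term5 n t (t + u)) \<in> borel_measurable (lborel \<Otimes>\<^sub>M lborel)"
  unfolding term3_def term4_def term5_def case_prod_unfold by measurable

text \<open>Also correct for y < 0: the real square root of a negative number is negative, so both
  sides fail. Rows that miss the ellipse thus become empty windows without a case
  distinction.\<close>

lemma square_le_iff_window:
  fixes c x y :: real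
  assumes "c > 0"
  shows "c * x\<^sup>2 \<le> y \<longleftrightarrow> \<bar>x\<bar> \<le> sqrt (y / c)"
proof -
  have "c * x\<^sup>2 \<le> y \<longleftrightarrow> \<bar>x\<bar>\<^sup>2 \<le> y / c"
    using assms by (simp add: field_simps)
  also have "\<dots> \<longleftrightarrow> \<bar>x\<bar> \<le> sqrt (y / c)"
    using real_le_rsqrt[of "\<bar>x\<bar>" "y / c"] sqrt_le_D[of "\<bar>x\<bar>"] by (smt (verit) real_sqrt_abs real_sqrt_le_iff power2_abs)
  finally show ?thesis .
qed

lemma truncation_sum_bounds:
  fixes \<alpha> :: "real \<times> real"
  shows "\<exists>C. \<forall>N t v. t > 0 \<longrightarrow> v > 0 \<longrightarrow>
     \<bar>\<Sum>k\<in>truncation \<alpha> N. term3 (lattice_point \<alpha> k) t v\<bar> \<le> C * \<mu> t * (2 + 8 / sqrt v)"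
    and "\<exists>C. \<forall>N t v. t > 0 \<longrightarrow> v > 0 \<longrightarrow>
     \<bar>\<Sum>k\<in>truncation \<alpha> N. term4 (lattice_point \<alpha> k) t v\<bar> \<le> C * \<mu> t * (2 + 8 / sqrt v)"
    and "\<exists>C. \<forall>N t v. t > 0 \<longrightarrow> v > 0 \<longrightarrow>
     \<bar>\<Sum>k\<in>truncation \<alpha> N. term5 (lattice_point \<alpha> k) t v\<bar> \<le> C * \<mu> v * (2 + 8 / sqrt t)"
proof -
  obtain a b where \<alpha>: "\<alpha> = (a, b)" by (cases \<alpha>)
  have pi1: "pi / 2 \<ge> 1" "3 * pi / 2 \<ge> 1"
    using pi_ge_two by auto
  \<comment> \<open>Common scheme: when 4 Q is a combination of the squares of p + 2 m and \<gamma>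
    + l, the condition Q \<le> N is a window symmetric in the numerator p + 2 m.\<close>
  have bound: "\<exists>C. \<forall>N t v. t > 0 \<longrightarrow> v > 0 \<longrightarrow>
      \<bar>\<Sum>k\<in>truncation \<alpha> N. F (lattice_point \<alpha> k) t v\<bar> \<le> C * \<mu> t * (2 + 8 / sqrt v)"
    if \<phi>: "bij \<phi>" and p: "\<And>l. p l - \<beta> \<in> \<int>" and c: "c \<ge> 1" "d \<ge> 1" "e > 0"
      and Q: "\<And>l m. 4 * Q (lattice_point \<alpha> (\<phi> (l, m))) = e * (p l + 2 * of_int m)\<^sup>2 + e' * (\<gamma> + of_int l)\<^sup>2"
      and F: "\<And>l m t v. F (lattice_point \<alpha> (\<phi> (l, m))) t v =
        (p l + 2 * of_int m) * exp (- (c * (p l + 2 * of_int m)\<^sup>2 * t + d * (\<gamma> + of_int l)\<^sup>2 * v))"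
    for \<phi> :: "int \<times> int \<Rightarrow> int \<times> int" and p :: "int \<Rightarrow> real" and \<beta> \<gamma> c d e e' and F :: "real \<times> real \<Rightarrow> real \<Rightarrow> real \<Rightarrow> real"
  proof -
    obtain C where "C > 0" and C: "\<And>(p :: int \<Rightarrow> real) L J \<gamma> c d t u. (\<And>l. p l - \<beta> \<in> \<int>) \<Longrightarrow> finite J \<Longrightarrow> c \<ge> 1 \<Longrightarrow> d \<ge> 1 \<Longrightarrow> t > 0 \<Longrightarrow> u > 0 \<Longrightarrow>
      \<bar>\<Sum>l\<in>J. \<Sum>m::int | \<bar>p l + 2 * of_int m\<bar> \<le> L l. (p l + 2 * of_int m) * exp (- (c * (p l + 2 * of_int m)\<^sup>2 * t + d * (\<gamma> + of_int l)\<^sup>2 * u))\<bar>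
        \<le> C * \<mu> t * (2 + 8 / sqrt u)"
      using theta_partial_sum_bound[of \<beta>] by blast
    have mem: "\<phi> (l, m) \<in> truncation \<alpha> N \<longleftrightarrow> \<bar>p l + 2 * of_int m\<bar> \<le> sqrt ((4 * real N - e' * (\<gamma> + of_int l)\<^sup>2) / e)" for l m N
    proof -
      have "\<phi> (l, m) \<in> truncation \<alpha> N \<longleftrightarrow> e * (p l + 2 * of_int m)\<^sup>2 \<le> 4 * real N - e' * (\<gamma> + of_int l)\<^sup>2"
        unfolding truncation_def mem_Collect_eq using Q[of l m] by linarith
      then show ?thesis
        by (simp only: square_le_iff_window[OF \<open>e > 0\<close>])
    qed
    have "\<bar>\<Sum>k\<in>truncation \<alpha> N. F (lattice_point \<alpha> k) t v\<bar> \<le> C * \<mu> t * (2 + 8 / sqrt v)" if "t > 0" "v > 0" for N t v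
      by (subst sum_fibres(1)[OF finite_truncation \<phi>], unfold F mem) (intro C p sum_fibres(2)[OF finite_truncation \<phi>] c that)
    then show ?thesis by blast
  qed
  \<comment> \<open>At fixed second coordinate, 2 n1 + n2 advances in steps of 2.\<close>
  show "\<exists>C. \<forall>N t v. t > 0 \<longrightarrow> v > 0 \<longrightarrow>
     \<bar>\<Sum>k\<in>truncation \<alpha> N. term3 (lattice_point \<alpha> k) t v\<bar> \<le> C * \<mu> t * (2 + 8 / sqrt v)"
  proof (rule bound[where \<phi> = "\<lambda>(l, m). (m, l)" and p = "\<lambda>l. 2 * a + b + of_int l" and \<beta> = "2 * a + b" and \<gamma> = b and c = "3 * pi / 2" and d = "pi / 2" and e = 3 and e' = 1])
    show "bij (\<lambda>(l, m). (m, l) :: int \<times> int)"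
      by (rule o_bij[of "\<lambda>(l, m). (m, l)"]) auto
  qed (use pi1 in \<open>simp_all add: term3_def Q_eq lattice_point_def \<alpha> power2_eq_square algebra_simps\<close>)
  \<comment> \<open>At fixed first coordinate, 3 n1 + 2 n2 advances in steps of 2.\<close>
  show "\<exists>C. \<forall>N t v. t > 0 \<longrightarrow> v > 0 \<longrightarrow>
     \<bar>\<Sum>k\<in>truncation \<alpha> N. term4 (lattice_point \<alpha> k) t v\<bar> \<le> C * \<mu> t * (2 + 8 / sqrt v)"
  proof (rule bound[where \<phi> = "\<lambda>k. k" and p = "\<lambda>l. 3 * a + 2 * b + of_int (3 * l)" and \<beta> = "3 * a + 2 * b" and \<gamma> = a and c = "pi / 2" and d = "3 * pi / 2" and e = 1 and e' = 3])
    show "bij (\<lambda>k :: int \<times> int. k)"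
      using bij_id by (simp add: id_def)
  qed (use pi1 in \<open>simp_all add: term4_def Q_eq lattice_point_def \<alpha> power2_eq_square algebra_simps\<close>)
  \<comment> \<open>The numerator of \<open>theta5\<close> is n1, so the slices must fix 3 n1 + 2
    n2. The chosen map gives 3 (l + 2m) + 2 (- l - 3m) = l, while n1 = l + 2m again advances by 2.
    As n1 is paired with v in the exponent, t and v exchange roles.\<close>
  have "\<exists>C. \<forall>N t v. t > 0 \<longrightarrow> v > 0 \<longrightarrow>
     \<bar>\<Sum>k\<in>truncation \<alpha> N. term5 (lattice_point \<alpha> k) v t\<bar> \<le> C * \<mu> t * (2 + 8 / sqrt v)"
  proof (rule bound[where F = "\<lambda>n t v. term5 n v t" and \<phi> = "\<lambda>(l, m). (l + 2 * m, - l - 3 * m)" and p = "\<lambda>l. a + of_int l" and \<beta> = a and \<gamma> = "3 * a + 2 * b" and c = "3 * pi / 2" and d = "pi / 2" and e = 3 and e' = 1])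
    show "bij (\<lambda>(l, m). (l + 2 * m, - l - 3 * m) :: int \<times> int)"
      by (rule o_bij[of "\<lambda>(i, j). (3 * i + 2 * j, - i - j)"]) auto
  qed (use pi1 in \<open>simp_all add: term5_def Q_eq lattice_point_def \<alpha> power2_eq_square algebra_simps\<close>)
  then show "\<exists>C. \<forall>N t v. t > 0 \<longrightarrow> v > 0 \<longrightarrow>
     \<bar>\<Sum>k\<in>truncation \<alpha> N. term5 (lattice_point \<alpha> k) t v\<bar> \<le> C * \<mu> v * (2 + 8 / sqrt t)"
    by blast
qed

section \<open>Truncation in the iterated integral\<close>

lemma weight_measurable [measurable]:
  "(\<lambda>(t, u). weight13 s t (t + u)) \<in> borel_measurable (lborel \<Otimes>\<^sub>M lborel)"
  "(\<lambda>(t, u). weight31 s t (t + u)) \<in> borel_measurable (lborel \<Otimes>\<^sub>M lborel)"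
  unfolding weight13_def weight31_def powr_3_half case_prod_unfold by measurable

text \<open>The denominators give (1 + x)^(-3/2), and 2 + 8 / sqrt y is at most 10 sqrt (1 + x) /
  sqrt x; the product is a multiple of \<mu> x. The power \<kappa>^2 collects the exponents 1/2 and
  3/2.\<close>

lemma weight_bound_aux:
  fixes z z' :: complex
  assumes x: "x > 0" and \<kappa>: "\<kappa> > 0" and z: "norm z \<ge> \<kappa>" and z': "norm z' \<ge> \<kappa> * (1 + x)" and y: "y \<ge> x"
  shows "norm (1 / (csqrt z * z' powr (3 / 2))) * (2 + 8 / sqrt y) \<le> 10 / \<kappa>\<^sup>2 * \<mu> x"
proof -
  have cs: "norm (csqrt w) = sqrt (norm w)" for w
  proof -
    have "(norm (csqrt w))\<^sup>2 = norm w"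
      by (simp flip: norm_power)
    then show ?thesis
      by (metis norm_ge_zero real_sqrt_unique)
  qed
  have "sqrt \<kappa> \<le> norm (csqrt z)"
    using z by (simp add: cs)
  moreover have "\<kappa> * (1 + x) * (sqrt \<kappa> * sqrt (1 + x)) \<le> norm (z' powr (3 / 2))"
    unfolding powr_3_half norm_mult cs real_sqrt_mult[symmetric] using z' \<kappa> x by (intro mult_mono) auto
  ultimately have "sqrt \<kappa> * (\<kappa> * (1 + x) * (sqrt \<kappa> * sqrt (1 + x))) \<le> norm (csqrt z * z' powr (3 / 2))"
    unfolding norm_mult using \<kappa> x by (intro mult_mono) auto
  moreover have "sqrt \<kappa> * (\<kappa> * (1 + x) * (sqrt \<kappa> * sqrt (1 + x))) = \<kappa>\<^sup>2 * ((1 + x) * sqrt (1 + x))"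
  proof -
    have "sqrt \<kappa> * (\<kappa> * (1 + x) * (sqrt \<kappa> * sqrt (1 + x))) = (sqrt \<kappa> * sqrt \<kappa>) * \<kappa> * ((1 + x) * sqrt (1 + x))"
      by (simp only: mult_ac)
    then show ?thesis
      using \<kappa> by (simp add: power2_eq_square)
  qed
  ultimately have le: "\<kappa>\<^sup>2 * ((1 + x) * sqrt (1 + x)) \<le> norm (csqrt z * z' powr (3 / 2))"
    by simp
  moreover have "\<kappa>\<^sup>2 * ((1 + x) * sqrt (1 + x)) > 0"
    using \<kappa> x by simp
  ultimately have "norm (1 / (csqrt z * z' powr (3 / 2))) \<le> 1 / (\<kappa>\<^sup>2 * ((1 + x) * sqrt (1 + x)))"
    unfolding norm_divide norm_one
    by (intro divide_left_mono[OF le] mult_pos_pos[of "norm (csqrt z * z' powr (3 / 2))"]) linarith+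
  moreover have "2 + 8 / sqrt y \<le> 10 * sqrt (1 + x) / sqrt x"
  proof -
    have "2 + 8 / sqrt y \<le> 2 + 8 / sqrt x"
      using x y by (intro add_left_mono divide_left_mono) auto
    also have "\<dots> = (2 * sqrt x + 8 * sqrt 1) / sqrt x"
      using x by (simp add: field_simps)
    also have "\<dots> \<le> (2 * sqrt (1 + x) + 8 * sqrt (1 + x)) / sqrt x"
      using x by (intro divide_right_mono add_mono mult_left_mono) auto
    finally show ?thesis by simp
  qed
  ultimately have "norm (1 / (csqrt z * z' powr (3 / 2))) * (2 + 8 / sqrt y) \<le>
      1 / (\<kappa>\<^sup>2 * ((1 + x) * sqrt (1 + x))) * (10 * sqrt (1 + x) / sqrt x)"
    using x y \<kappa> by (intro mult_mono) auto
  also have "\<dots> = 10 / \<kappa>\<^sup>2 * \<mu> x"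
  proof -
    have "1 / (\<kappa>\<^sup>2 * ((1 + x) * r)) * (10 * r / sqrt x) = 10 / \<kappa>\<^sup>2 * (1 / (sqrt x * (1 + x)))" if "r \<noteq> 0" for r
      using that by (simp add: mult_ac)
    from this[of "sqrt (1 + x)"] show ?thesis
      using x by (simp add: \<mu>_def)
  qed
  finally show ?thesis .
qed

text \<open>In both integrals the exponent 3/2 sits on the variable in which the theta bound is only
  2 + 8 / sqrt, without decay at infinity, and supplies that decay. For \<open>weight13\<close> this
  variable is t + u, which is at least u.\<close>

lemma weight_bounds:
  assumes s: "Re s > 0"
  obtains K where "K > 0"
    "\<And>t u. t > 0 \<Longrightarrow> u > 0 \<Longrightarrow> norm (weight13 s t (t + u)) * (2 + 8 / sqrt (t + u)) \<le> K * \<mu> u"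
    "\<And>t u. t > 0 \<Longrightarrow> u > 0 \<Longrightarrow> norm (weight31 s t (t + u)) * (2 + 8 / sqrt t) \<le> K * \<mu> t"
proof -
  define \<kappa> where "\<kappa> = min 1 (Re s)"
  have \<kappa>: "\<kappa> > 0" "\<kappa> \<le> 1" "\<kappa> \<le> Re s"
    using s by (auto simp: \<kappa>_def)
  have n1: "norm (of_real v + s) \<ge> \<kappa>" if "v > 0" for v
    using complex_Re_le_cmod[of "of_real v + s"] \<kappa> that by simp
  have n2: "norm (of_real v + s) \<ge> \<kappa> * (1 + x)" if "v \<ge> x" "x > 0" for v x
  proof -
    have "\<kappa> * x \<le> 1 * x"
      using \<kappa> that by (intro mult_right_mono) auto
    then have "\<kappa> * (1 + x) \<le> v + Re s"
      using \<kappa> that unfolding distrib_left mult_1_right by linarith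
    then show ?thesis
      using complex_Re_le_cmod[of "of_real v + s"] by simp
  qed
  show ?thesis
  proof (rule that[of "10 / \<kappa>\<^sup>2"])
    fix t u :: real assume "t > 0" "u > 0"
    then show "norm (weight13 s t (t + u)) * (2 + 8 / sqrt (t + u)) \<le> 10 / \<kappa>\<^sup>2 * \<mu> u"
      unfolding weight13_def by (intro weight_bound_aux \<kappa> n1 n2) auto
    show "norm (weight31 s t (t + u)) * (2 + 8 / sqrt t) \<le> 10 / \<kappa>\<^sup>2 * \<mu> t"
      unfolding weight31_def mult.commute[of "(of_real t + s) powr (3 / 2)"]
      using \<open>t > 0\<close> \<open>u > 0\<close> by (intro weight_bound_aux \<kappa> n1 n2) auto
  qed (use \<kappa> in auto)
qed

lemma single_term_bound:
  fixes c x :: real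
  assumes "c > 0"
  shows "\<exists>C\<ge>0. \<forall>t>0. \<bar>x * exp (- (c * x\<^sup>2 * t))\<bar> \<le> C * \<mu> t"
proof (cases "x = 0")
  case False
  define \<kappa> where "\<kappa> = c * x\<^sup>2"
  \<comment> \<open>The minimum with 1 yields 1 + m t \<ge> m (1 + t), which pulls the scale out of
    \<mu>.\<close>
  define m where "m = min 1 \<kappa>"
  have m: "m > 0" "m \<le> 1" "m \<le> \<kappa>"
    using False assms by (auto simp: m_def \<kappa>_def)
  have exp_le: "exp (- y) \<le> 2 * \<mu> y" if y: "y > 0" for y :: real
  proof -
    have "sqrt y \<le> 1 + y"
      using sum_squares_bound[of 1 "sqrt y"] y by simp
    then have "sqrt y * (1 + y) \<le> (1 + y) * (1 + y)"
      using y by (intro mult_right_mono) auto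
    also have "\<dots> \<le> 2 * (1 + y + y\<^sup>2 / 2)"
      by (simp add: power2_eq_square algebra_simps)
    also have "\<dots> \<le> 2 * exp y"
      using exp_ge_quadratic[of y] y by simp
    finally have "2 / (2 * exp y) \<le> 2 / (sqrt y * (1 + y))"
      using y by (intro divide_left_mono mult_pos_pos) auto
    then show ?thesis
      by (simp add: \<mu>_def exp_minus inverse_eq_divide)
  qed
  have \<mu>_scale: "\<mu> (\<kappa> * t) \<le> 1 / (sqrt m * m) * \<mu> t" if t: "t > 0" for t
  proof -
    have "\<mu> (\<kappa> * t) \<le> \<mu> (m * t)"
      using m t by (intro \<mu>_antimono mult_right_mono) auto
    also have "\<dots> = 1 / (sqrt m * sqrt t * (1 + m * t))"
      by (simp add: \<mu>_def real_sqrt_mult)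
    also have "\<dots> \<le> 1 / (sqrt m * sqrt t * (m * (1 + t)))"
      using m t by (intro divide_left_mono mult_left_mono mult_pos_pos) (auto simp: algebra_simps add_pos_pos)
    also have "\<dots> = 1 / (sqrt m * m) * \<mu> t"
      by (simp add: \<mu>_def mult_ac)
    finally show ?thesis .
  qed
  have "\<bar>x * exp (- (c * x\<^sup>2 * t))\<bar> \<le> (\<bar>x\<bar> * (2 * (1 / (sqrt m * m)))) * \<mu> t" if t: "t > 0" for t
  proof -
    have "\<bar>x * exp (- (c * x\<^sup>2 * t))\<bar> = \<bar>x\<bar> * exp (- (\<kappa> * t))"
      by (simp add: abs_mult \<kappa>_def)
    also have "\<dots> \<le> \<bar>x\<bar> * (2 * \<mu> (\<kappa> * t))"
      using m t by (intro mult_left_mono exp_le) auto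
    also have "\<dots> \<le> \<bar>x\<bar> * (2 * (1 / (sqrt m * m) * \<mu> t))"
      using \<mu>_scale[OF t] by (intro mult_left_mono) auto
    finally show ?thesis by (simp only: mult.assoc)
  qed
  then show ?thesis
    using m by (intro exI[of _ "\<bar>x\<bar> * (2 * (1 / (sqrt m * m)))"]) auto
qed auto

text \<open>Bounds without uniformity in n, for exchanging the finite truncated sums with the
  integrals.\<close>

lemma term_bounds:
  shows "\<exists>C\<ge>0. \<forall>t>0. \<forall>v>0. \<bar>term3 n t v\<bar> \<le> C * \<mu> t * (2 + 8 / sqrt v)"
    and "\<exists>C\<ge>0. \<forall>t>0. \<forall>v>0. \<bar>term4 n t v\<bar> \<le> C * \<mu> t * (2 + 8 / sqrt v)"
    and "\<exists>C\<ge>0. \<forall>t>0. \<forall>v>0. \<bar>term5 n t v\<bar> \<le> C * \<mu> v * (2 + 8 / sqrt t)"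
proof -
  have aux: "\<bar>x * exp (- (c * x\<^sup>2 * t + d * y\<^sup>2 * v))\<bar> \<le> C * \<mu> t * (2 + 8 / sqrt v)"
    if "\<bar>x * exp (- (c * x\<^sup>2 * t))\<bar> \<le> C * \<mu> t" "d \<ge> 0" "v > 0" for x c t d y v C :: real
  proof -
    have "\<bar>x * exp (- (c * x\<^sup>2 * t + d * y\<^sup>2 * v))\<bar> = \<bar>x * exp (- (c * x\<^sup>2 * t))\<bar> * exp (- (d * y\<^sup>2 * v))"
      by (simp add: abs_mult mult.assoc flip: exp_add)
    also have "\<dots> \<le> (C * \<mu> t) * (2 + 8 / sqrt v)"
    proof (intro mult_mono)
      have "exp (- (d * y\<^sup>2 * v)) \<le> 1"
        using that by simp
      also have "\<dots> \<le> 2 + 8 / sqrt v"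
        using that by simp
      finally show "exp (- (d * y\<^sup>2 * v)) \<le> 2 + 8 / sqrt v" .
    qed (use that in \<open>auto intro: order_trans[OF abs_ge_zero]\<close>)
    finally show ?thesis .
  qed
  have pos: "3 * pi / 2 > 0" "pi / 2 > 0"
    by simp_all
  show "\<exists>C\<ge>0. \<forall>t>0. \<forall>v>0. \<bar>term3 n t v\<bar> \<le> C * \<mu> t * (2 + 8 / sqrt v)"
    using single_term_bound[OF pos(1), of "2 * fst n + snd n"] pos unfolding term3_def
    by (meson aux less_imp_le)
  show "\<exists>C\<ge>0. \<forall>t>0. \<forall>v>0. \<bar>term4 n t v\<bar> \<le> C * \<mu> t * (2 + 8 / sqrt v)"
    using single_term_bound[OF pos(2), of "3 * fst n + 2 * snd n"] pos unfolding term4_def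
    by (meson aux less_imp_le)
  show "\<exists>C\<ge>0. \<forall>t>0. \<forall>v>0. \<bar>term5 n t v\<bar> \<le> C * \<mu> v * (2 + 8 / sqrt t)"
    using single_term_bound[OF pos(1), of "fst n"] pos unfolding term5_def add.commute[of "pi / 2 * _ * _"]
    by (meson aux less_imp_le)
qed

section \<open>Pointwise convergence of the truncated theta series\<close>

lemma exp_Q_bound:
  fixes \<rho> :: real
  assumes \<rho>: "\<rho> > 0"
  obtains C where "C \<ge> 0" "\<And>a b. (1 + a\<^sup>2) * (1 + b\<^sup>2) * exp (- (\<rho> * (a\<^sup>2 + b\<^sup>2))) \<le> C * (1 / (1 + a\<^sup>2) * (1 / (1 + b\<^sup>2)))"
proof -
  define C where "C = 2 + 4 / \<rho>\<^sup>2"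
  have C: "C \<ge> 2"
    by (simp add: C_def)
  have one: "(1 + x\<^sup>2) * exp (- (\<rho> * x\<^sup>2)) \<le> C * (1 / (1 + x\<^sup>2))" for x :: real
  proof -
    have "(1 + x\<^sup>2) * (1 + x\<^sup>2) \<le> 2 + 2 * (x\<^sup>2)\<^sup>2"
      using sum_squares_bound[of 1 "x\<^sup>2"] by (simp add: power2_eq_square algebra_simps)
    also have "\<dots> = 2 + 4 / \<rho>\<^sup>2 * ((\<rho> * x\<^sup>2)\<^sup>2 / 2)"
      using \<rho> by (simp add: power_mult_distrib)
    also have "\<dots> \<le> C * (1 + \<rho> * x\<^sup>2 + (\<rho> * x\<^sup>2)\<^sup>2 / 2)"
    proof -
      define z where "z = \<rho> * x\<^sup>2"
      have z: "z \<ge> 0" using \<rho> by (simp add: z_def)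
      have "2 * 1 \<le> C * (1 + z)" using C z by (intro mult_mono) auto
      moreover have "4 / \<rho>\<^sup>2 * (z\<^sup>2 / 2) \<le> C * (z\<^sup>2 / 2)"
        by (intro mult_right_mono) (auto simp: C_def)
      ultimately show ?thesis
        unfolding z_def[symmetric] by (simp add: distrib_left)
    qed
    also have "\<dots> \<le> C * exp (\<rho> * x\<^sup>2)"
      using C exp_ge_quadratic[of "\<rho> * x\<^sup>2"] \<rho> by (intro mult_left_mono) auto
    finally have "(1 + x\<^sup>2) * (1 + x\<^sup>2) \<le> C * exp (\<rho> * x\<^sup>2)" .
    moreover have "1 + x\<^sup>2 > 0"
      by (simp add: add_pos_nonneg)
    ultimately show ?thesis
      by (simp add: exp_minus field_simps)
  qed
  show ?thesis
  proof (rule that[of "C * C"])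
    fix a b :: real
    have "(1 + a\<^sup>2) * (1 + b\<^sup>2) * exp (- (\<rho> * (a\<^sup>2 + b\<^sup>2))) = ((1 + a\<^sup>2) * exp (- (\<rho> * a\<^sup>2))) * ((1 + b\<^sup>2) * exp (- (\<rho> * b\<^sup>2)))"
      by (simp add: distrib_left exp_diff exp_minus field_simps)
    also have "\<dots> \<le> (C * (1 / (1 + a\<^sup>2))) * (C * (1 / (1 + b\<^sup>2)))"
      using C by (intro mult_mono one) auto
    finally show "(1 + a\<^sup>2) * (1 + b\<^sup>2) * exp (- (\<rho> * (a\<^sup>2 + b\<^sup>2))) \<le> C * C * (1 / (1 + a\<^sup>2) * (1 / (1 + b\<^sup>2)))"
      by (simp add: mult_ac)
  qed (use C in auto)
qed

text \<open>The bound on g uses the exponent with v lowered to t, where the two diagonal squares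
  combine to 2 \<pi> Q t and \<open>Q_lower\<close> applies.\<close>

lemma theta_series_limit:
  fixes g :: "real \<times> real \<Rightarrow> real"
  assumes t: "t > 0" and v: "v \<ge> t"
    and g: "\<And>a b. \<bar>g (a, b)\<bar> \<le> 5 * ((1 + a\<^sup>2) * (1 + b\<^sup>2)) * exp (- (2 * pi * Q (a, b) * t))"
  shows "(\<lambda>N. \<Sum>k\<in>truncation \<alpha> N. of_real (g (lattice_point \<alpha> k))) \<longlonglongrightarrow>
    infsum (\<lambda>n. complex_of_real (g n)) (shifted_lattice \<alpha>)"
proof -
  have "pi * t / 3 > 0"
    using t by simp
  then obtain C where C: "C \<ge> 0" "\<And>a b. (1 + a\<^sup>2) * (1 + b\<^sup>2) * exp (- (pi * t / 3 * (a\<^sup>2 + b\<^sup>2))) \<le> C * (1 / (1 + a\<^sup>2) * (1 / (1 + b\<^sup>2)))"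
    using exp_Q_bound by blast
  show ?thesis
  proof (rule lattice_sum_limit)
    fix a b :: real
    have "2 * pi * t * ((a\<^sup>2 + b\<^sup>2) / 6) \<le> 2 * pi * t * Q (a, b)"
      using t by (intro mult_left_mono Q_lower) auto
    moreover have "2 * pi * t * ((a\<^sup>2 + b\<^sup>2) / 6) = pi * t / 3 * (a\<^sup>2 + b\<^sup>2)"
      by simp
    moreover have "2 * pi * t * Q (a, b) = 2 * pi * Q (a, b) * t"
      by simp
    ultimately have "exp (- (2 * pi * Q (a, b) * t)) \<le> exp (- (pi * t / 3 * (a\<^sup>2 + b\<^sup>2)))"
      by (simp only: exp_le_cancel_iff neg_le_iff_le)
    then have "5 * ((1 + a\<^sup>2) * (1 + b\<^sup>2)) * exp (- (2 * pi * Q (a, b) * t)) \<le> 5 * ((1 + a\<^sup>2) * (1 + b\<^sup>2)) * exp (- (pi * t / 3 * (a\<^sup>2 + b\<^sup>2)))"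
      by (intro mult_left_mono) auto
    also have "\<dots> \<le> 5 * (C * (1 / (1 + a\<^sup>2) * (1 / (1 + b\<^sup>2))))"
      using C(2)[of a b] by (simp add: mult.assoc)
    finally show "norm (complex_of_real (g (a, b))) \<le> 5 * C * (1 / (1 + a\<^sup>2) * (1 / (1 + b\<^sup>2)))"
      using g[of a b] by simp
  qed
qed

text \<open>The common constant 5 = 3 + 2 is the largest sum of coefficients among the three
  numerators.\<close>

lemma linear_form_bounds:
  fixes a b :: real
  shows "\<bar>2 * a + b\<bar> \<le> 5 * ((1 + a\<^sup>2) * (1 + b\<^sup>2))" "\<bar>3 * a + 2 * b\<bar> \<le> 5 * ((1 + a\<^sup>2) * (1 + b\<^sup>2))"
    "\<bar>a\<bar> \<le> 5 * ((1 + a\<^sup>2) * (1 + b\<^sup>2))"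
proof -
  have lin: "\<bar>x\<bar> \<le> 1 + x\<^sup>2" for x :: real
    using sum_squares_bound[of 1 "\<bar>x\<bar>"] by simp
  have "1 + a\<^sup>2 \<le> (1 + a\<^sup>2) * (1 + b\<^sup>2)" "1 + b\<^sup>2 \<le> (1 + a\<^sup>2) * (1 + b\<^sup>2)"
    by (simp_all add: algebra_simps)
  then have "\<bar>a\<bar> \<le> (1 + a\<^sup>2) * (1 + b\<^sup>2)" "\<bar>b\<bar> \<le> (1 + a\<^sup>2) * (1 + b\<^sup>2)"
    using lin[of a] lin[of b] by linarith+
  then show "\<bar>2 * a + b\<bar> \<le> 5 * ((1 + a\<^sup>2) * (1 + b\<^sup>2))" "\<bar>3 * a + 2 * b\<bar> \<le> 5 * ((1 + a\<^sup>2) * (1 + b\<^sup>2))"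
    "\<bar>a\<bar> \<le> 5 * ((1 + a\<^sup>2) * (1 + b\<^sup>2))"
    by linarith+
qed

lemma theta_limits:
  assumes t: "t > 0" and u: "u > 0"
  shows "(\<lambda>N. \<Sum>k\<in>truncation \<alpha> N. of_real (term3 (lattice_point \<alpha> k) t (t + u))) \<longlonglongrightarrow> theta3 \<alpha> (\<i> * of_real t, \<i> * of_real t + \<i> * of_real u)"
    and "(\<lambda>N. \<Sum>k\<in>truncation \<alpha> N. of_real (term4 (lattice_point \<alpha> k) t (t + u))) \<longlonglongrightarrow> theta4 \<alpha> (\<i> * of_real t, \<i> * of_real t + \<i> * of_real u)"
    and "(\<lambda>N. \<Sum>k\<in>truncation \<alpha> N. of_real (term5 (lattice_point \<alpha> k) t (t + u))) \<longlonglongrightarrow> theta5 \<alpha> (\<i> * of_real t, \<i> * of_real t + \<i> * of_real u)"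
proof -
  have tu: "t + u \<ge> t"
    using u by simp
  have e3: "of_real 3 * of_real pi * \<i> / 2 * of_real x * (\<i> * of_real t) + of_real pi * \<i> * of_real y * (\<i> * of_real t + \<i> * of_real u) / 2
      = complex_of_real (- (3 * pi / 2 * x * t + pi / 2 * y * (t + u)))" for x y
    by (simp add: complex_eq_iff field_simps)
  have e45: "of_real pi * \<i> / 2 * of_real x * (\<i> * of_real t) + of_real 3 * of_real pi * \<i> * of_real y * (\<i> * of_real t + \<i> * of_real u) / 2
      = complex_of_real (- (pi / 2 * x * t + 3 * pi / 2 * y * (t + u)))" for x y
    by (simp add: complex_eq_iff field_simps)
  have Q1: "2 * pi * Q (a, b) * t \<le> 3 * pi / 2 * (2 * a + b)\<^sup>2 * t + pi / 2 * b\<^sup>2 * (t + u)" for a b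
  proof -
    have "3 * pi / 2 * (2 * a + b)\<^sup>2 * t + pi / 2 * b\<^sup>2 * (t + u) = 2 * pi * Q (a, b) * t + pi / 2 * b\<^sup>2 * u"
      by (simp add: Q_eq power2_eq_square field_simps)
    then show ?thesis
      using u by simp
  qed
  have Q2: "2 * pi * Q (a, b) * t \<le> pi / 2 * (3 * a + 2 * b)\<^sup>2 * t + 3 * pi / 2 * a\<^sup>2 * (t + u)" for a b
  proof -
    have "pi / 2 * (3 * a + 2 * b)\<^sup>2 * t + 3 * pi / 2 * a\<^sup>2 * (t + u) = 2 * pi * Q (a, b) * t + 3 * pi / 2 * a\<^sup>2 * u"
      by (simp add: Q_eq power2_eq_square field_simps)
    then show ?thesis
      using u by simp
  qed
  have "(\<lambda>N. \<Sum>k\<in>truncation \<alpha> N. of_real (term3 (lattice_point \<alpha> k) t (t + u))) \<longlonglongrightarrow>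
      infsum (\<lambda>n. complex_of_real (term3 n t (t + u))) (shifted_lattice \<alpha>)"
    by (rule theta_series_limit[OF t tu])
      (unfold term3_def fst_conv snd_conv abs_mult abs_exp_cancel, (rule mult_mono, rule linear_form_bounds), use Q1 in \<open>simp_all only: exp_le_cancel_iff neg_le_iff_le abs_ge_zero exp_ge_zero\<close>, simp)
  also have "infsum (\<lambda>n. complex_of_real (term3 n t (t + u))) (shifted_lattice \<alpha>) = theta3 \<alpha> (\<i> * of_real t, \<i> * of_real t + \<i> * of_real u)"
    unfolding theta3_def prod.case
    by (intro infsum_cong) (simp only: term3_def case_prod_unfold e3 exp_of_real of_real_mult)
  finally show "(\<lambda>N. \<Sum>k\<in>truncation \<alpha> N. of_real (term3 (lattice_point \<alpha> k) t (t + u))) \<longlonglongrightarrow> theta3 \<alpha> (\<i> * of_real t, \<i> * of_real t + \<i> * of_real u)" .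
  have "(\<lambda>N. \<Sum>k\<in>truncation \<alpha> N. of_real (term4 (lattice_point \<alpha> k) t (t + u))) \<longlonglongrightarrow>
      infsum (\<lambda>n. complex_of_real (term4 n t (t + u))) (shifted_lattice \<alpha>)"
    by (rule theta_series_limit[OF t tu])
      (unfold term4_def fst_conv snd_conv abs_mult abs_exp_cancel, (rule mult_mono, rule linear_form_bounds), use Q2 in \<open>simp_all only: exp_le_cancel_iff neg_le_iff_le abs_ge_zero exp_ge_zero\<close>, simp)
  also have "infsum (\<lambda>n. complex_of_real (term4 n t (t + u))) (shifted_lattice \<alpha>) = theta4 \<alpha> (\<i> * of_real t, \<i> * of_real t + \<i> * of_real u)"
    unfolding theta4_def prod.case
    by (intro infsum_cong) (simp only: term4_def case_prod_unfold e45 exp_of_real of_real_mult)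
  finally show "(\<lambda>N. \<Sum>k\<in>truncation \<alpha> N. of_real (term4 (lattice_point \<alpha> k) t (t + u))) \<longlonglongrightarrow> theta4 \<alpha> (\<i> * of_real t, \<i> * of_real t + \<i> * of_real u)" .
  have "(\<lambda>N. \<Sum>k\<in>truncation \<alpha> N. of_real (term5 (lattice_point \<alpha> k) t (t + u))) \<longlonglongrightarrow>
      infsum (\<lambda>n. complex_of_real (term5 n t (t + u))) (shifted_lattice \<alpha>)"
    by (rule theta_series_limit[OF t tu])
      (unfold term5_def fst_conv snd_conv abs_mult abs_exp_cancel, (rule mult_mono, rule linear_form_bounds), use Q2 in \<open>simp_all only: exp_le_cancel_iff neg_le_iff_le abs_ge_zero exp_ge_zero\<close>, simp)
  also have "infsum (\<lambda>n. complex_of_real (term5 n t (t + u))) (shifted_lattice \<alpha>) = theta5 \<alpha> (\<i> * of_real t, \<i> * of_real t + \<i> * of_real u)"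
    unfolding theta5_def prod.case
    by (intro infsum_cong) (simp only: term5_def case_prod_unfold e45 exp_of_real of_real_mult)
  finally show "(\<lambda>N. \<Sum>k\<in>truncation \<alpha> N. of_real (term5 (lattice_point \<alpha> k) t (t + u))) \<longlonglongrightarrow> theta5 \<alpha> (\<i> * of_real t, \<i> * of_real t + \<i> * of_real u)" .
qed

text \<open>Each of the two vertical paths contributes a factor i, whence the sign.\<close>

lemma H2_eq:
  "H2 \<alpha> \<tau> = - (of_real (sqrt 3) * \<i> / (2 * pi)) *
     ((LBINT t:{0<..}. LBINT u:{0<..}. (2 * theta3 \<alpha> (\<i> * of_real t, \<i> * of_real t + \<i> * of_real u)
         - theta4 \<alpha> (\<i> * of_real t, \<i> * of_real t + \<i> * of_real u)) * weight13 (- \<i> * \<tau>) t (t + u))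
    + (LBINT t:{0<..}. LBINT u:{0<..}. theta5 \<alpha> (\<i> * of_real t, \<i> * of_real t + \<i> * of_real u) * weight31 (- \<i> * \<tau>) t (t + u)))"
proof -
  have "- \<i> * (\<i> * of_real t + \<tau>) = of_real t + - \<i> * \<tau>"
    "- \<i> * (\<i> * of_real t + \<i> * of_real u + \<tau>) = of_real (t + u) + - \<i> * \<tau>" for t u
    by (simp_all add: algebra_simps)
  note eqs = this
  have pull: "\<i> * (LBINT t:{0<..}. \<i> * g t) = - (LBINT t:{0<..}. g t)" for g :: "real \<Rightarrow> complex"
    by (simp only: set_integral_mult_right) simp
  show ?thesis
    unfolding H2_def vertical_integral_def weight13_def weight31_def add_0 eqs pull
    by (simp add: distrib_left)
qed

text \<open>Both iterated integrals are dominated by a multiple of \<mu> t \<mu> u, one factor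
  coming from the theta sums and the other from the weights. The constant is the prefactor - sqrt 3
  i / (2 \<pi>) times 4 / (sqrt 3 \<pi>) from \<open>lattice_term_integral\<close>.\<close>

lemma H2_truncation_limit:
  assumes s: "Re s > 0" and \<tau>: "s = - \<i> * \<tau>"
  shows "(\<lambda>N. \<Sum>k\<in>truncation \<alpha> N. - (2 * \<i> / of_real (pi\<^sup>2)) * (LBINT w. of_real (summand (lattice_point \<alpha> k) w) * gauss s w))
     \<longlonglongrightarrow> H2 \<alpha> \<tau>"
proof -
  let ?l = "lattice_point \<alpha>"
  obtain K where K: "K > 0"
    "\<And>t u. t > 0 \<Longrightarrow> u > 0 \<Longrightarrow> norm (weight13 s t (t + u)) * (2 + 8 / sqrt (t + u)) \<le> K * \<mu> u"
    "\<And>t u. t > 0 \<Longrightarrow> u > 0 \<Longrightarrow> norm (weight31 s t (t + u)) * (2 + 8 / sqrt t) \<le> K * \<mu> t"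
    using weight_bounds[OF s] by blast
  have w13: "norm (of_real x * weight13 s t (t + u)) \<le> C * K * (\<mu> t * \<mu> u)"
    if "\<bar>x\<bar> \<le> C * \<mu> t * (2 + 8 / sqrt (t + u))" "t > 0" "u > 0" "C \<ge> 0" for x C t u
  proof -
    have "norm (of_real x * weight13 s t (t + u)) \<le> C * \<mu> t * (2 + 8 / sqrt (t + u)) * norm (weight13 s t (t + u))"
      using that by (simp add: norm_mult mult_right_mono)
    also have "\<dots> = C * \<mu> t * (norm (weight13 s t (t + u)) * (2 + 8 / sqrt (t + u)))"
      by (simp only: mult_ac)
    also have "\<dots> \<le> C * \<mu> t * (K * \<mu> u)"
      using that \<mu>_nonneg by (intro mult_left_mono K) auto
    finally show ?thesis by (simp only: mult_ac)
  qed
  have w31: "norm (of_real x * weight31 s t (t + u)) \<le> C * K * (\<mu> t * \<mu> u)"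
    if "\<bar>x\<bar> \<le> C * \<mu> (t + u) * (2 + 8 / sqrt t)" "t > 0" "u > 0" "C \<ge> 0" for x C t u
  proof -
    have "norm (of_real x * weight31 s t (t + u)) \<le> C * \<mu> (t + u) * (2 + 8 / sqrt t) * norm (weight31 s t (t + u))"
      using that by (simp add: norm_mult mult_right_mono)
    also have "\<dots> = C * \<mu> (t + u) * (norm (weight31 s t (t + u)) * (2 + 8 / sqrt t))"
      by (simp only: mult_ac)
    also have "\<dots> \<le> C * \<mu> u * (K * \<mu> t)"
      using that \<mu>_nonneg by (intro mult_mono K mult_left_mono \<mu>_antimono) auto
    finally show ?thesis by (simp only: mult_ac)
  qed
  \<comment> \<open>A Boolean tag merges the \<open>theta3\<close> and \<open>theta4\<close> terms
    into one finite sum, because H2 contains the integral of the combined numerator.\<close>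
  define T :: "nat \<Rightarrow> (bool \<times> int \<times> int) set" where "T N = UNIV \<times> truncation \<alpha> N" for N
  define x :: "bool \<times> int \<times> int \<Rightarrow> real \<Rightarrow> real \<Rightarrow> real" where
    "x = (\<lambda>(c, k) t v. if c then 2 * term3 (?l k) t v else - term4 (?l k) t v)"
  have xsum: "(\<Sum>i\<in>T N. x i t v) = 2 * (\<Sum>k\<in>truncation \<alpha> N. term3 (?l k) t v) - (\<Sum>k\<in>truncation \<alpha> N. term4 (?l k) t v)" for N t v
    unfolding T_def sum.cartesian_product' by (simp add: UNIV_bool x_def sum_negf sum_distrib_left)
  have [measurable]: "(\<lambda>(t, u). x i t (t + u)) \<in> borel_measurable (lborel \<Otimes>\<^sub>M lborel)" for i
    using term_measurable(1,2)[of "?l (snd i)"] by (cases i; cases "fst i") (auto simp: x_def case_prod_unfold)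
  have xb: "\<exists>C\<ge>0. \<forall>t>0. \<forall>v>0. \<bar>x i t v\<bar> \<le> C * \<mu> t * (2 + 8 / sqrt v)" for i
  proof (cases "fst i")
    case True
    obtain C where C: "C \<ge> 0" "\<forall>t>0. \<forall>v>0. \<bar>term3 (?l (snd i)) t v\<bar> \<le> C * \<mu> t * (2 + 8 / sqrt v)"
      using term_bounds(1) by blast
    then have "\<forall>t>0. \<forall>v>0. \<bar>x i t v\<bar> \<le> 2 * C * \<mu> t * (2 + 8 / sqrt v)"
      using True by (auto simp: x_def case_prod_unfold abs_mult mult.assoc)
    then show ?thesis
      using C(1) by (intro exI[of _ "2 * C"]) simp
  next
    case False
    then show ?thesis
      using term_bounds(2)[of "?l (snd i)"] by (simp add: x_def case_prod_unfold)
  qed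
  obtain C3 C4 C5 where C: 
    "\<forall>N t v. t > 0 \<longrightarrow> v > 0 \<longrightarrow> \<bar>\<Sum>k\<in>truncation \<alpha> N. term3 (?l k) t v\<bar> \<le> C3 * \<mu> t * (2 + 8 / sqrt v)"
    "\<forall>N t v. t > 0 \<longrightarrow> v > 0 \<longrightarrow> \<bar>\<Sum>k\<in>truncation \<alpha> N. term4 (?l k) t v\<bar> \<le> C4 * \<mu> t * (2 + 8 / sqrt v)"
    "\<forall>N t v. t > 0 \<longrightarrow> v > 0 \<longrightarrow> \<bar>\<Sum>k\<in>truncation \<alpha> N. term5 (?l k) t v\<bar> \<le> C5 * \<mu> v * (2 + 8 / sqrt t)"
    using truncation_sum_bounds[of \<alpha>] by blast
  have enlarge: "C * \<mu> t * (2 + 8 / sqrt v) \<le> \<bar>C\<bar> * \<mu> t * (2 + 8 / sqrt v)" if "t > 0" "v > 0" for C t v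
    using that \<mu>_nonneg by (intro mult_right_mono) auto
  have L1: "(\<lambda>N. LBINT t:{0<..}. LBINT u:{0<..}. (\<Sum>i\<in>T N. of_real (x i t (t + u)) * weight13 s t (t + u))) \<longlonglongrightarrow>
     (LBINT t:{0<..}. LBINT u:{0<..}. (2 * theta3 \<alpha> (\<i> * of_real t, \<i> * of_real t + \<i> * of_real u)
         - theta4 \<alpha> (\<i> * of_real t, \<i> * of_real t + \<i> * of_real u)) * weight13 s t (t + u))"
  proof (rule iterated_integral_limit)
    show "(\<lambda>(t, u). \<Sum>i\<in>T N. of_real (x i t (t + u)) * weight13 s t (t + u)) \<in> borel_measurable (lborel \<Otimes>\<^sub>M lborel)" for N
      by measurable
    fix t u :: real assume tu: "t > 0" "u > 0"
    show "norm (\<Sum>i\<in>T N. of_real (x i t (t + u)) * weight13 s t (t + u)) \<le> (2 * \<bar>C3\<bar> + \<bar>C4\<bar>) * K * (\<mu> t * \<mu> u)" for N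
    proof -
      have "\<bar>\<Sum>i\<in>T N. x i t (t + u)\<bar> \<le> 2 * (\<bar>C3\<bar> * \<mu> t * (2 + 8 / sqrt (t + u))) + \<bar>C4\<bar> * \<mu> t * (2 + 8 / sqrt (t + u))"
      proof -
        have "t + u > 0" using tu by simp
        then have "\<bar>\<Sum>k\<in>truncation \<alpha> N. term3 (?l k) t (t + u)\<bar> \<le> \<bar>C3\<bar> * \<mu> t * (2 + 8 / sqrt (t + u))"
          "\<bar>\<Sum>k\<in>truncation \<alpha> N. term4 (?l k) t (t + u)\<bar> \<le> \<bar>C4\<bar> * \<mu> t * (2 + 8 / sqrt (t + u))"
          using C(1,2) tu by (auto intro: order_trans[OF _ enlarge])
        then show ?thesis
          unfolding xsum by linarith
      qed
      also have "\<dots> = (2 * \<bar>C3\<bar> + \<bar>C4\<bar>) * \<mu> t * (2 + 8 / sqrt (t + u))"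
        by (simp add: algebra_simps)
      finally show ?thesis
        using w13[of "\<Sum>i\<in>T N. x i t (t + u)"] tu by (simp add: sum_distrib_right)
    qed
    have "(\<lambda>N. (2 * (\<Sum>k\<in>truncation \<alpha> N. of_real (term3 (?l k) t (t + u))) - (\<Sum>k\<in>truncation \<alpha> N. of_real (term4 (?l k) t (t + u)))) * weight13 s t (t + u)) \<longlonglongrightarrow>
       (2 * theta3 \<alpha> (\<i> * of_real t, \<i> * of_real t + \<i> * of_real u)
         - theta4 \<alpha> (\<i> * of_real t, \<i> * of_real t + \<i> * of_real u)) * weight13 s t (t + u)"
      by (intro tendsto_intros theta_limits tu)
    moreover have "(2 * (\<Sum>k\<in>truncation \<alpha> N. of_real (term3 (?l k) t (t + u))) - (\<Sum>k\<in>truncation \<alpha> N. of_real (term4 (?l k) t (t + u)))) * weight13 s t (t + u)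
       = (\<Sum>i\<in>T N. of_real (x i t (t + u)) * weight13 s t (t + u))" for N
    proof -
      have "(\<Sum>i\<in>T N. of_real (x i t (t + u)) * weight13 s t (t + u)) = of_real (\<Sum>i\<in>T N. x i t (t + u)) * weight13 s t (t + u)"
        by (simp add: sum_distrib_right)
      then show ?thesis
        unfolding xsum by simp
    qed
    ultimately show "(\<lambda>N. \<Sum>i\<in>T N. of_real (x i t (t + u)) * weight13 s t (t + u)) \<longlonglongrightarrow> (2 * theta3 \<alpha> (\<i> * of_real t, \<i> * of_real t + \<i> * of_real u)
         - theta4 \<alpha> (\<i> * of_real t, \<i> * of_real t + \<i> * of_real u)) * weight13 s t (t + u)"
      by simp
  qed
  have L2: "(\<lambda>N. LBINT t:{0<..}. LBINT u:{0<..}. (\<Sum>k\<in>truncation \<alpha> N. of_real (term5 (?l k) t (t + u)) * weight31 s t (t + u))) \<longlonglongrightarrow>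
     (LBINT t:{0<..}. LBINT u:{0<..}. theta5 \<alpha> (\<i> * of_real t, \<i> * of_real t + \<i> * of_real u) * weight31 s t (t + u))"
  proof (rule iterated_integral_limit)
    show "(\<lambda>(t, u). \<Sum>k\<in>truncation \<alpha> N. of_real (term5 (?l k) t (t + u)) * weight31 s t (t + u)) \<in> borel_measurable (lborel \<Otimes>\<^sub>M lborel)" for N
      by measurable
    fix t u :: real assume tu: "t > 0" "u > 0"
    show "norm (\<Sum>k\<in>truncation \<alpha> N. of_real (term5 (?l k) t (t + u)) * weight31 s t (t + u)) \<le> \<bar>C5\<bar> * K * (\<mu> t * \<mu> u)" for N
    proof -
      have "\<bar>\<Sum>k\<in>truncation \<alpha> N. term5 (?l k) t (t + u)\<bar> \<le> C5 * \<mu> (t + u) * (2 + 8 / sqrt t)"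
        using C(3) tu by simp
      also have "\<dots> \<le> \<bar>C5\<bar> * \<mu> (t + u) * (2 + 8 / sqrt t)"
        using enlarge[of "t + u" t C5] tu by simp
      finally show ?thesis
        using w31[of "\<Sum>k\<in>truncation \<alpha> N. term5 (?l k) t (t + u)"] tu by (simp add: sum_distrib_right)
    qed
    show "(\<lambda>N. \<Sum>k\<in>truncation \<alpha> N. of_real (term5 (?l k) t (t + u)) * weight31 s t (t + u)) \<longlonglongrightarrow>
        theta5 \<alpha> (\<i> * of_real t, \<i> * of_real t + \<i> * of_real u) * weight31 s t (t + u)"
      unfolding sum_distrib_right[symmetric] by (intro tendsto_intros theta_limits tu)
  qed
  have S1: "wedge_integral (\<lambda>t v. \<Sum>i\<in>T N. of_real (x i t v) * weight13 s t v) =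
      (\<Sum>i\<in>T N. wedge_integral (\<lambda>t v. of_real (x i t v) * weight13 s t v))" for N
  proof -
    have "\<forall>i. \<exists>C\<ge>0. \<forall>t>0. \<forall>v>0. \<bar>x i t v\<bar> \<le> C * \<mu> t * (2 + 8 / sqrt v)"
      using xb by blast
    from choice[OF this] obtain Cx where Cx: "\<And>i. Cx i \<ge> 0 \<and> (\<forall>t>0. \<forall>v>0. \<bar>x i t v\<bar> \<le> Cx i * \<mu> t * (2 + 8 / sqrt v))"
      by blast
    show ?thesis
    proof (rule iterated_integral_sum)
      show "norm (of_real (x i t (t + u)) * weight13 s t (t + u)) \<le> Cx i * K * (\<mu> t * \<mu> u)" if "t > 0" "u > 0" for i t u
        using that Cx[of i] by (intro w13) auto
    qed measurable
  qed
  have S2: "wedge_integral (\<lambda>t v. \<Sum>k\<in>truncation \<alpha> N. of_real (term5 (?l k) t v) * weight31 s t v) =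
      (\<Sum>k\<in>truncation \<alpha> N. wedge_integral (\<lambda>t v. of_real (term5 (?l k) t v) * weight31 s t v))" for N
  proof -
    have "\<forall>k. \<exists>C\<ge>0. \<forall>t>0. \<forall>v>0. \<bar>term5 (?l k) t v\<bar> \<le> C * \<mu> v * (2 + 8 / sqrt t)"
      using term_bounds(3) by blast
    from choice[OF this] obtain Cx where Cx: "\<And>k. Cx k \<ge> 0 \<and> (\<forall>t>0. \<forall>v>0. \<bar>term5 (?l k) t v\<bar> \<le> Cx k * \<mu> v * (2 + 8 / sqrt t))"
      by blast
    show ?thesis
    proof (rule iterated_integral_sum)
      show "norm (of_real (term5 (?l k) t (t + u)) * weight31 s t (t + u)) \<le> Cx k * K * (\<mu> t * \<mu> u)" if "t > 0" "u > 0" for k t u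
        using that Cx[of k] by (intro w31) auto
    qed measurable
  qed
  let ?c = "- (of_real (sqrt 3) * \<i> / (2 * pi))"
  have "(\<lambda>N. ?c * ((\<Sum>i\<in>T N. wedge_integral (\<lambda>t v. of_real (x i t v) * weight13 s t v)) +
      (\<Sum>k\<in>truncation \<alpha> N. wedge_integral (\<lambda>t v. of_real (term5 (?l k) t v) * weight31 s t v)))) \<longlonglongrightarrow> H2 \<alpha> \<tau>"
    unfolding H2_eq \<tau>[symmetric] using L1 L2 unfolding S1 S2 by (intro tendsto_intros)
  moreover have "?c * ((\<Sum>i\<in>T N. wedge_integral (\<lambda>t v. of_real (x i t v) * weight13 s t v)) +
      (\<Sum>k\<in>truncation \<alpha> N. wedge_integral (\<lambda>t v. of_real (term5 (?l k) t v) * weight31 s t v))) =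
      (\<Sum>k\<in>truncation \<alpha> N. - (2 * \<i> / of_real (pi\<^sup>2)) * (LBINT w. of_real (summand (?l k) w) * gauss s w))" for N
  proof -
    let ?I3 = "\<lambda>k. wedge_integral (\<lambda>t v. of_real (term3 (?l k) t v) * weight13 s t v)"
    let ?I4 = "\<lambda>k. wedge_integral (\<lambda>t v. of_real (term4 (?l k) t v) * weight13 s t v)"
    let ?I5 = "\<lambda>k. wedge_integral (\<lambda>t v. of_real (term5 (?l k) t v) * weight31 s t v)"
    have "wedge_integral (\<lambda>t v. of_real (x (True, k) t v) * weight13 s t v) = 2 * ?I3 k" for k
    proof -
      have "of_real (x (True, k) t (t + u)) * weight13 s t (t + u) = 2 * (of_real (term3 (?l k) t (t + u)) * weight13 s t (t + u))" for t u
        by (simp add: x_def)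
      then show ?thesis
        by (simp only: set_integral_mult_right)
    qed
    moreover have "wedge_integral (\<lambda>t v. of_real (x (False, k) t v) * weight13 s t v) = (- 1) * ?I4 k" for k
    proof -
      have "of_real (x (False, k) t (t + u)) * weight13 s t (t + u) = (- 1) * (of_real (term4 (?l k) t (t + u)) * weight13 s t (t + u))" for t u
        by (simp add: x_def)
      then show ?thesis
        by (simp only: set_integral_mult_right)
    qed
    ultimately have sumT: "(\<Sum>i\<in>T N. wedge_integral (\<lambda>t v. of_real (x i t v) * weight13 s t v)) =
        (\<Sum>k\<in>truncation \<alpha> N. 2 * ?I3 k - ?I4 k)"
      unfolding T_def sum.cartesian_product' by (simp add: UNIV_bool sum_subtractf sum_negf)
    have each: "?c * (2 * ?I3 k - ?I4 k + ?I5 k) = - (2 * \<i> / of_real (pi\<^sup>2)) * (LBINT w. of_real (summand (?l k) w) * gauss s w)" for k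
    proof -
      have "2 * ?I3 k - ?I4 k + ?I5 k = of_real (4 / (sqrt 3 * pi)) * (LBINT w. of_real (summand (?l k) w) * gauss s w)"
        using lattice_term_integral(2)[OF s, of "fst (?l k)" "snd (?l k)"]
        by (simp only: prod.collapse)
      moreover have "?c * of_real (4 / (sqrt 3 * pi)) = - (2 * \<i> / of_real (pi\<^sup>2))"
        by (simp add: power2_eq_square field_simps)
      ultimately show ?thesis
        by (simp only: mult.assoc[symmetric])
    qed
    show ?thesis
      unfolding sumT by (simp only: sum.distrib[symmetric] sum_distrib_left each)
  qed
  ultimately show ?thesis
    by simp
qed

section \<open>Truncation in the plane integral\<close>

text \<open>Outer weights are absolutely summable, inner sums are conditionally convergent over
  windows whose centres drift by \<kappa> times the outer variable. The drift costs a factor sqrt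
  |\<gamma> + l|, so the rows have a summable majorant independent of the windows; this gives the
  uniform bound and, by dominated convergence over l, the product of the two limits.\<close>

lemma window_double_sum_bound:
  fixes \<beta> \<gamma> \<kappa> :: real
  assumes \<kappa>: "\<kappa> \<ge> 0"
  obtains C where "C > 0"
    "\<And>\<xi> h H J L. finite J \<Longrightarrow> H \<ge> 0 \<Longrightarrow> (\<And>l. \<bar>h l\<bar> \<le> H / (1 + (\<gamma> + of_int l)\<^sup>2)) \<Longrightarrow>
      \<bar>\<Sum>l\<in>J. h l * (\<Sum>m | \<bar>\<beta> + \<kappa> * (\<gamma> + of_int l) + of_int m\<bar> \<le> L l. (\<beta> + of_int m) / ((\<beta> + of_int m)\<^sup>2 + \<xi>\<^sup>2))\<bar>
        \<le> C * H * (1 + \<xi>\<^sup>2)"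
    "\<And>\<xi> h H J L. \<xi> \<noteq> 0 \<Longrightarrow> H \<ge> 0 \<Longrightarrow> (\<And>l. \<bar>h l\<bar> \<le> H / (1 + (\<gamma> + of_int l)\<^sup>2)) \<Longrightarrow> (\<And>N. finite (J N)) \<Longrightarrow>
      (\<And>N l m. l \<notin> J N \<Longrightarrow> \<not> \<bar>\<beta> + \<kappa> * (\<gamma> + of_int l) + of_int m\<bar> \<le> L N l) \<Longrightarrow>
      (\<And>l. filterlim (\<lambda>N. L N l) at_top sequentially) \<Longrightarrow>
      (\<lambda>N. \<Sum>l\<in>J N. h l * (\<Sum>m | \<bar>\<beta> + \<kappa> * (\<gamma> + of_int l) + of_int m\<bar> \<le> L N l. (\<beta> + of_int m) / ((\<beta> + of_int m)\<^sup>2 + \<xi>\<^sup>2)))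
        \<longlonglongrightarrow> (\<integral>l. h l \<partial>count_space UNIV) * (pi * \<G> \<beta> \<xi>)"
proof -
  define W where "W \<xi> l r = (\<Sum>m::int | \<bar>\<beta> + \<kappa> * (\<gamma> + of_int l) + of_int m\<bar> \<le> r. (\<beta> + of_int m) / ((\<beta> + of_int m)\<^sup>2 + \<xi>\<^sup>2))"
    for \<xi> r :: real and l :: int
  obtain C where C: "C > 0"
    "\<And>\<sigma> x L. \<bar>\<Sum>k::int | \<bar>\<beta> + \<sigma> + of_int k\<bar> \<le> L. (\<beta> + of_int k) / ((\<beta> + of_int k)\<^sup>2 + x\<^sup>2)\<bar> \<le> C * (1 + x\<^sup>2) * (1 + sqrt \<bar>\<sigma>\<bar>)"
    using \<G>_window_bound[of \<beta>] by blast
  define g where "g l = (1 + sqrt \<bar>\<gamma> + of_int l\<bar>) / (1 + (\<gamma> + of_int l)\<^sup>2)" for l :: int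
  have g: "integrable (count_space UNIV) g"
    unfolding g_def by (rule integrable_sqrt_over_square)
  have g0: "g l \<ge> 0" for l
    by (simp add: g_def add_nonneg_nonneg)
  have W: "\<bar>W \<xi> l r\<bar> \<le> C * (1 + sqrt \<kappa>) * (1 + \<xi>\<^sup>2) * (1 + sqrt \<bar>\<gamma> + of_int l\<bar>)" for \<xi> l r
  proof -
    have "\<bar>W \<xi> l r\<bar> \<le> C * (1 + \<xi>\<^sup>2) * (1 + sqrt \<bar>\<kappa> * (\<gamma> + of_int l)\<bar>)"
      unfolding W_def by (rule C(2))
    also have "\<dots> \<le> C * (1 + \<xi>\<^sup>2) * ((1 + sqrt \<kappa>) * (1 + sqrt \<bar>\<gamma> + of_int l\<bar>))"
    proof (intro mult_left_mono)
      have "sqrt \<bar>\<kappa> * (\<gamma> + of_int l)\<bar> = sqrt \<kappa> * sqrt \<bar>\<gamma> + of_int l\<bar>"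
        using \<kappa> by (simp only: abs_mult real_sqrt_mult abs_of_nonneg)
      moreover have "1 + p * q \<le> (1 + p) * (1 + q)" if "p \<ge> 0" "q \<ge> 0" for p q :: real
        using that by (simp add: algebra_simps)
      ultimately show "1 + sqrt \<bar>\<kappa> * (\<gamma> + of_int l)\<bar> \<le> (1 + sqrt \<kappa>) * (1 + sqrt \<bar>\<gamma> + of_int l\<bar>)"
        using \<kappa> by simp
    qed (use C(1) in auto)
    finally show ?thesis
      by (simp only: mult_ac)
  qed
  have hW: "\<bar>h l * W \<xi> l r\<bar> \<le> C * (1 + sqrt \<kappa>) * H * (1 + \<xi>\<^sup>2) * g l"
    if "\<bar>h l\<bar> \<le> H / (1 + (\<gamma> + of_int l)\<^sup>2)" "H \<ge> 0" for h :: "int \<Rightarrow> real" and l \<xi> r H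
  proof -
    have "\<bar>h l * W \<xi> l r\<bar> \<le> H / (1 + (\<gamma> + of_int l)\<^sup>2) * (C * (1 + sqrt \<kappa>) * (1 + \<xi>\<^sup>2) * (1 + sqrt \<bar>\<gamma> + of_int l\<bar>))"
      unfolding abs_mult using that by (intro mult_mono W) (auto simp: add_nonneg_nonneg)
    then show ?thesis
      by (simp add: g_def mult_ac)
  qed
  define M where "M = C * (1 + sqrt \<kappa>) * (integral\<^sup>L (count_space UNIV) g + 1)"
  have M: "M > 0"
  proof -
    have "integral\<^sup>L (count_space UNIV) g \<ge> 0"
      using g0 by (simp add: integral_nonneg)
    moreover have "sqrt \<kappa> \<ge> 0"
      using \<kappa> by simp
    ultimately show ?thesis
      unfolding M_def using C(1) by (intro mult_pos_pos) linarith+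
  qed
  show ?thesis
  proof (rule that[OF M])
    fix \<xi> H :: real and h L :: "int \<Rightarrow> real" and J :: "int set"
    assume J: "finite J" and H: "H \<ge> 0" and h: "\<And>l. \<bar>h l\<bar> \<le> H / (1 + (\<gamma> + of_int l)\<^sup>2)"
    have "sum g J = (\<integral>l. indicator J l * g l \<partial>count_space UNIV)"
    proof -
      have "finite {l. indicator J l * g l \<noteq> 0}"
        by (rule finite_subset[OF _ J]) (auto simp: indicator_def)
      then have "(\<integral>l. indicator J l * g l \<partial>count_space UNIV) = (\<Sum>l | indicator J l * g l \<noteq> 0. indicator J l * g l)"
        by (simp only: lebesgue_integral_count_space_finite_support UNIV_I simp_thms)
      also have "\<dots> = sum g J"
        by (rule sum.mono_neutral_cong_left[OF J]) (auto simp: indicator_def)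
      finally show ?thesis ..
    qed
    also have "\<dots> \<le> integral\<^sup>L (count_space UNIV) g"
    proof (rule integral_mono_AE[OF _ g])
      show "integrable (count_space UNIV) (\<lambda>l. indicator J l * g l)"
        using integrable_mult_indicator[OF _ g, of J] by simp
    qed (use g0 in \<open>auto simp: indicator_def\<close>)
    finally have sg: "sum g J \<le> integral\<^sup>L (count_space UNIV) g + 1"
      by simp
    have "\<bar>\<Sum>l\<in>J. h l * W \<xi> l (L l)\<bar> \<le> (\<Sum>l\<in>J. C * (1 + sqrt \<kappa>) * H * (1 + \<xi>\<^sup>2) * g l)"
      using H by (intro order_trans[OF sum_abs] sum_mono hW h)
    also have "\<dots> = C * (1 + sqrt \<kappa>) * H * (1 + \<xi>\<^sup>2) * sum g J"
      by (simp only: sum_distrib_left)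
    also have "\<dots> \<le> C * (1 + sqrt \<kappa>) * H * (1 + \<xi>\<^sup>2) * (integral\<^sup>L (count_space UNIV) g + 1)"
      using sg C(1) H \<kappa> by (intro mult_left_mono) auto
    also have "\<dots> = M * H * (1 + \<xi>\<^sup>2)"
      by (simp add: M_def)
    finally show "\<bar>\<Sum>l\<in>J. h l * (\<Sum>m | \<bar>\<beta> + \<kappa> * (\<gamma> + of_int l) + of_int m\<bar> \<le> L l. (\<beta> + of_int m) / ((\<beta> + of_int m)\<^sup>2 + \<xi>\<^sup>2))\<bar>
        \<le> M * H * (1 + \<xi>\<^sup>2)"
      unfolding W_def .
  next
    fix \<xi> H :: real and h :: "int \<Rightarrow> real" and J :: "nat \<Rightarrow> int set" and L :: "nat \<Rightarrow> int \<Rightarrow> real"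
    assume \<xi>: "\<xi> \<noteq> 0" and H: "H \<ge> 0" and h: "\<And>l. \<bar>h l\<bar> \<le> H / (1 + (\<gamma> + of_int l)\<^sup>2)"
      and J: "\<And>N. finite (J N)"
      and out: "\<And>N l m. l \<notin> J N \<Longrightarrow> \<not> \<bar>\<beta> + \<kappa> * (\<gamma> + of_int l) + of_int m\<bar> \<le> L N l"
      and L: "\<And>l. filterlim (\<lambda>N. L N l) at_top sequentially"
    have "(\<lambda>N. \<integral>l. h l * W \<xi> l (L N l) \<partial>count_space UNIV) \<longlonglongrightarrow> (\<integral>l. h l * (pi * \<G> \<beta> \<xi>) \<partial>count_space UNIV)"
    proof (rule integral_dominated_convergence[where w = "\<lambda>l. C * (1 + sqrt \<kappa>) * H * (1 + \<xi>\<^sup>2) * g l"])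
      show "AE l in count_space UNIV. (\<lambda>N. h l * W \<xi> l (L N l)) \<longlonglongrightarrow> h l * (pi * \<G> \<beta> \<xi>)"
        unfolding W_def by (intro AE_I2 tendsto_intros \<G>_window_limit \<xi> L)
      show "AE l in count_space UNIV. norm (h l * W \<xi> l (L N l)) \<le> C * (1 + sqrt \<kappa>) * H * (1 + \<xi>\<^sup>2) * g l" for N
        unfolding real_norm_def using H by (intro AE_I2 hW h)
    qed (use g in auto)
    moreover have "(\<integral>l. h l * W \<xi> l (L N l) \<partial>count_space UNIV) = (\<Sum>l\<in>J N. h l * W \<xi> l (L N l))" for N
    proof -
      \<comment> \<open>Rows outside J have empty windows, so the integral over all l is the finite
        sum over J.\<close>
      have W0: "W \<xi> l (L N l) = 0" if "l \<notin> J N" for l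
      proof -
        have "{m. \<bar>\<beta> + \<kappa> * (\<gamma> + of_int l) + of_int m\<bar> \<le> L N l} = {}"
          using out[OF that] by blast
        then show ?thesis
          by (simp only: W_def sum.empty)
      qed
      then have "finite {l. h l * W \<xi> l (L N l) \<noteq> 0}"
        by (intro finite_subset[OF _ J[of N]]) auto
      then have "(\<integral>l. h l * W \<xi> l (L N l) \<partial>count_space UNIV) = (\<Sum>l | h l * W \<xi> l (L N l) \<noteq> 0. h l * W \<xi> l (L N l))"
        by (simp only: lebesgue_integral_count_space_finite_support UNIV_I simp_thms)
      also have "\<dots> = (\<Sum>l\<in>J N. h l * W \<xi> l (L N l))"
        using W0 by (intro sum.mono_neutral_left J) auto
      finally show ?thesis .
    qed
    ultimately show "(\<lambda>N. \<Sum>l\<in>J N. h l * (\<Sum>m | \<bar>\<beta> + \<kappa> * (\<gamma> + of_int l) + of_int m\<bar> \<le> L N l. (\<beta> + of_int m) / ((\<beta> + of_int m)\<^sup>2 + \<xi>\<^sup>2)))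
        \<longlonglongrightarrow> (\<integral>l. h l \<partial>count_space UNIV) * (pi * \<G> \<beta> \<xi>)"
      by (simp add: W_def)
  qed
qed

section \<open>Truncation windows along the coordinate axes\<close>

text \<open>Completing the square in the first coordinate, Q = 3 (a + b/2)^2 + b^2 / 4: the drift is
  1/2. The trailing division by 1 is \<open>square_le_iff_window\<close> at c = 1.\<close>

lemma truncation_window_fst:
  "(i, j) \<in> truncation (a, b) N \<longleftrightarrow> \<bar>a + 1 / 2 * (b + of_int j) + of_int i\<bar> \<le> sqrt (((4 * real N - (b + of_int j)\<^sup>2) / 12) / 1)"
proof -
  have "Q (lattice_point (a, b) (i, j)) = 3 * (a + 1 / 2 * (b + of_int j) + of_int i)\<^sup>2 + (b + of_int j)\<^sup>2 / 4"
    by (simp add: Q_eq lattice_point_def power2_eq_square field_simps)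
  then have "(i, j) \<in> truncation (a, b) N \<longleftrightarrow> 1 * (a + 1 / 2 * (b + of_int j) + of_int i)\<^sup>2 \<le> (4 * real N - (b + of_int j)\<^sup>2) / 12"
  proof -
    have "q \<le> n \<longleftrightarrow> 1 * u \<le> (4 * n - v) / 12" if "q = 3 * u + v / 4" for q n u v :: real
      unfolding that by (simp add: field_simps)
    then show ?thesis
      using \<open>Q _ = _\<close> unfolding truncation_def mem_Collect_eq by blast
  qed
  then show ?thesis
    by (simp only: square_le_iff_window zero_less_one)
qed

text \<open>Completing the square in the second coordinate, Q = (b + 3a/2)^2 + 3 a^2 / 4: the drift
  is 3/2.\<close>

lemma truncation_window_snd:
  "(i, j) \<in> truncation (a, b) N \<longleftrightarrow> \<bar>b + 3 / 2 * (a + of_int i) + of_int j\<bar> \<le> sqrt (((4 * real N - 3 * (a + of_int i)\<^sup>2) / 4) / 1)"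
proof -
  have "Q (lattice_point (a, b) (i, j)) = (b + 3 / 2 * (a + of_int i) + of_int j)\<^sup>2 + 3 / 4 * (a + of_int i)\<^sup>2"
    by (simp add: Q_eq lattice_point_def power2_eq_square field_simps)
  then have "(i, j) \<in> truncation (a, b) N \<longleftrightarrow> 1 * (b + 3 / 2 * (a + of_int i) + of_int j)\<^sup>2 \<le> (4 * real N - 3 * (a + of_int i)\<^sup>2) / 4"
  proof -
    have "q \<le> n \<longleftrightarrow> 1 * u \<le> (4 * n - 3 * v) / 4" if "q = u + 3 / 4 * v" for q n u v :: real
      unfolding that by (simp add: field_simps)
    then show ?thesis
      using \<open>Q _ = _\<close> unfolding truncation_def mem_Collect_eq by blast
  qed
  then show ?thesis
    by (simp only: square_le_iff_window zero_less_one)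
qed

lemma window_radius_limit:
  "filterlim (\<lambda>N. sqrt (((4 * real N - c) / d) / 1)) at_top sequentially" if "d > 0"
proof -
  have "filterlim (\<lambda>N. - c / d + 4 / d * real N) at_top sequentially"
    using that by (intro filterlim_tendsto_add_at_top[OF tendsto_const] filterlim_tendsto_pos_mult_at_top[OF tendsto_const] filterlim_real_sequentially) auto
  then have "filterlim (\<lambda>N. sqrt (- c / d + 4 / d * real N)) at_top sequentially"
    by (rule filterlim_compose[OF sqrt_at_top])
  moreover have "- c / d + 4 / d * real N = ((4 * real N - c) / d) / 1" for N
    by (simp add: diff_divide_distrib)
  ultimately show ?thesis
    by simp
qed

text \<open>The terms with first lattice coordinate zero are kept apart, because individually they are
  singular at \<open>x = 0\<close>.\<close>

definition part1 :: "real \<times> real \<Rightarrow> real \<Rightarrow> real \<Rightarrow> real" where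
  "part1 n x y = y\<^sup>2 / ((snd n)\<^sup>2 + y\<^sup>2) * (fst n / ((fst n)\<^sup>2 + x\<^sup>2))"

definition part2 :: "real \<times> real \<Rightarrow> real \<Rightarrow> real \<Rightarrow> real" where
  "part2 n x y = (if fst n = 0 then 0 else x / ((fst n)\<^sup>2 + x\<^sup>2)) * (snd n / ((snd n)\<^sup>2 + y\<^sup>2))"

definition part3 :: "real \<times> real \<Rightarrow> real \<Rightarrow> real \<Rightarrow> real" where
  "part3 n x y = (if fst n = 0 then snd n / x * (y / ((snd n)\<^sup>2 + y\<^sup>2) - (y + 3 * x / 2) / ((snd n)\<^sup>2 + (y + 3 * x / 2)\<^sup>2)) else 0)"

lemma summand_parts: "summand n (x, y) = part1 n x y + y * part2 n x y + part3 n x y"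
proof (cases n)
  case (Pair a b)
  show ?thesis
  proof (cases "a = 0")
    case False
    have "(a * y\<^sup>2 + b * x * y) / (p * q) = y\<^sup>2 / q * (a / p) + y * (x / p * (b / q))" for p q
      by (simp add: add_divide_distrib mult_ac)
    then show ?thesis
      using False by (simp add: Pair summand_def part1_def part2_def part3_def)
  qed (simp add: Pair summand_def part1_def part2_def part3_def)
qed

lemma weight1_bound: "\<bar>y\<^sup>2 / (b\<^sup>2 + y\<^sup>2)\<bar> \<le> (1 + y\<^sup>2) / (1 + b\<^sup>2)" for b y :: real
proof (cases "y = 0")
  case False
  have "y\<^sup>2 * (1 + b\<^sup>2) \<le> (1 + y\<^sup>2) * (b\<^sup>2 + y\<^sup>2)"
    by (simp add: algebra_simps)
  moreover have "b\<^sup>2 + y\<^sup>2 > 0" "1 + b\<^sup>2 > 0"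
    using False by (simp_all add: add_nonneg_pos add_pos_nonneg)
  ultimately show ?thesis
    by (simp add: field_simps)
qed (simp add: add_nonneg_nonneg)

text \<open>With the zero of a + i removed, the weight is of size |x| near x = 0 instead of 1/|x|.
  The cubic estimate serves the absolutely convergent remainder in \<open>part3_sum\<close>.\<close>

lemma weight2_bound:
  fixes a :: real
  obtains C where "C > 0"
    "\<And>x i. \<bar>if a + of_int i = 0 then 0 else x / ((a + of_int i)\<^sup>2 + x\<^sup>2)\<bar> \<le> C * \<bar>x\<bar> / (1 + (a + of_int i)\<^sup>2)"
    "\<And>i. a + of_int i \<noteq> 0 \<Longrightarrow> 1 / \<bar>a + of_int i\<bar> ^ 3 \<le> C / (1 + (a + of_int i)\<^sup>2)"
proof -
  obtain \<delta> where \<delta>: "\<delta> > 0" "\<delta> \<le> 1" "\<And>k::int. a + k \<noteq> 0 \<Longrightarrow> \<bar>a + k\<bar> \<ge> \<delta>"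
    using shifted_int_gap[of a] by blast
  define C where "C = 2 / \<delta> ^ 3"
  have C: "C > 0"
    using \<delta> by (simp add: C_def)
  have C2: "2 / \<delta>\<^sup>2 \<le> C"
    using \<delta> by (simp add: C_def power2_eq_square power3_eq_cube field_simps)
  have sq: "1 + r\<^sup>2 \<le> 2 / \<delta>\<^sup>2 * r\<^sup>2" if "\<bar>r\<bar> \<ge> \<delta>" for r :: real
  proof -
    have "\<delta>\<^sup>2 \<le> r\<^sup>2"
      using that \<delta> power_mono[of \<delta> "\<bar>r\<bar>" 2] by simp
    moreover have "r\<^sup>2 * \<delta>\<^sup>2 \<le> r\<^sup>2 * 1"
      using \<delta> by (intro mult_left_mono) (auto simp: power_le_one)
    ultimately have "\<delta>\<^sup>2 * (1 + r\<^sup>2) \<le> 2 * r\<^sup>2"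
      by (simp add: algebra_simps)
    then show ?thesis
      using \<delta> by (simp add: field_simps)
  qed
  show ?thesis
  proof (rule that[OF C])
    fix x :: real and i :: int
    show "\<bar>if a + of_int i = 0 then 0 else x / ((a + of_int i)\<^sup>2 + x\<^sup>2)\<bar> \<le> C * \<bar>x\<bar> / (1 + (a + of_int i)\<^sup>2)"
    proof (cases "a + of_int i = 0")
      case False
      define r where "r = a + of_int i"
      have r: "\<bar>r\<bar> \<ge> \<delta>" "r \<noteq> 0"
        using \<delta> False by (auto simp: r_def)
      have "1 + r\<^sup>2 \<le> C * (r\<^sup>2 + x\<^sup>2)"
      proof -
        have "1 + r\<^sup>2 \<le> 2 / \<delta>\<^sup>2 * r\<^sup>2" by (rule sq[OF r(1)])
        also have "\<dots> \<le> C * (r\<^sup>2 + x\<^sup>2)"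
          using C2 C by (intro mult_mono) auto
        finally show ?thesis .
      qed
      moreover have "r\<^sup>2 + x\<^sup>2 > 0" "1 + r\<^sup>2 > 0"
        using r by (simp_all add: add_pos_nonneg)
      ultimately have "1 / (r\<^sup>2 + x\<^sup>2) \<le> C / (1 + r\<^sup>2)"
        by (simp add: field_simps)
      then have "\<bar>x\<bar> * (1 / (r\<^sup>2 + x\<^sup>2)) \<le> \<bar>x\<bar> * (C / (1 + r\<^sup>2))"
        by (rule mult_left_mono) simp
      then show ?thesis
        using \<open>r\<^sup>2 + x\<^sup>2 > 0\<close> False by (simp add: r_def mult_ac)
    qed (use C in simp)
  next
    fix i :: int assume nz: "a + of_int i \<noteq> 0"
    define r where "r = a + of_int i"
    have r: "\<bar>r\<bar> \<ge> \<delta>" "r \<noteq> 0"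
      using \<delta> nz by (auto simp: r_def)
    have "1 + r\<^sup>2 \<le> 2 / \<delta>\<^sup>2 * r\<^sup>2" by (rule sq[OF r(1)])
    also have "\<dots> = C * (\<delta> * r\<^sup>2)"
      using \<delta> by (simp add: C_def power2_eq_square power3_eq_cube)
    also have "\<dots> \<le> C * (\<bar>r\<bar> * r\<^sup>2)"
      using r C by (intro mult_left_mono mult_right_mono) auto
    also have "\<bar>r\<bar> * r\<^sup>2 = \<bar>r\<bar> ^ 3"
      by (simp add: power2_eq_square power3_eq_cube)
    finally have "1 + r\<^sup>2 \<le> C * \<bar>r\<bar> ^ 3" .
    moreover have "1 + r\<^sup>2 > 0"
      by (simp add: add_pos_nonneg)
    ultimately have "1 / \<bar>r\<bar> ^ 3 \<le> C / (1 + r\<^sup>2)"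
      using r by (simp add: field_simps)
    then show "1 / \<bar>a + of_int i\<bar> ^ 3 \<le> C / (1 + (a + of_int i)\<^sup>2)"
      by (simp add: r_def)
  qed
qed

section \<open>Bounds and limits of the three parts\<close>

text \<open>Absolutely convergent in the second coordinate, with total \<pi> y \<F>, and
  conditionally convergent in the first; so the slices fix the second coordinate.\<close>

lemma part1_sum:
  fixes a b :: real
  defines "S \<equiv> \<lambda>N x y. \<Sum>k\<in>truncation (a, b) N. part1 (lattice_point (a, b) k) x y"
  shows "\<exists>C>0. \<forall>N x y. \<bar>S N x y\<bar> \<le> C * (1 + y\<^sup>2) * (1 + x\<^sup>2)"
    and "x \<noteq> 0 \<Longrightarrow> y \<noteq> 0 \<Longrightarrow> (\<lambda>N. S N x y) \<longlonglongrightarrow> y * (pi * \<F> b y) * (pi * \<G> a x)"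
proof -
  define \<phi> where "\<phi> = (\<lambda>(l, m). (m, l) :: int \<times> int)"
  have \<phi>: "bij \<phi>"
    by (rule o_bij[of \<phi>]) (auto simp: \<phi>_def)
  define J where "J N = fst ` (\<phi> -` truncation (a, b) N)" for N
  define L where "L N j = sqrt (((4 * real N - (b + of_int j)\<^sup>2) / 12) / 1)" for N and j :: int
  define h where "h y j = y\<^sup>2 / ((b + of_int j)\<^sup>2 + y\<^sup>2)" for y and j :: int
  have J: "finite (J N)" for N
    unfolding J_def by (rule sum_fibres(2)[OF finite_truncation \<phi>])
  have mem: "\<phi> (j, i) \<in> truncation (a, b) N \<longleftrightarrow> \<bar>a + 1 / 2 * (b + of_int j) + of_int i\<bar> \<le> L N j" for i j N
    unfolding \<phi>_def prod.case L_def by (rule truncation_window_fst)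
  have S: "S N x y = (\<Sum>j\<in>J N. h y j * (\<Sum>i | \<bar>a + 1 / 2 * (b + of_int j) + of_int i\<bar> \<le> L N j. (a + of_int i) / ((a + of_int i)\<^sup>2 + x\<^sup>2)))"
    for N x y
    unfolding S_def sum_fibres(1)[OF finite_truncation \<phi>] J_def[symmetric] mem
    by (simp add: part1_def lattice_point_def \<phi>_def h_def sum_distrib_left)
  have h: "\<bar>h y j\<bar> \<le> (1 + y\<^sup>2) / (1 + (b + of_int j)\<^sup>2)" for y j
    unfolding h_def by (rule weight1_bound)
  have half: "(0::real) \<le> 1 / 2"
    by simp
  obtain C where C: "C > 0"
    "\<And>\<xi> h H J L. finite J \<Longrightarrow> H \<ge> 0 \<Longrightarrow> (\<And>l. \<bar>h l\<bar> \<le> H / (1 + (b + of_int l)\<^sup>2)) \<Longrightarrow>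
      \<bar>\<Sum>l\<in>J. h l * (\<Sum>m | \<bar>a + 1 / 2 * (b + of_int l) + of_int m\<bar> \<le> L l. (a + of_int m) / ((a + of_int m)\<^sup>2 + \<xi>\<^sup>2))\<bar>
        \<le> C * H * (1 + \<xi>\<^sup>2)"
    and lim: "\<And>\<xi> h H J L. \<xi> \<noteq> 0 \<Longrightarrow> H \<ge> 0 \<Longrightarrow> (\<And>l. \<bar>h l\<bar> \<le> H / (1 + (b + of_int l)\<^sup>2)) \<Longrightarrow> (\<And>N. finite (J N)) \<Longrightarrow>
      (\<And>N l m. l \<notin> J N \<Longrightarrow> \<not> \<bar>a + 1 / 2 * (b + of_int l) + of_int m\<bar> \<le> L N l) \<Longrightarrow>
      (\<And>l. filterlim (\<lambda>N. L N l) at_top sequentially) \<Longrightarrow>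
      (\<lambda>N. \<Sum>l\<in>J N. h l * (\<Sum>m | \<bar>a + 1 / 2 * (b + of_int l) + of_int m\<bar> \<le> L N l. (a + of_int m) / ((a + of_int m)\<^sup>2 + \<xi>\<^sup>2)))
        \<longlonglongrightarrow> (\<integral>l. h l \<partial>count_space UNIV) * (pi * \<G> a \<xi>)"
    using window_double_sum_bound[OF half, of b a] by blast
  show "\<exists>C>0. \<forall>N x y. \<bar>S N x y\<bar> \<le> C * (1 + y\<^sup>2) * (1 + x\<^sup>2)"
    unfolding S using C(1) by (intro exI[of _ C] conjI allI C(2) J h) (auto simp: add_nonneg_nonneg)
  show "(\<lambda>N. S N x y) \<longlonglongrightarrow> y * (pi * \<F> b y) * (pi * \<G> a x)" if x: "x \<noteq> 0" and y: "y \<noteq> 0"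
  proof -
    have "(\<integral>j. h y j \<partial>count_space UNIV) = (\<integral>j. y * (y / ((b + of_int j)\<^sup>2 + y\<^sup>2)) \<partial>count_space UNIV)"
      by (simp add: h_def power2_eq_square)
    also have "\<dots> = y * (pi * \<F> b y)"
      unfolding integral_mult_right_zero \<F>_integral_count_space(2)[OF y] ..
    finally have "y * (pi * \<F> b y) = (\<integral>j. h y j \<partial>count_space UNIV)" ..
    then show ?thesis
      unfolding S
    proof (simp only:, intro lim[OF x _ h])
      show "\<not> \<bar>a + 1 / 2 * (b + of_int l) + of_int m\<bar> \<le> L N l" if "l \<notin> J N" for N l m
        using that unfolding J_def mem[symmetric] by (force simp: image_iff)
      show "filterlim (\<lambda>N. L N l) at_top sequentially" for l
        unfolding L_def by (rule window_radius_limit) simp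
    qed (auto simp: J add_nonneg_nonneg)
  qed
qed

text \<open>The roles are exchanged: absolute convergence in the first coordinate, windows in the
  second. For integral a the omitted zero row accounts for the correction - 1/x.\<close>

lemma part2_sum:
  fixes a b :: real
  defines "S \<equiv> \<lambda>N x y. \<Sum>k\<in>truncation (a, b) N. part2 (lattice_point (a, b) k) x y"
  shows "\<exists>C>0. \<forall>N x y. \<bar>S N x y\<bar> \<le> C * \<bar>x\<bar> * (1 + y\<^sup>2)"
    and "x \<noteq> 0 \<Longrightarrow> y \<noteq> 0 \<Longrightarrow> (\<lambda>N. S N x y) \<longlonglongrightarrow> (pi * \<F> a x - (if a \<in> \<int> then 1 / x else 0)) * (pi * \<G> b y)"
proof -
  define \<phi> where "\<phi> = (\<lambda>(l, m). (l, m) :: int \<times> int)"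
  have \<phi>: "bij \<phi>"
    by (rule o_bij[of \<phi>]) (auto simp: \<phi>_def)
  define J where "J N = fst ` (\<phi> -` truncation (a, b) N)" for N
  define L where "L N i = sqrt (((4 * real N - 3 * (a + of_int i)\<^sup>2) / 4) / 1)" for N and i :: int
  define h where "h x i = (if a + of_int i = 0 then 0 else x / ((a + of_int i)\<^sup>2 + x\<^sup>2))" for x and i :: int
  have J: "finite (J N)" for N
    unfolding J_def by (rule sum_fibres(2)[OF finite_truncation \<phi>])
  have mem: "\<phi> (i, j) \<in> truncation (a, b) N \<longleftrightarrow> \<bar>b + 3 / 2 * (a + of_int i) + of_int j\<bar> \<le> L N i" for i j N
    unfolding \<phi>_def prod.case L_def by (rule truncation_window_snd)
  have S: "S N x y = (\<Sum>i\<in>J N. h x i * (\<Sum>j | \<bar>b + 3 / 2 * (a + of_int i) + of_int j\<bar> \<le> L N i. (b + of_int j) / ((b + of_int j)\<^sup>2 + y\<^sup>2)))"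
    for N x y
    unfolding S_def sum_fibres(1)[OF finite_truncation \<phi>] J_def[symmetric] mem
    unfolding part2_def lattice_point_def \<phi>_def prod.case fst_conv snd_conv h_def sum_distrib_left ..
  obtain D where D: "D > 0" "\<And>x i. \<bar>h x i\<bar> \<le> D * \<bar>x\<bar> / (1 + (a + of_int i)\<^sup>2)"
    unfolding h_def using weight2_bound[of a] by metis
  have half: "(0::real) \<le> 3 / 2"
    by simp
  obtain C where C: "C > 0"
    "\<And>\<xi> h H J L. finite J \<Longrightarrow> H \<ge> 0 \<Longrightarrow> (\<And>l. \<bar>h l\<bar> \<le> H / (1 + (a + of_int l)\<^sup>2)) \<Longrightarrow>
      \<bar>\<Sum>l\<in>J. h l * (\<Sum>m | \<bar>b + 3 / 2 * (a + of_int l) + of_int m\<bar> \<le> L l. (b + of_int m) / ((b + of_int m)\<^sup>2 + \<xi>\<^sup>2))\<bar>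
        \<le> C * H * (1 + \<xi>\<^sup>2)"
    and lim: "\<And>\<xi> h H J L. \<xi> \<noteq> 0 \<Longrightarrow> H \<ge> 0 \<Longrightarrow> (\<And>l. \<bar>h l\<bar> \<le> H / (1 + (a + of_int l)\<^sup>2)) \<Longrightarrow> (\<And>N. finite (J N)) \<Longrightarrow>
      (\<And>N l m. l \<notin> J N \<Longrightarrow> \<not> \<bar>b + 3 / 2 * (a + of_int l) + of_int m\<bar> \<le> L N l) \<Longrightarrow>
      (\<And>l. filterlim (\<lambda>N. L N l) at_top sequentially) \<Longrightarrow>
      (\<lambda>N. \<Sum>l\<in>J N. h l * (\<Sum>m | \<bar>b + 3 / 2 * (a + of_int l) + of_int m\<bar> \<le> L N l. (b + of_int m) / ((b + of_int m)\<^sup>2 + \<xi>\<^sup>2)))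
        \<longlonglongrightarrow> (\<integral>l. h l \<partial>count_space UNIV) * (pi * \<G> b \<xi>)"
    using window_double_sum_bound[OF half, of a b] by blast
  have "\<bar>S N x y\<bar> \<le> C * D * \<bar>x\<bar> * (1 + y\<^sup>2)" for N x y
    unfolding S using C(2)[OF J, where H = "D * \<bar>x\<bar>" and h = "h x" and \<xi> = y and L = "L N"] D by (simp add: mult.assoc)
  then show "\<exists>C>0. \<forall>N x y. \<bar>S N x y\<bar> \<le> C * \<bar>x\<bar> * (1 + y\<^sup>2)"
    using C(1) D(1) by (intro exI[of _ "C * D"]) auto
  show "(\<lambda>N. S N x y) \<longlonglongrightarrow> (pi * \<F> a x - (if a \<in> \<int> then 1 / x else 0)) * (pi * \<G> b y)" if x: "x \<noteq> 0" and y: "y \<noteq> 0"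
  proof -
    let ?f = "\<lambda>i::int. x / ((a + of_int i)\<^sup>2 + x\<^sup>2)"
    have "(\<integral>i. h x i \<partial>count_space UNIV) = pi * \<F> a x - (if a \<in> \<int> then 1 / x else 0)"
    proof (cases "a \<in> \<int>")
      case True
      then obtain m :: int where m: "a = of_int m"
        by (auto elim: Ints_cases)
      \<comment> \<open>At the zero of a + i the full term x / (0 + x^2) equals 1/x.\<close>
      have "h x i = ?f i - indicator {- m} i * (1 / x)" for i
      proof -
        have "a + of_int i = 0 \<longleftrightarrow> i = - m"
          unfolding m by linarith
        then show ?thesis
          using x by (auto simp: h_def indicator_def power2_eq_square)
      qed
      moreover have "finite {i. indicator {- m} i * (1 / x) \<noteq> 0}"
        by (rule finite_subset[of _ "{- m}"]) (auto simp: indicator_def)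
      moreover have "(\<integral>i. indicator {- m} i * (1 / x) \<partial>count_space UNIV) = 1 / x"
        by (simp add: measure_def)
      moreover have "integrable (count_space UNIV) (\<lambda>i. indicator {- m} i * (1 / x))"
        by (rule integrable_mult_left) (simp add: integrable_indicator_iff)
      ultimately show ?thesis
        using True by (simp only: Bochner_Integration.integral_diff[OF \<F>_integral_count_space(1)[OF x]] \<F>_integral_count_space(2)[OF x] if_True)
    next
      case False
      then have "a + of_int i \<noteq> 0" for i
        by (metis Ints_minus Ints_of_int add_eq_0_iff2)
      then have "h x i = ?f i" for i
        by (simp add: h_def)
      then show ?thesis
        using False \<F>_integral_count_space(2)[OF x, of a] by simp
    qed
    then have e: "pi * \<F> a x - (if a \<in> \<int> then 1 / x else 0) = (\<integral>i. h x i \<partial>count_space UNIV)" ..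
    show ?thesis
      unfolding S e
    proof (intro lim[OF y _ D(2)])
      show "\<not> \<bar>b + 3 / 2 * (a + of_int l) + of_int m\<bar> \<le> L N l" if "l \<notin> J N" for N l m
        using that unfolding J_def mem[symmetric] by (force simp: image_iff)
      show "filterlim (\<lambda>N. L N l) at_top sequentially" for l
        unfolding L_def by (rule window_radius_limit) simp
    qed (use D in \<open>auto simp: J\<close>)
  qed
qed

text \<open>Only the row a + i = 0 contributes, through a single window without drift. The limit may
  be taken in its two halves separately, but the bound near x = 0 requires their difference.\<close>

lemma part3_sum:
  fixes a b :: real
  defines "S \<equiv> \<lambda>N x y. \<Sum>k\<in>truncation (a, b) N. part3 (lattice_point (a, b) k) x y"
  shows "\<exists>C>0. \<forall>N x y. \<bar>S N x y\<bar> \<le> C * (1 + x\<^sup>2) * (1 + y\<^sup>2)"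
    and "x \<noteq> 0 \<Longrightarrow> y \<noteq> 0 \<Longrightarrow> y + 3 * x / 2 \<noteq> 0 \<Longrightarrow>
      (\<lambda>N. S N x y) \<longlonglongrightarrow> (if a \<in> \<int> then 1 / x * (y * (pi * \<G> b y) - (y + 3 * x / 2) * (pi * \<G> b (y + 3 * x / 2))) else 0)"
proof -
  define W where "W N r = (\<Sum>j | \<bar>b + 0 + of_int j\<bar> \<le> sqrt (((4 * real N - 0) / 4) / 1). (b + of_int j) / ((b + of_int j)\<^sup>2 + r\<^sup>2))" for N r
  define Jw where "Jw N = {j::int. \<bar>b + 0 + of_int j\<bar> \<le> sqrt (((4 * real N - 0) / 4) / 1)}" for N
  have finJ: "finite (Jw N)" for N
  proof (rule finite_subset)
    show "Jw N \<subseteq> {\<lceil>- b - sqrt (((4 * real N - 0) / 4) / 1)\<rceil>..\<lfloor>sqrt (((4 * real N - 0) / 4) / 1) - b\<rfloor>}"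
      unfolding Jw_def by (auto simp: ceiling_le_iff le_floor_iff abs_le_iff)
  qed simp
  have S_nonint: "S N x y = 0" if "a \<notin> \<int>" for N x y
  proof -
    have "a + of_int i \<noteq> 0" for i
      using that by (metis Ints_minus Ints_of_int add_eq_0_iff2)
    then show ?thesis
      by (simp add: S_def part3_def lattice_point_def)
  qed
  have S_int: "S N x y = (\<Sum>j\<in>Jw N. (b + of_int j) / x * (y / ((b + of_int j)\<^sup>2 + y\<^sup>2) - (y + 3 * x / 2) / ((b + of_int j)\<^sup>2 + (y + 3 * x / 2)\<^sup>2)))"
    if m: "a = of_int m" for m N x y
  proof -
    have i0: "a + of_int i = 0 \<longleftrightarrow> i = - m" for i
      unfolding m by linarith
    have "S N x y = (\<Sum>k\<in>(\<lambda>j. (- m, j)) ` Jw N. part3 (lattice_point (a, b) k) x y)"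
      unfolding S_def
    proof (rule sum.mono_neutral_right[OF finite_truncation])
      show "(\<lambda>j. (- m, j)) ` Jw N \<subseteq> truncation (a, b) N"
        unfolding Jw_def using truncation_window_snd[of "- m" _ a b N] by (auto simp: m)
      show "\<forall>k\<in>truncation (a, b) N - (\<lambda>j. (- m, j)) ` Jw N. part3 (lattice_point (a, b) k) x y = 0"
      proof
        fix k assume k: "k \<in> truncation (a, b) N - (\<lambda>j. (- m, j)) ` Jw N"
        have "fst k \<noteq> - m"
        proof
          assume e: "fst k = - m"
          then have "(- m, snd k) \<in> truncation (a, b) N"
            using k by (metis DiffD1 prod.collapse)
          then have "snd k \<in> Jw N"
            unfolding truncation_window_snd Jw_def by (simp add: m)
          then show False
            using k e by (metis DiffD2 imageI prod.collapse)
        qed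
        then show "part3 (lattice_point (a, b) k) x y = 0"
          using i0 by (simp add: part3_def lattice_point_def)
      qed
    qed
    also have "\<dots> = (\<Sum>j\<in>Jw N. part3 (lattice_point (a, b) (- m, j)) x y)"
      by (rule sum.reindex_cong[of "\<lambda>j. (- m, j)"]) (auto simp: inj_on_def)
    finally show ?thesis
      by (simp add: part3_def lattice_point_def m)
  qed
  obtain C where C: "C > 0"
    "\<And>\<sigma> x L. \<bar>\<Sum>k::int | \<bar>b + \<sigma> + of_int k\<bar> \<le> L. (b + of_int k) / ((b + of_int k)\<^sup>2 + x\<^sup>2)\<bar> \<le> C * (1 + x\<^sup>2) * (1 + sqrt \<bar>\<sigma>\<bar>)"
    using \<G>_window_bound[of b] by blast
  have W: "\<bar>W N r\<bar> \<le> C * (1 + r\<^sup>2)" for N r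
    unfolding W_def using C(2)[where \<sigma> = 0 and x = r and L = "sqrt (((4 * real N - 0) / 4) / 1)"]
    by (simp only: abs_zero real_sqrt_zero add_0_right mult_1_right)
  obtain D where D: "D > 0" "\<And>i. b + of_int i \<noteq> 0 \<Longrightarrow> 1 / \<bar>b + of_int i\<bar> ^ 3 \<le> D / (1 + (b + of_int i)\<^sup>2)"
    using weight2_bound[of b] by metis
  define M where "M = 3 / 2 * (C + 80 * D)"
  have M: "M > 0"
    using C D by (simp add: M_def add_pos_pos)
  have "\<bar>S N x y\<bar> \<le> M * (1 + x\<^sup>2) * (1 + y\<^sup>2)" for N x y
  proof (cases "a \<in> \<int> \<and> x \<noteq> 0")
    case True
    then obtain m :: int where m: "a = of_int m"
      by (auto elim: Ints_cases)
    define z where "z = y + 3 * x / 2"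
    have x: "x \<noteq> 0" using True by simp
    \<comment> \<open>The difference of the quotients contains the factor y - z = - 3x/2, which
      cancels 1/x. What remains is one window sum and a series with cubic decay.\<close>
    have trm: "c / x * (y / (c\<^sup>2 + y\<^sup>2) - z / (c\<^sup>2 + z\<^sup>2)) = - (3 / 2) * (c / (c\<^sup>2 + y\<^sup>2) - z * (z + y) * (c / ((c\<^sup>2 + y\<^sup>2) * (c\<^sup>2 + z\<^sup>2))))" for c
    proof (cases "c = 0")
      case False
      then have nz: "c\<^sup>2 + y\<^sup>2 \<noteq> 0" "c\<^sup>2 + z\<^sup>2 \<noteq> 0"
        by (auto simp: add_nonneg_eq_0_iff)
      have "y / (c\<^sup>2 + y\<^sup>2) - z / (c\<^sup>2 + z\<^sup>2) = (y * (c\<^sup>2 + z\<^sup>2) - z * (c\<^sup>2 + y\<^sup>2)) / ((c\<^sup>2 + y\<^sup>2) * (c\<^sup>2 + z\<^sup>2))"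
        using nz by (rule diff_frac_eq)
      also have "y * (c\<^sup>2 + z\<^sup>2) - z * (c\<^sup>2 + y\<^sup>2) = (y - z) * ((c\<^sup>2 + z\<^sup>2) - z * (z + y))"
        by (simp add: power2_eq_square algebra_simps)
      also have "y - z = - (3 / 2) * x"
        by (simp add: z_def)
      finally have 1: "y / (c\<^sup>2 + y\<^sup>2) - z / (c\<^sup>2 + z\<^sup>2) = - (3 / 2) * x * (((c\<^sup>2 + z\<^sup>2) - z * (z + y)) / ((c\<^sup>2 + y\<^sup>2) * (c\<^sup>2 + z\<^sup>2)))"
        by simp
      have "((c\<^sup>2 + z\<^sup>2) - z * (z + y)) / ((c\<^sup>2 + y\<^sup>2) * (c\<^sup>2 + z\<^sup>2)) = 1 / (c\<^sup>2 + y\<^sup>2) - z * (z + y) * (1 / ((c\<^sup>2 + y\<^sup>2) * (c\<^sup>2 + z\<^sup>2)))"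
        using nz by (simp add: diff_divide_distrib)
      then show ?thesis
        unfolding 1 using x by (simp add: right_diff_distrib mult_ac)
    qed simp
    have "S N x y = (\<Sum>j\<in>Jw N. - (3 / 2) * ((b + of_int j) / ((b + of_int j)\<^sup>2 + y\<^sup>2) -
        z * (z + y) * ((b + of_int j) / (((b + of_int j)\<^sup>2 + y\<^sup>2) * ((b + of_int j)\<^sup>2 + z\<^sup>2)))))"
      unfolding S_int[OF m] z_def[symmetric] trm ..
    also have "\<dots> = - (3 / 2) * (W N y - z * (z + y) * (\<Sum>j\<in>Jw N. (b + of_int j) / (((b + of_int j)\<^sup>2 + y\<^sup>2) * ((b + of_int j)\<^sup>2 + z\<^sup>2))))"
      unfolding W_def Jw_def sum_distrib_left[symmetric] sum_subtractf ..
    finally have S: "S N x y = - (3 / 2) * (W N y - z * (z + y) * (\<Sum>j\<in>Jw N. (b + of_int j) / (((b + of_int j)\<^sup>2 + y\<^sup>2) * ((b + of_int j)\<^sup>2 + z\<^sup>2))))" .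
    have cubic: "\<bar>\<Sum>j\<in>Jw N. (b + of_int j) / (((b + of_int j)\<^sup>2 + y\<^sup>2) * ((b + of_int j)\<^sup>2 + z\<^sup>2))\<bar> \<le> 10 * D"
    proof -
      have "\<bar>(b + of_int j) / (((b + of_int j)\<^sup>2 + y\<^sup>2) * ((b + of_int j)\<^sup>2 + z\<^sup>2))\<bar> \<le> D * (1 / (1 + 1 * (b + of_int j)\<^sup>2))" for j :: int
      proof (cases "b + of_int j = 0")
        case False
        define c where "c = b + of_int j"
        have c: "c \<noteq> 0" using False by (simp add: c_def)
        have "\<bar>c / ((c\<^sup>2 + y\<^sup>2) * (c\<^sup>2 + z\<^sup>2))\<bar> = \<bar>c\<bar> / ((c\<^sup>2 + y\<^sup>2) * (c\<^sup>2 + z\<^sup>2))"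
          by (simp add: abs_mult)
        also have "\<dots> \<le> \<bar>c\<bar> / (c\<^sup>2 * c\<^sup>2)"
          using c by (intro divide_left_mono mult_mono mult_pos_pos) (auto simp: add_pos_nonneg)
        also have "c\<^sup>2 * c\<^sup>2 = \<bar>c\<bar> * \<bar>c\<bar> ^ 3"
          by (simp add: power2_eq_square power3_eq_cube)
        also have "\<bar>c\<bar> / (\<bar>c\<bar> * \<bar>c\<bar> ^ 3) = 1 / \<bar>c\<bar> ^ 3"
          using c by simp
        also have "\<dots> \<le> D / (1 + c\<^sup>2)"
          using D(2) False by (simp add: c_def)
        finally show ?thesis
          by (simp add: c_def)
      qed (use D in simp)
      then have "\<bar>\<Sum>j\<in>Jw N. (b + of_int j) / (((b + of_int j)\<^sup>2 + y\<^sup>2) * ((b + of_int j)\<^sup>2 + z\<^sup>2))\<bar> \<le> (\<Sum>j\<in>Jw N. D * (1 / (1 + 1 * (b + of_int j)\<^sup>2)))"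
        by (intro order_trans[OF sum_abs] sum_mono)
      also have "\<dots> = D * (\<Sum>j\<in>Jw N. 1 / (1 + 1 * (b + of_int j)\<^sup>2))"
        by (simp only: sum_distrib_left)
      also have "\<dots> \<le> D * (2 + 8 / sqrt 1)"
        using D by (intro mult_left_mono sum_inverse_square_le finJ) auto
      finally show ?thesis by simp
    qed
    have poly: "\<bar>z * (z + y)\<bar> \<le> 8 * ((1 + x\<^sup>2) * (1 + y\<^sup>2))"
    proof -
      have "\<bar>z\<bar> \<le> 2 * (\<bar>x\<bar> + \<bar>y\<bar>)" "\<bar>z + y\<bar> \<le> 2 * (\<bar>x\<bar> + \<bar>y\<bar>)"
        by (auto simp: z_def)
      then have "\<bar>z * (z + y)\<bar> \<le> (2 * (\<bar>x\<bar> + \<bar>y\<bar>)) * (2 * (\<bar>x\<bar> + \<bar>y\<bar>))"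
        unfolding abs_mult by (intro mult_mono) auto
      also have "\<dots> = 4 * (x\<^sup>2 + 2 * \<bar>x\<bar> * \<bar>y\<bar> + y\<^sup>2)"
        by (simp add: power2_eq_square algebra_simps)
      also have "2 * \<bar>x\<bar> * \<bar>y\<bar> \<le> x\<^sup>2 + y\<^sup>2"
        using sum_squares_bound[of "\<bar>x\<bar>" "\<bar>y\<bar>"] by simp
      also have "4 * (x\<^sup>2 + (x\<^sup>2 + y\<^sup>2) + y\<^sup>2) \<le> 8 * ((1 + x\<^sup>2) * (1 + y\<^sup>2))"
        by (simp add: algebra_simps)
      finally show ?thesis by simp
    qed
    have "\<bar>W N y\<bar> \<le> C * ((1 + x\<^sup>2) * (1 + y\<^sup>2))"
    proof -
      have "C * (1 + y\<^sup>2) \<le> C * ((1 + x\<^sup>2) * (1 + y\<^sup>2))"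
        using C(1) by (intro mult_left_mono) (auto simp: algebra_simps)
      then show ?thesis
        using W[of N y] by linarith
    qed
    moreover have "\<bar>z * (z + y) * (\<Sum>j\<in>Jw N. (b + of_int j) / (((b + of_int j)\<^sup>2 + y\<^sup>2) * ((b + of_int j)\<^sup>2 + z\<^sup>2)))\<bar> \<le>
        8 * ((1 + x\<^sup>2) * (1 + y\<^sup>2)) * (10 * D)"
      unfolding abs_mult[of "z * (z + y)"] using D by (intro mult_mono poly cubic) auto
    ultimately have "\<bar>S N x y\<bar> \<le> 3 / 2 * (C * ((1 + x\<^sup>2) * (1 + y\<^sup>2)) + 8 * ((1 + x\<^sup>2) * (1 + y\<^sup>2)) * (10 * D))"
      unfolding S abs_mult[of "- (3 / 2)"] by (intro mult_mono order_trans[OF abs_triangle_ineq4] add_mono) auto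
    also have "\<dots> = M * (1 + x\<^sup>2) * (1 + y\<^sup>2)"
      by (simp add: M_def field_simps)
    finally show ?thesis .
  next
    case False
    have "S N x y = 0"
    proof (cases "a \<in> \<int>")
      case True
      then show ?thesis
        using False S_int[of _ N x y] by (auto elim!: Ints_cases)
    qed (simp add: S_nonint)
    then show ?thesis
      using M by (simp add: add_nonneg_nonneg)
  qed
  then show "\<exists>C>0. \<forall>N x y. \<bar>S N x y\<bar> \<le> C * (1 + x\<^sup>2) * (1 + y\<^sup>2)"
    using M by blast
  show "(\<lambda>N. S N x y) \<longlonglongrightarrow> (if a \<in> \<int> then 1 / x * (y * (pi * \<G> b y) - (y + 3 * x / 2) * (pi * \<G> b (y + 3 * x / 2))) else 0)"
    if x: "x \<noteq> 0" and y: "y \<noteq> 0" and z: "y + 3 * x / 2 \<noteq> 0"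
  proof (cases "a \<in> \<int>")
    case True
    then obtain m :: int where m: "a = of_int m"
      by (auto elim: Ints_cases)
    have Wlim: "(\<lambda>N. W N r) \<longlonglongrightarrow> pi * \<G> b r" if "r \<noteq> 0" for r
      unfolding W_def by (intro \<G>_window_limit that window_radius_limit) simp
    have "S N x y = 1 / x * (y * W N y - (y + 3 * x / 2) * W N (y + 3 * x / 2))" for N
    proof -
      have "c / x * (y / p - z / q) = 1 / x * (y * (c / p) - z * (c / q))" for c p q z :: real
        by (simp add: right_diff_distrib mult_ac)
      then show ?thesis
        unfolding S_int[OF m] W_def Jw_def[symmetric]
        by (simp only: sum_distrib_left[symmetric] sum_subtractf)
    qed
    then show ?thesis
      using True by (simp only: if_True) (intro tendsto_intros Wlim y z)
  qed (simp add: S_nonint)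
qed

section \<open>Identification of the limit with g2\<close>

lemma \<G>_int: "a \<in> \<int> \<Longrightarrow> \<G> a x = 0"
  and \<F>_int: "a \<in> \<int> \<Longrightarrow> \<F> a x = \<F> 0 x"
proof -
  assume "a \<in> \<int>"
  then obtain m :: int where m: "a = of_int m"
    by (auto elim: Ints_cases)
  have "sin (2 * pi * a) = 0" "cos (2 * pi * a) = 1"
    using sin_int_2pin[of m] cos_int_2pin[of m] by (simp_all add: m)
  then show "\<G> a x = 0" "\<F> a x = \<F> 0 x"
    by (simp_all add: \<G>_def \<F>_def)
qed

lemma g2_measurable: "g2 \<alpha> \<in> borel_measurable borel"
proof -
  have [measurable]: "(sinh :: real \<Rightarrow> real) \<in> borel_measurable borel" "(cosh :: real \<Rightarrow> real) \<in> borel_measurable borel"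
    by (intro borel_measurable_continuous_onI continuous_intros)+
  show ?thesis
    unfolding g2_def case_prod_unfold \<F>_def \<G>_def Gstar_def
    by (cases "fst \<alpha> \<in> \<int>") (simp_all only: simp_thms if_True if_False, measurable)
qed

text \<open>The squares absorb the factor y in front of the second part; polynomial growth is all
  that the Gaussian majorant must control.\<close>

lemma summand_sum_bound:
  fixes \<alpha> :: "real \<times> real"
  shows "\<exists>C. \<forall>N x y. \<bar>\<Sum>k\<in>truncation \<alpha> N. summand (lattice_point \<alpha> k) (x, y)\<bar> \<le> C * (1 + x\<^sup>2)\<^sup>2 * (1 + y\<^sup>2)\<^sup>2"
proof -
  obtain a b where \<alpha>: "\<alpha> = (a, b)" by (cases \<alpha>)
  obtain C1 C2 C3 where C: "C1 > 0" "C2 > 0" "C3 > 0"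
    "\<forall>N x y. \<bar>\<Sum>k\<in>truncation (a, b) N. part1 (lattice_point (a, b) k) x y\<bar> \<le> C1 * (1 + y\<^sup>2) * (1 + x\<^sup>2)"
    "\<forall>N x y. \<bar>\<Sum>k\<in>truncation (a, b) N. part2 (lattice_point (a, b) k) x y\<bar> \<le> C2 * \<bar>x\<bar> * (1 + y\<^sup>2)"
    "\<forall>N x y. \<bar>\<Sum>k\<in>truncation (a, b) N. part3 (lattice_point (a, b) k) x y\<bar> \<le> C3 * (1 + x\<^sup>2) * (1 + y\<^sup>2)"
    using part1_sum(1) part2_sum(1) part3_sum(1) by metis
  have "\<bar>\<Sum>k\<in>truncation (a, b) N. summand (lattice_point (a, b) k) (x, y)\<bar> \<le> (C1 + C2 + C3) * (1 + x\<^sup>2)\<^sup>2 * (1 + y\<^sup>2)\<^sup>2" for N x y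
  proof -
    define X Y where "X = 1 + x\<^sup>2" and "Y = 1 + y\<^sup>2"
    have XY: "X \<ge> 1" "Y \<ge> 1" "\<bar>x\<bar> \<le> X" "\<bar>y\<bar> \<le> Y"
      using sum_squares_bound[of 1 "\<bar>x\<bar>"] sum_squares_bound[of 1 "\<bar>y\<bar>"] by (simp_all add: X_def Y_def)
    have mono: "c * u * v \<le> c * X\<^sup>2 * Y\<^sup>2" if "c \<ge> 0" "0 \<le> u" "u \<le> X" "0 \<le> v" "v \<le> Y\<^sup>2" for c u v
    proof -
      have "X \<le> X\<^sup>2"
        using XY mult_right_mono[of 1 X X] by (simp add: power2_eq_square)
      then have "u \<le> X\<^sup>2"
        using that by linarith
      then show ?thesis
        using that by (intro mult_mono) auto
    qed
    have Y2: "Y \<le> Y\<^sup>2"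
      using XY mult_right_mono[of 1 Y Y] by (simp add: power2_eq_square)
    have "(\<Sum>k\<in>truncation (a, b) N. summand (lattice_point (a, b) k) (x, y)) =
        (\<Sum>k\<in>truncation (a, b) N. part1 (lattice_point (a, b) k) x y) + y * (\<Sum>k\<in>truncation (a, b) N. part2 (lattice_point (a, b) k) x y)
        + (\<Sum>k\<in>truncation (a, b) N. part3 (lattice_point (a, b) k) x y)"
      by (simp add: summand_parts sum.distrib sum_distrib_left)
    moreover have "\<bar>\<Sum>k\<in>truncation (a, b) N. part1 (lattice_point (a, b) k) x y\<bar> \<le> C1 * X\<^sup>2 * Y\<^sup>2"
    proof -
      have "\<bar>\<Sum>k\<in>truncation (a, b) N. part1 (lattice_point (a, b) k) x y\<bar> \<le> C1 * X * Y"
        using C(4) by (simp add: X_def Y_def mult_ac)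
      also have "\<dots> \<le> C1 * X\<^sup>2 * Y\<^sup>2"
        using C XY Y2 by (intro mono) auto
      finally show ?thesis .
    qed
    moreover have "\<bar>y * (\<Sum>k\<in>truncation (a, b) N. part2 (lattice_point (a, b) k) x y)\<bar> \<le> C2 * X\<^sup>2 * Y\<^sup>2"
    proof -
      have "\<bar>y * (\<Sum>k\<in>truncation (a, b) N. part2 (lattice_point (a, b) k) x y)\<bar> \<le> Y * (C2 * \<bar>x\<bar> * Y)"
        unfolding abs_mult Y_def using C(5) XY(4)[unfolded Y_def] by (intro mult_mono) auto
      also have "\<dots> = C2 * \<bar>x\<bar> * Y\<^sup>2"
        by (simp add: power2_eq_square)
      also have "\<dots> \<le> C2 * X\<^sup>2 * Y\<^sup>2"
        using C XY Y2 by (intro mono) auto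
      finally show ?thesis .
    qed
    moreover have "\<bar>\<Sum>k\<in>truncation (a, b) N. part3 (lattice_point (a, b) k) x y\<bar> \<le> C3 * X\<^sup>2 * Y\<^sup>2"
    proof -
      have "\<bar>\<Sum>k\<in>truncation (a, b) N. part3 (lattice_point (a, b) k) x y\<bar> \<le> C3 * X * Y"
        using C(6) by (simp add: X_def Y_def)
      also have "\<dots> \<le> C3 * X\<^sup>2 * Y\<^sup>2"
        using C XY Y2 by (intro mono) auto
      finally show ?thesis .
    qed
    ultimately have "\<bar>\<Sum>k\<in>truncation (a, b) N. summand (lattice_point (a, b) k) (x, y)\<bar> \<le> C1 * X\<^sup>2 * Y\<^sup>2 + C2 * X\<^sup>2 * Y\<^sup>2 + C3 * X\<^sup>2 * Y\<^sup>2"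
      by linarith
    then show ?thesis
      by (simp add: X_def Y_def distrib_right)
  qed
  then show ?thesis
    unfolding \<alpha> by blast
qed

lemma summand_sum_limit:
  fixes \<alpha> :: "real \<times> real"
  assumes x: "x \<noteq> 0" and y: "y \<noteq> 0" and z: "y + 3 * x / 2 \<noteq> 0"
  shows "(\<lambda>N. - (2 * \<i> / of_real (pi\<^sup>2)) * of_real (\<Sum>k\<in>truncation \<alpha> N. summand (lattice_point \<alpha> k) (x, y))) \<longlonglongrightarrow> g2 \<alpha> (x, y)"
proof -
  obtain a b where \<alpha>: "\<alpha> = (a, b)" by (cases \<alpha>)
  define V where "V = y * (pi * \<F> b y) * (pi * \<G> a x) + y * ((pi * \<F> a x - (if a \<in> \<int> then 1 / x else 0)) * (pi * \<G> b y)) +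
     (if a \<in> \<int> then 1 / x * (y * (pi * \<G> b y) - (y + 3 * x / 2) * (pi * \<G> b (y + 3 * x / 2))) else 0)"
  have "(\<lambda>N. (\<Sum>k\<in>truncation (a, b) N. part1 (lattice_point (a, b) k) x y) + y * (\<Sum>k\<in>truncation (a, b) N. part2 (lattice_point (a, b) k) x y)
        + (\<Sum>k\<in>truncation (a, b) N. part3 (lattice_point (a, b) k) x y)) \<longlonglongrightarrow> V"
    unfolding V_def using x y z by (intro tendsto_add tendsto_mult_left part1_sum(2) part2_sum(2) part3_sum(2))
  then have "(\<lambda>N. \<Sum>k\<in>truncation \<alpha> N. summand (lattice_point \<alpha> k) (x, y)) \<longlonglongrightarrow> V"
    by (simp add: \<alpha> summand_parts sum.distrib sum_distrib_left)
  then have "(\<lambda>N. - (2 * \<i> / of_real (pi\<^sup>2)) * of_real (\<Sum>k\<in>truncation \<alpha> N. summand (lattice_point \<alpha> k) (x, y))) \<longlonglongrightarrow> - (2 * \<i> / of_real (pi\<^sup>2)) * of_real V"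
    by (intro tendsto_mult_left tendsto_of_real)
  also have "- (2 * \<i> / of_real (pi\<^sup>2)) * of_real V = - 2 * \<i> * of_real (V / pi\<^sup>2)"
    by simp
  also have "\<dots> = g2 \<alpha> (x, y)"
  proof (cases "a \<in> \<int>")
    case True
    have "V / pi\<^sup>2 = \<F> 0 x * Gstar b y - 1 / (pi * x) * Gstar b (y + 3 * x / 2)"
    proof -
      have "V = pi\<^sup>2 * (\<F> 0 x * Gstar b y) - pi * Gstar b (y + 3 * x / 2) / x"
      proof -
        \<comment> \<open>For integral a the first part vanishes in the limit, and the correction -
          1/x of the second part cancels the first half of the third.\<close>
        have "y * ((p * f - 1 / x) * (p * g)) + 1 / x * (y * (p * g) - u * (p * v)) = p\<^sup>2 * (f * (y * g)) - p * (u * v) / x"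
          for p f g u v
          by (simp add: power2_eq_square algebra_simps)
        then show ?thesis
          using True by (simp add: V_def \<G>_int[OF True] \<F>_int[OF True] Gstar_def)
      qed
      then show ?thesis
        by (simp add: diff_divide_distrib power2_eq_square)
    qed
    then show ?thesis
      using True by (simp add: \<alpha> g2_def)
  next
    case False
    have "V / pi\<^sup>2 = y * (\<G> a x * \<F> b y + \<F> a x * \<G> b y)"
      using False by (simp add: V_def power2_eq_square field_simps)
    then show ?thesis
      using False by (simp add: \<alpha> g2_def)
  qed
  finally show ?thesis .
qed

theorem theorem1p3:
  fixes \<alpha> :: "real \<times> real" and \<tau> :: complex
  assumes "Im \<tau> > 0"
  shows "H2 \<alpha> \<tau> =
    (\<integral>w. g2 \<alpha> w * exp (2 * pi * \<i> * \<tau> * of_real (Q w)) \<partial>(lborel :: (real \<times> real) measure))"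
proof -
  define s where "s = - \<i> * \<tau>"
  have s: "Re s > 0"
    using assms by (simp add: s_def)
  let ?c = "- (2 * \<i> / of_real (pi\<^sup>2))"
  let ?S = "\<lambda>N w. \<Sum>k\<in>truncation \<alpha> N. summand (lattice_point \<alpha> k) w"
  obtain C where C: "\<And>N x y. \<bar>?S N (x, y)\<bar> \<le> C * (1 + x\<^sup>2)\<^sup>2 * (1 + y\<^sup>2)\<^sup>2"
    using summand_sum_bound by blast
  have "(\<lambda>N. LBINT w. ?c * of_real (?S N w) * gauss s w) \<longlonglongrightarrow> (LBINT w. g2 \<alpha> w * gauss s w)"
  proof (rule integral_dominated_convergence)
    show "(\<lambda>w. g2 \<alpha> w * gauss s w) \<in> borel_measurable lborel"
      using g2_measurable[of \<alpha>] by measurable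
    show "integrable lborel (\<lambda>w. norm ?c * (C * (1 + (fst w)\<^sup>2)\<^sup>2 * (1 + (snd w)\<^sup>2)\<^sup>2 * norm (gauss s w)))"
      by (intro integrable_mult_right gauss_majorant_integrable s)
    show "AE w in lborel. (\<lambda>N. ?c * of_real (?S N w) * gauss s w) \<longlonglongrightarrow> g2 \<alpha> w * gauss s w"
      using AE_plane_generic
    proof eventually_elim
      case (elim w)
      then have "(\<lambda>N. ?c * of_real (?S N (fst w, snd w))) \<longlonglongrightarrow> g2 \<alpha> (fst w, snd w)"
        by (intro summand_sum_limit) auto
      then show ?case
        unfolding prod.collapse by (rule tendsto_mult_right)
    qed
    show "AE w in lborel. norm (?c * of_real (?S N w) * gauss s w) \<le>
        norm ?c * (C * (1 + (fst w)\<^sup>2)\<^sup>2 * (1 + (snd w)\<^sup>2)\<^sup>2 * norm (gauss s w))" for N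
    proof (intro AE_I2)
      fix w :: "real \<times> real"
      have "\<bar>?S N w\<bar> \<le> C * (1 + (fst w)\<^sup>2)\<^sup>2 * (1 + (snd w)\<^sup>2)\<^sup>2"
        using C[where N = N and x = "fst w" and y = "snd w"] by simp
      then have "norm ?c * (\<bar>?S N w\<bar> * norm (gauss s w)) \<le> norm ?c * (C * (1 + (fst w)\<^sup>2)\<^sup>2 * (1 + (snd w)\<^sup>2)\<^sup>2 * norm (gauss s w))"
        by (intro mult_left_mono mult_right_mono) auto
      then show "norm (?c * of_real (?S N w) * gauss s w) \<le> norm ?c * (C * (1 + (fst w)\<^sup>2)\<^sup>2 * (1 + (snd w)\<^sup>2)\<^sup>2 * norm (gauss s w))"
        by (simp only: norm_mult norm_of_real mult.assoc)
    qed
  qed measurable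
  moreover have "(LBINT w. ?c * of_real (?S N w) * gauss s w) =
      (\<Sum>k\<in>truncation \<alpha> N. ?c * (LBINT w. of_real (summand (lattice_point \<alpha> k) w) * gauss s w))" for N
  proof -
    have "(LBINT w. ?c * of_real (?S N w) * gauss s w) =
        (LBINT w. \<Sum>k\<in>truncation \<alpha> N. ?c * (of_real (summand (lattice_point \<alpha> k) w) * gauss s w))"
      by (simp only: of_real_sum sum_distrib_left sum_distrib_right mult.assoc)
    also have "\<dots> = (\<Sum>k\<in>truncation \<alpha> N. LBINT w. ?c * (of_real (summand (lattice_point \<alpha> k) w) * gauss s w))"
    proof (rule Bochner_Integration.integral_sum)
      fix k
      show "integrable lborel (\<lambda>w. ?c * (of_real (summand (lattice_point \<alpha> k) w) * gauss s w))"
        using lattice_term_integral(1)[OF s, of "fst (lattice_point \<alpha> k)" "snd (lattice_point \<alpha> k)"]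
        by (intro integrable_mult_right) simp
    qed
    finally show ?thesis
      by (simp only: integral_mult_right_zero)
  qed
  \<comment> \<open>Term by term, the truncated plane integrals are the sequence already known to
    converge to H2, so the two limits coincide.\<close>
  ultimately have "H2 \<alpha> \<tau> = (LBINT w. g2 \<alpha> w * gauss s w)"
    using H2_truncation_limit[OF s s_def, of \<alpha>] by (simp only: LIMSEQ_unique)
  also have "\<dots> = (LBINT w. g2 \<alpha> w * exp (2 * pi * \<i> * \<tau> * of_real (Q w)))"
    by (intro Bochner_Integration.integral_cong) (simp_all add: gauss_def s_def mult_ac)
  finally show ?thesis .
qed

end
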